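(* Let $X$ be a real stationary GeRF over $\mathbb{R}^{d}$ with covariance distribution $\rho_{X}$. Let $g$ be a symbol function over $\mathbb{R}^{d}$ such that $\frac{1}{g}$ is smooth with polynomially bounded derivatives of all orders. Then there exists a unique stationary solution $U$ to $$\mathcal{L}_{g}U \stackrel{2nd\ o.}{=} X,$$ and its covariance distribution is given by $$\rho_{U}=\rho_{U}^{W}\ast\rho_{X},$$ where $\rho_{U}^{W}$ is the covariance distribution of the unique stationary solution to $\mathcal{L}_{g}U\stackrel{2nd\ o.}{=}W$, with $W$ a White Noise over $\mathbb{R}^d$.
   Context: Conventions: $\mathbb{N}=\{0,1,2,\dots\}$. $\mathcal{S}(\mathbb{R}^d)$ is the (complex) Schwartz space and $\mathcal{S}'(\mathbb{R}^d)$ the space of tempered distributions. The Fourier transform is $\mathscr{F}(\varphi)(\xi)=(2\pi)^{-d/2}\int_{\mathbb{R}^d} e^{-i\xi^T x}\varphi(x)dx$ on $\mathcal{S}(\mathbb{R}^d)$, extended to $\mathcal{S}'(\mathbb{R}^d)$ by $\langle\mathscr{F}(T),\varphi\rangle=\langle T,\mathscr{F}(\varphi)\rangle$. Measures: $\mathcal{M}^+_{SG}(\mathbb{R}^d)$ is the set of positive Radon measures $\mu$ on $\mathbb{R}^d$ with $\int(1+|x|^2)^{-N}d\mu(x)<\infty$ for some $N\in\mathbb{N}$, identified with tempered distributions via $\varphi\mapsto\int\varphi\,d\mu$. Symbol functions: a symbol function over $\mathbb{R}^d$ is a continuous, polynomially bounded function $g:\mathbb{R}^d\to\mathbb{C}$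 that is Hermitian-symmetric: $g(x)=\overline{g(-x)}$. Random fields: a GeRF (generalized random field) $Z$ is a continuous linear map $\varphi\mapsto\langle Z,\varphi\rangle$ from $\mathcal{S}(\mathbb{R}^d)$ to $L^2(\Omega,\mathcal{F},\mathbb{P})$ for some probability space (complex-valued square-integrable random variables); it is real if $\langle Z,\varphi\rangle$ is real for real $\varphi$. All GeRFs are assumed to have zero mean. The covariance distribution $C_Z\in\mathcal{S}'(\mathbb{R}^d\times\mathbb{R}^d)$ is determined by $\mathbb{C}ov(\langle Z,\varphi\rangle,\langle Z,\phi\rangle)=\mathbb{E}(\langle Z,\varphi\rangle\overline{\langle Z,\phi\rangle})=\langle C_Z,\varphi\otimes\overline{\phi}\rangle$. A real GeRF $Z$ is (second order) stationary if there is a real even $\rho_Z\in\mathcal{S}'(\mathbb{R}^d)$ with $\langle C_Z,\varphi\otimes\overline{\phi}\rangle=\langle\rho_Z,\varphi\ast\check{\overline{\phi}}\rangle$ for all $\varphi,\phi\in\mathcal{S}(\mathbb{R}^d)$, where $\check{\phi}(x)=\phi(-x)$; $\rho_Z$ is its (stationary) covariance distribution. By the Bochner–Schwartz theorem there is a unique even $\mu_Z\in\mathcal{M}^+_{SG}(\mathbb{R}^d)$ with $\rho_Z=\mathscr{F}(\mu_Z)$, called the spectral measure of $Z$. White Noise: $W$ is a real stationary GeRF with $\langle C_W,\varphi\otimes\overline{\phi}\rangle=\int\varphi\overline{\phi}\,dx$, i.e. $\rho_W=\delta$ (Dirac at $0$) and $d\mu_W(\xi)=(2\pi)^{-d/2}d\xi$.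 The operator on GeRFs: for a GeRF $Z$, $\mathscr{F}(Z)$ and $\mathscr{F}^{-1}(Z)$ are defined by $\langle\mathscr{F}^{\pm1}(Z),\varphi\rangle=\langle Z,\mathscr{F}^{\pm1}(\varphi)\rangle$. If $U$ is a real stationary GeRF, then $M=\mathscr{F}(U)$ satisfies $\mathbb{E}(\langle M,\varphi\rangle\overline{\langle M,\phi\rangle})=(2\pi)^{d/2}\int\varphi\overline{\phi}\,d\mu_U$, and $gM$ is the GeRF $\langle gM,\varphi\rangle:=\langle M,g\varphi\rangle$, where $\langle M,f\rangle$, for a continuous $f$ with $\sup_x(1+|x|^2)^k|f(x)|<\infty$ for all $k\in\mathbb{N}$, is the $L^2$-limit of $\langle M,f_n\rangle$ for any $f_n\in\mathcal{S}(\mathbb{R}^d)$ with $\|(1+|x|^2)^k(f_n-f)\|_\infty\to0$ for every $k\in\mathbb{N}$. Then $\mathcal{L}_gU:=\mathscr{F}^{-1}(g\,\mathscr{F}(U))$. Solutions: $\mathcal{L}_gU\stackrel{2nd\ o.}{=}X$ means that $\mathcal{L}_gU$ and $X$ have the same covariance distribution. A stationary solution is a real stationary GeRF $U$ satisfying this; since the equation only concerns covariances, uniqueness is understood as uniqueness of the spectral measure (equivalently covariance distribution) of the stationary solution. Convolution: if $f$ is a smooth function on $\mathbb{R}^d$ all of whose derivatives are polynomially bounded (i.e. $f\in\mathcal{O}_M(\mathbb{R}^d)$), then $S=\mathscr{F}(f)$ is convolvable with every $T\in\mathcal{S}'(\mathbb{R}^d)$: $\check S\ast\varphi\in\mathcal{S}(\mathbb{R}^d)$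 for $\varphi\in\mathcal{S}(\mathbb{R}^d)$ (with $\check S$ the reflection of $S$), and $S\ast T\in\mathcal{S}'(\mathbb{R}^d)$ is $\langle S\ast T,\varphi\rangle=\langle T,\check S\ast\varphi\rangle$. *)

theory Defs
  imports "HOL-Probability.Probability"
begin

section \<open>Smooth and rapidly decreasing functions\<close>

text \<open>
  A mixed partial derivative is indexed by the list of the coordinate directions in which one
  differentiates; on smooth functions the order in the list is irrelevant, so lists over
  \<^term>\<open>Basis\<close> carry the same information as multi-indices.
\<close>

primrec partials :: "'a::euclidean_space list \<Rightarrow> ('a \<Rightarrow> complex) \<Rightarrow> 'a \<Rightarrow> complex" where
  "partials [] f = f"
| "partials (b # bs) f = (\<lambda>x. frechet_derivative (partials bs f) (at x) b)"

definition smooth :: "('a::euclidean_space \<Rightarrow> complex) \<Rightarrow> bool" where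
  "smooth f \<longleftrightarrow> (\<forall>bs\<in>lists Basis. partials bs f differentiable_on UNIV)"

definition polynomially_bounded :: "('a::euclidean_space \<Rightarrow> complex) \<Rightarrow> bool" where
  "polynomially_bounded f \<longleftrightarrow> (\<exists>C. \<exists>N::nat. \<forall>x. cmod (f x) \<le> C * (1 + (norm x)\<^sup>2) ^ N)"

text \<open>The space usually denoted \<open>O\<^sub>M\<close>.\<close>

definition slowly_increasing :: "('a::euclidean_space \<Rightarrow> complex) set" where
  "slowly_increasing =
     {f. smooth f \<and> (\<forall>bs\<in>lists Basis. polynomially_bounded (partials bs f))}"

definition symbol_function :: "('a::euclidean_space \<Rightarrow> complex) \<Rightarrow> bool" where
  "symbol_function g \<longleftrightarrow>
     continuous_on UNIV g \<and> polynomially_bounded g \<and> (\<forall>x. g x = cnj (g (- x)))"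

definition weighted :: "nat \<Rightarrow> ('a::euclidean_space \<Rightarrow> complex) \<Rightarrow> 'a \<Rightarrow> real" where
  "weighted k f x = (1 + (norm x)\<^sup>2) ^ k * cmod (f x)"

text \<open>This supremum is meaningful only where the weighted function is bounded.\<close>

definition weighted_sup :: "nat \<Rightarrow> ('a::euclidean_space \<Rightarrow> complex) \<Rightarrow> real" where
  "weighted_sup k f = (SUP x. weighted k f x)"

definition schwartz :: "('a::euclidean_space \<Rightarrow> complex) set" where
  "schwartz =
     {f. smooth f \<and> (\<forall>k. \<forall>bs\<in>lists Basis. bdd_above (range (weighted k (partials bs f))))}"

text \<open>
  Neighbourhood filter of a Schwartz function in the locally convex topology given by the
  seminorms \<open>weighted_sup k (partials bs f)\<close>.
\<close>

definition schwartz_nhds ::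
    "('a::euclidean_space \<Rightarrow> complex) \<Rightarrow> ('a \<Rightarrow> complex) filter" where
  "schwartz_nhds f =
     (INF (k, bs, e) \<in> UNIV \<times> lists Basis \<times> {0<..}.
        principal {h \<in> schwartz. weighted_sup k (partials bs (\<lambda>x. h x - f x)) < e})"

definition reflect :: "('a::euclidean_space \<Rightarrow> complex) \<Rightarrow> 'a \<Rightarrow> complex" where
  "reflect f x = f (- x)"

definition fun_convolution ::
    "('a::euclidean_space \<Rightarrow> complex) \<Rightarrow> ('a \<Rightarrow> complex) \<Rightarrow> 'a \<Rightarrow> complex" where
  "fun_convolution f h x = (LINT y|lborel. f y * h (x - y))"

definition tensor ::
    "('a::euclidean_space \<Rightarrow> complex) \<Rightarrow> ('a \<Rightarrow> complex) \<Rightarrow> 'a \<times> 'a \<Rightarrow> complex" where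
  "tensor f h = (\<lambda>(x, y). f x * h y)"

definition fourier :: "('a::euclidean_space \<Rightarrow> complex) \<Rightarrow> 'a \<Rightarrow> complex" where
  "fourier f \<xi> =
     complex_of_real ((2 * pi) powr (- (real DIM('a) / 2))) *
       (LINT x|lborel. exp (- \<i> * complex_of_real (\<xi> \<bullet> x)) * f x)"

definition inv_fourier :: "('a::euclidean_space \<Rightarrow> complex) \<Rightarrow> 'a \<Rightarrow> complex" where
  "inv_fourier f x =
     complex_of_real ((2 * pi) powr (- (real DIM('a) / 2))) *
       (LINT \<xi>|lborel. exp (\<i> * complex_of_real (\<xi> \<bullet> x)) * f \<xi>)"


section \<open>Tempered distributions\<close>

text \<open>
  Distributions are functionals that are \<^term>\<open>undefined\<close> off the Schwartz space, so that HOL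
  equality of two of them means equality on all Schwartz functions.
\<close>

definition tempered_distributions ::
    "(('a::euclidean_space \<Rightarrow> complex) \<Rightarrow> complex) set" where
  "tempered_distributions =
     {T \<in> extensional schwartz.
        (\<forall>f\<in>schwartz. \<forall>h\<in>schwartz. \<forall>a b.
           T (\<lambda>x. a * f x + b * h x) = a * T f + b * T h) \<and>
        (\<forall>f\<in>schwartz. (T \<longlongrightarrow> T f) (schwartz_nhds f))}"

definition dist_of_fun ::
    "('a::euclidean_space \<Rightarrow> complex) \<Rightarrow> ('a \<Rightarrow> complex) \<Rightarrow> complex" where
  "dist_of_fun f = (\<lambda>h\<in>schwartz. LINT x|lborel. f x * h x)"

definition dist_fourier ::
    "(('a::euclidean_space \<Rightarrow> complex) \<Rightarrow> complex) \<Rightarrow> ('a \<Rightarrow> complex) \<Rightarrow> complex" where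
  "dist_fourier T = (\<lambda>h\<in>schwartz. T (fourier h))"

definition dist_reflect ::
    "(('a::euclidean_space \<Rightarrow> complex) \<Rightarrow> complex) \<Rightarrow> ('a \<Rightarrow> complex) \<Rightarrow> complex" where
  "dist_reflect T = (\<lambda>h\<in>schwartz. T (reflect h))"

definition real_distribution ::
    "(('a::euclidean_space \<Rightarrow> complex) \<Rightarrow> complex) \<Rightarrow> bool" where
  "real_distribution T \<longleftrightarrow> (\<forall>h\<in>schwartz. range h \<subseteq> \<real> \<longrightarrow> T h \<in> \<real>)"

definition even_distribution ::
    "(('a::euclidean_space \<Rightarrow> complex) \<Rightarrow> complex) \<Rightarrow> bool" where
  "even_distribution T \<longleftrightarrow> dist_reflect T = T"

definition dist_conv_fun ::
    "(('a::euclidean_space \<Rightarrow> complex) \<Rightarrow> complex) \<Rightarrow> ('a \<Rightarrow> complex) \<Rightarrow> 'a \<Rightarrow> complex" where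
  "dist_conv_fun S h x = S (\<lambda>y. h (x - y))"

text \<open>
  The convolution \<open>dist_convolution S T\<close> is meaningful for \<open>S\<close> in \<open>convolvable\<close> and
  \<open>T\<close> tempered: then \<open>dist_conv_fun (dist_reflect S)\<close> maps Schwartz functions to Schwartz
  functions.
\<close>

definition convolvable :: "(('a::euclidean_space \<Rightarrow> complex) \<Rightarrow> complex) set" where
  "convolvable = (\<lambda>f. dist_fourier (dist_of_fun f)) ` slowly_increasing"

definition dist_convolution ::
    "(('a::euclidean_space \<Rightarrow> complex) \<Rightarrow> complex) \<Rightarrow> (('a \<Rightarrow> complex) \<Rightarrow> complex) \<Rightarrow>
     ('a \<Rightarrow> complex) \<Rightarrow> complex" where
  "dist_convolution S T = (\<lambda>h\<in>schwartz. T (dist_conv_fun (dist_reflect S) h))"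


section \<open>Generalized random fields\<close>

definition square_integrable :: "'w measure \<Rightarrow> ('w \<Rightarrow> complex) \<Rightarrow> bool" where
  "square_integrable P Y \<longleftrightarrow>
     Y \<in> borel_measurable P \<and> integrable P (\<lambda>\<omega>. (cmod (Y \<omega>))\<^sup>2)"

definition L2_dist_sq :: "'w measure \<Rightarrow> ('w \<Rightarrow> complex) \<Rightarrow> ('w \<Rightarrow> complex) \<Rightarrow> real" where
  "L2_dist_sq P Y Y' = (LINT \<omega>|P. (cmod (Y \<omega> - Y' \<omega>))\<^sup>2)"

text \<open>
  A field assigns to a Schwartz function a representative of an element of \<open>L\<^sup>2(P)\<close>; identities
  between random variables are therefore almost sure ones. Fields are centred.
\<close>

definition gerf ::
    "'w measure \<Rightarrow> (('a::euclidean_space \<Rightarrow> complex) \<Rightarrow> 'w \<Rightarrow> complex) \<Rightarrow> bool" where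
  "gerf P Z \<longleftrightarrow>
     prob_space P \<and>
     (\<forall>f\<in>schwartz. square_integrable P (Z f)) \<and>
     (\<forall>f\<in>schwartz. \<forall>h\<in>schwartz. \<forall>a b.
        AE \<omega> in P. Z (\<lambda>x. a * f x + b * h x) \<omega> = a * Z f \<omega> + b * Z h \<omega>) \<and>
     (\<forall>f\<in>schwartz. ((\<lambda>h. L2_dist_sq P (Z h) (Z f)) \<longlongrightarrow> 0) (schwartz_nhds f)) \<and>
     (\<forall>f\<in>schwartz. (LINT \<omega>|P. Z f \<omega>) = 0)"

definition real_gerf ::
    "'w measure \<Rightarrow> (('a::euclidean_space \<Rightarrow> complex) \<Rightarrow> 'w \<Rightarrow> complex) \<Rightarrow> bool" where
  "real_gerf P Z \<longleftrightarrow>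
     gerf P Z \<and> (\<forall>f\<in>schwartz. range f \<subseteq> \<real> \<longrightarrow> (AE \<omega> in P. Z f \<omega> \<in> \<real>))"

definition covariance_distribution ::
    "'w measure \<Rightarrow> (('a::euclidean_space \<Rightarrow> complex) \<Rightarrow> 'w \<Rightarrow> complex) \<Rightarrow>
     (('a \<times> 'a \<Rightarrow> complex) \<Rightarrow> complex) \<Rightarrow> bool" where
  "covariance_distribution P Z C \<longleftrightarrow>
     gerf P Z \<and> C \<in> tempered_distributions \<and>
     (\<forall>f\<in>schwartz. \<forall>h\<in>schwartz.
        (LINT \<omega>|P. Z f \<omega> * cnj (Z h \<omega>)) = C (tensor f (\<lambda>x. cnj (h x))))"

definition real_stationary_gerf ::
    "'w measure \<Rightarrow> (('a::euclidean_space \<Rightarrow> complex) \<Rightarrow> 'w \<Rightarrow> complex) \<Rightarrow>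
     (('a \<Rightarrow> complex) \<Rightarrow> complex) \<Rightarrow> bool" where
  "real_stationary_gerf P Z \<rho> \<longleftrightarrow>
     real_gerf P Z \<and>
     \<rho> \<in> tempered_distributions \<and> real_distribution \<rho> \<and> even_distribution \<rho> \<and>
     (\<exists>C. covariance_distribution P Z C \<and>
        (\<forall>f\<in>schwartz. \<forall>h\<in>schwartz.
           C (tensor f (\<lambda>x. cnj (h x))) = \<rho> (fun_convolution f (reflect (\<lambda>x. cnj (h x))))))"

definition white_noise ::
    "'w measure \<Rightarrow> (('a::euclidean_space \<Rightarrow> complex) \<Rightarrow> 'w \<Rightarrow> complex) \<Rightarrow> bool" where
  "white_noise P W \<longleftrightarrow>
     (\<exists>\<rho>. real_stationary_gerf P W \<rho>) \<and>
     (\<exists>C. covariance_distribution P W C \<and>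
        (\<forall>f\<in>schwartz. \<forall>h\<in>schwartz.
           C (tensor f (\<lambda>x. cnj (h x))) = (LINT x|lborel. f x * cnj (h x))))"

definition gerf_fourier ::
    "(('a::euclidean_space \<Rightarrow> complex) \<Rightarrow> 'w \<Rightarrow> complex) \<Rightarrow> ('a \<Rightarrow> complex) \<Rightarrow> 'w \<Rightarrow> complex" where
  "gerf_fourier Z f = Z (fourier f)"

definition gerf_inv_fourier ::
    "(('a::euclidean_space \<Rightarrow> complex) \<Rightarrow> 'w \<Rightarrow> complex) \<Rightarrow> ('a \<Rightarrow> complex) \<Rightarrow> 'w \<Rightarrow> complex" where
  "gerf_inv_fourier Z f = Z (inv_fourier f)"

text \<open>
  \<open>gerf_extend P M f\<close> is a representative of the \<open>L\<^sup>2\<close>-limit of \<open>M (F n)\<close>, common to all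
  sequences \<open>F\<close> of Schwartz functions that approximate the continuous, rapidly decreasing
  function \<open>f\<close> in every weighted supremum norm.
\<close>

definition gerf_extend ::
    "'w measure \<Rightarrow> (('a::euclidean_space \<Rightarrow> complex) \<Rightarrow> 'w \<Rightarrow> complex) \<Rightarrow>
     ('a \<Rightarrow> complex) \<Rightarrow> 'w \<Rightarrow> complex" where
  "gerf_extend P M f =
     (SOME Y. square_integrable P Y \<and>
        (\<forall>F. (\<forall>n::nat. F n \<in> schwartz) \<and>
             (\<forall>k. (\<lambda>n. weighted_sup k (\<lambda>x. F n x - f x)) \<longlonglongrightarrow> 0) \<longrightarrow>
             (\<lambda>n. L2_dist_sq P (M (F n)) Y) \<longlonglongrightarrow> 0))"

definition gerf_mult ::
    "'w measure \<Rightarrow> ('a::euclidean_space \<Rightarrow> complex) \<Rightarrow> (('a \<Rightarrow> complex) \<Rightarrow> 'w \<Rightarrow> complex) \<Rightarrow>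
     ('a \<Rightarrow> complex) \<Rightarrow> 'w \<Rightarrow> complex" where
  "gerf_mult P g M f = gerf_extend P M (\<lambda>x. g x * f x)"

definition symbol_operator ::
    "'w measure \<Rightarrow> ('a::euclidean_space \<Rightarrow> complex) \<Rightarrow> (('a \<Rightarrow> complex) \<Rightarrow> 'w \<Rightarrow> complex) \<Rightarrow>
     ('a \<Rightarrow> complex) \<Rightarrow> 'w \<Rightarrow> complex" where
  "symbol_operator P g U = gerf_inv_fourier (gerf_mult P g (gerf_fourier U))"

text \<open>Equality of covariance distributions; the two fields may live on different spaces.\<close>

definition second_order_eq ::
    "'v measure \<Rightarrow> (('a::euclidean_space \<Rightarrow> complex) \<Rightarrow> 'v \<Rightarrow> complex) \<Rightarrow>
     'w measure \<Rightarrow> (('a \<Rightarrow> complex) \<Rightarrow> 'w \<Rightarrow> complex) \<Rightarrow> bool" where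
  "second_order_eq Q Z P X \<longleftrightarrow>
     (\<exists>C. covariance_distribution Q Z C \<and> covariance_distribution P X C)"

text \<open>
  \<open>U\<close>, a field on \<open>Q\<close> with stationary covariance distribution \<open>\<rho>\<close>, solves the equation with
  symbol \<open>g\<close> and right-hand side \<open>X\<close>, a field on \<open>P\<close>.
\<close>

definition stationary_solution ::
    "('a::euclidean_space \<Rightarrow> complex) \<Rightarrow>
     'w measure \<Rightarrow> (('a \<Rightarrow> complex) \<Rightarrow> 'w \<Rightarrow> complex) \<Rightarrow>
     'v measure \<Rightarrow> (('a \<Rightarrow> complex) \<Rightarrow> 'v \<Rightarrow> complex) \<Rightarrow>
     (('a \<Rightarrow> complex) \<Rightarrow> complex) \<Rightarrow> bool" where
  "stationary_solution g P X Q U \<rho> \<longleftrightarrow>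
     real_stationary_gerf Q U \<rho> \<and> second_order_eq Q (symbol_operator Q g U) P X"

end

theory Submission
  imports Defs
begin

text \<open>
  On the Fourier side the operator with symbol \<open>g\<close> is multiplication by \<open>g\<close>, so the candidate solution
  is \<open>X\<close> composed with the Fourier multiplier \<open>1 / g\<close>, and its covariance is \<open>\<rho>X\<close> composed with the
  multiplier \<open>1 / \<bar>g\<bar>\<^sup>2\<close>. Since \<open>1 / g\<close> is smooth and \<open>g\<close> has polynomial growth, \<open>g\<close> is itself smooth with
  polynomially bounded derivatives, and both multipliers act on Schwartz functions. For white noise \<open>\<rho>W\<close>
  is evaluation at \<open>0\<close>, so convolving with the covariance of its solution is the multiplier \<open>1 / \<bar>g\<bar>\<^sup>2\<close>.

  Uniqueness holds because a tempered functional is determined by its values on the products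
  \<open>a * cnj b\<close> of Schwartz functions: multiplication by ever wider Gaussians recovers every Schwartz function.

  The extension of \<open>\<F>(U)\<close> to continuous functions needs \<open>E \<bar>\<F>(U)(h)\<bar>\<^sup>2\<close> to be controlled by weighted suprema
  of \<open>h\<close>. The Bochner-Schwartz theorem is not needed for this: the moment is \<open>T (\<bar>h\<bar>\<^sup>2)\<close> for a tempered
  functional \<open>T\<close> that is nonnegative on squares, and if \<open>q\<close> dominates \<open>\<bar>h\<bar>\<^sup>2\<close> then \<open>q - \<bar>h\<bar>\<^sup>2\<close> is again a
  square, so that \<open>T (\<bar>h\<bar>\<^sup>2) \<le> T q\<close>.
\<close>

section \<open>Weighted derivative bounds\<close>

text \<open>A field is known only through its second moments, and on the Fourier side these are
  values on products: stationarity and the convolution theorem give E(U(F a) cnj(U(F b))) = (2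
  pi)^(d/2) \<rho>(F(a cnj b)). So \<rho> composed with F stands in for the spectral measure, and
  |g|^2 enters when a, b are replaced by g a, g b.

  The delicate point is that g M is defined by choosing an L2-limit along approximations that
  converge in weighted suprema, with no control of derivatives. Although g f is a Schwartz function
  and U(F(g f)) the obvious candidate, continuity of U in the Schwartz topology does not show that
  it is the limit. Without a moment bound free of derivatives the chosen representative would remain
  unspecified.

  Continuity is expressed by explicit estimates with one constant for all derivatives up to a given
  order. Composing operators then means composing bounds, and constants can be kept uniform in the
  parameter of the Gaussians.\<close>

definition dpart :: "'a::euclidean_space \<Rightarrow> ('a \<Rightarrow> complex) \<Rightarrow> 'a \<Rightarrow> complex" where
  "dpart b f = (\<lambda>x. frechet_derivative f (at x) b)"

text \<open>The weight of \<open>weighted\<close>, the square of the Japanese bracket. It is smooth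
  and at least 1, so its integer powers are monotone in the exponent and can themselves serve as
  multipliers.\<close>

definition wt :: "'a::euclidean_space \<Rightarrow> real" where
  "wt x = 1 + (norm x)\<^sup>2"

text \<open>
  A negative weight \<open>m\<close> expresses decay and a positive one polynomial growth, so that one calculus
  serves both Schwartz functions and their multipliers.
\<close>

primrec wbd :: "nat \<Rightarrow> int \<Rightarrow> real \<Rightarrow> ('a::euclidean_space \<Rightarrow> complex) \<Rightarrow> bool" where
  "wbd 0 m C f \<longleftrightarrow> (\<forall>x. cmod (f x) \<le> C * wt x powi m)"
| "wbd (Suc n) m C f \<longleftrightarrow> (\<forall>x. cmod (f x) \<le> C * wt x powi m) \<and>
     (\<forall>x. f differentiable at x) \<and> (\<forall>b\<in>Basis. wbd n m C (dpart b f))"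

lemma wt_ge_1 [simp]: "1 \<le> wt x"
  by (simp add: wt_def)

lemma wt_pos [simp]: "0 < wt x"
  using wt_ge_1[of x] by linarith

lemma wt_nonneg [simp]: "0 \<le> wt x"
  using wt_pos[of x] by linarith

lemma wt_nonzero [simp]: "wt x \<noteq> 0"
  using wt_pos[of x] by linarith

lemma wt_zero [simp]: "wt 0 = 1"
  by (simp add: wt_def)

lemma wt_minus [simp]: "wt (- x) = wt x"
  by (simp add: wt_def)

lemma wt_powi_add: "wt x powi (m + k) = wt x powi m * wt x powi k"
  by (simp add: power_int_add)

lemma wt_powi_mono: "m \<le> k \<Longrightarrow> wt x powi m \<le> wt x powi k"
  by (simp add: power_int_increasing)

lemma wt_powi_pos [simp]: "0 < wt x powi m"
  by (simp add: zero_less_power_int)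

lemma norm_le_wt: "norm x \<le> wt x"
proof -
  have "0 \<le> (norm x - 1)\<^sup>2 + (norm x)\<^sup>2 + 1" by simp
  then show ?thesis unfolding wt_def power2_eq_square by (simp add: algebra_simps)
qed

text \<open>A form of Peetre's inequality. Applied to a shifted point and the opposite shift, it
  bounds the weight before the shift by the weight after it, up to a factor depending on the shift
  alone.\<close>

lemma wt_add: "wt (x + y) \<le> 2 * (wt x * wt y)"
proof -
  have "(norm (x + y))\<^sup>2 \<le> (norm x + norm y)\<^sup>2"
    by (simp add: norm_triangle_ineq power_mono)
  also have "\<dots> \<le> 2 * (norm x)\<^sup>2 + 2 * (norm y)\<^sup>2"
    using sum_squares_bound[of "norm x" "norm y"] by (simp add: power2_sum)
  finally have "1 + (norm (x + y))\<^sup>2 \<le> 1 + 2 * (norm x)\<^sup>2 + 2 * (norm y)\<^sup>2" by simp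
  moreover have "0 \<le> (norm x)\<^sup>2 * (norm y)\<^sup>2" by simp
  moreover have "2 * (wt x * wt y) = 2 + 2 * (norm x)\<^sup>2 + 2 * (norm y)\<^sup>2 + 2 * ((norm x)\<^sup>2 * (norm y)\<^sup>2)"
    by (simp add: wt_def algebra_simps)
  ultimately show ?thesis unfolding wt_def[of "x + y"] by linarith
qed

lemma wbd_bound: "wbd n m C f \<Longrightarrow> cmod (f x) \<le> C * wt x powi m"
  by (cases n) auto

lemma wbd_nonneg: "wbd n m C f \<Longrightarrow> 0 \<le> C"
  using wbd_bound[of n m C f 0] norm_ge_zero[of "f 0"] by (simp, linarith)

lemma wbd_SucD:
  assumes "wbd (Suc n) m C f"
  shows "f differentiable at x" "b \<in> Basis \<Longrightarrow> wbd n m C (dpart b f)"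
  using assms by auto

lemma wbd_mono:
  assumes "wbd n m C f" "n' \<le> n" "m \<le> m'" "C \<le> C'"
  shows "wbd n' m' C' f"
proof -
  have *: "cmod (f x) \<le> C' * wt x powi m'" if "wbd n m C f" for n f and x :: 'a
  proof -
    have "cmod (f x) \<le> C * wt x powi m" using wbd_bound[OF that] .
    also have "\<dots> \<le> C' * wt x powi m'"
      using wbd_nonneg[OF assms(1)] assms by (intro mult_mono wt_powi_mono) (auto simp: less_imp_le)
    finally show ?thesis .
  qed
  show ?thesis using assms(1,2)
  proof (induction n' arbitrary: n f)
    case 0 then show ?case using * by auto
  next
    case (Suc n')
    then obtain k where k: "n = Suc k" "n' \<le> k" by (cases n) auto
    have "cmod (f x) \<le> C' * wt x powi m'" for x using *[OF Suc.prems(1)] .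
    with Suc k show ?case by auto
  qed
qed

section \<open>Calculus of directional derivatives\<close>

lemma has_derivative_dpart:
  "f differentiable at x \<Longrightarrow> (f has_derivative (\<lambda>h. \<Sum>b\<in>Basis. (h \<bullet> b) *\<^sub>R dpart b f x)) (at x)"
proof -
  assume f: "f differentiable at x"
  then have D: "(f has_derivative frechet_derivative f (at x)) (at x)"
    by (simp add: frechet_derivative_works)
  then interpret bounded_linear "frechet_derivative f (at x)"
    by (rule has_derivative_bounded_linear)
  have "frechet_derivative f (at x) = (\<lambda>h. \<Sum>b\<in>Basis. (h \<bullet> b) *\<^sub>R dpart b f x)"
  proof
    fix h
    have "frechet_derivative f (at x) h = frechet_derivative f (at x) (\<Sum>b\<in>Basis. (h \<bullet> b) *\<^sub>R b)"
      by (simp add: euclidean_representation)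
    also have "\<dots> = (\<Sum>b\<in>Basis. (h \<bullet> b) *\<^sub>R dpart b f x)"
      by (simp add: sum scaleR dpart_def)
    finally show "frechet_derivative f (at x) h = (\<Sum>b\<in>Basis. (h \<bullet> b) *\<^sub>R dpart b f x)" .
  qed
  with D show ?thesis by simp
qed

lemma dpart_eqI: "(f has_derivative D) (at x) \<Longrightarrow> dpart b f x = D b"
  unfolding dpart_def by (metis frechet_derivative_at)

lemma frechet_works: "f differentiable at x \<Longrightarrow> (f has_derivative (\<lambda>b. dpart b f x)) (at x)"
  unfolding dpart_def by (simp add: frechet_derivative_works)

lemma dpart_add:
  assumes "\<And>x. f differentiable at x" "\<And>x. h differentiable at x"
  shows "dpart b (\<lambda>x. f x + h x) = (\<lambda>x. dpart b f x + dpart b h x)"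
  by (intro ext dpart_eqI[OF has_derivative_add[OF frechet_works frechet_works]] assms)

lemma dpart_mult:
  assumes "\<And>x. f differentiable at x" "\<And>x. h differentiable at x"
  shows "dpart b (\<lambda>x. f x * h x) = (\<lambda>x. f x * dpart b h x + dpart b f x * h x)"
  by (intro ext dpart_eqI[OF has_derivative_mult[OF frechet_works frechet_works]] assms)

lemma dpart_cmult:
  assumes "\<And>x. f differentiable at x"
  shows "dpart b (\<lambda>x. c * f x) = (\<lambda>x. c * dpart b f x)"
  by (intro ext dpart_eqI[OF has_derivative_mult_right[OF frechet_works]] assms)

lemma dpart_cnj:
  assumes "\<And>x. f differentiable at x"
  shows "dpart b (\<lambda>x. cnj (f x)) = (\<lambda>x. cnj (dpart b f x))"
  by (intro ext dpart_eqI[OF has_derivative_cnj[OF frechet_works]] assms)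

lemma dpart_affine:
  assumes "\<And>x. f differentiable at x"
  shows "((\<lambda>x. f (a + s *\<^sub>R x)) has_derivative (\<lambda>h. s *\<^sub>R dpart h f (a + s *\<^sub>R x))) (at x)"
    and "dpart b (\<lambda>x. f (a + s *\<^sub>R x)) = (\<lambda>x. s *\<^sub>R dpart b f (a + s *\<^sub>R x))"
proof -
  have *: "((\<lambda>x. f (a + s *\<^sub>R x)) has_derivative (\<lambda>h. s *\<^sub>R dpart h f (a + s *\<^sub>R x))) (at x)" for x
  proof -
    have "((\<lambda>x. a + s *\<^sub>R x) has_derivative (\<lambda>h. s *\<^sub>R h)) (at x)"
      by (auto intro!: derivative_eq_intros)
    from has_derivative_compose[OF this frechet_works[OF assms]]
    have "((\<lambda>x. f (a + s *\<^sub>R x)) has_derivative (\<lambda>h. dpart (s *\<^sub>R h) f (a + s *\<^sub>R x))) (at x)" .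
    moreover have "dpart (s *\<^sub>R h) f y = s *\<^sub>R dpart h f y" for h y
      by (rule linear_cmul[OF bounded_linear.linear[OF has_derivative_bounded_linear[OF frechet_works[OF assms]]]])
    ultimately show ?thesis by simp
  qed
  show "((\<lambda>x. f (a + s *\<^sub>R x)) has_derivative (\<lambda>h. s *\<^sub>R dpart h f (a + s *\<^sub>R x))) (at x)" by (rule *)
  show "dpart b (\<lambda>x. f (a + s *\<^sub>R x)) = (\<lambda>x. s *\<^sub>R dpart b f (a + s *\<^sub>R x))"
    by (intro ext dpart_eqI[OF *])
qed

lemma dpart_reflect:
  assumes "\<And>x. f differentiable at x"
  shows "reflect f differentiable at x" "dpart b (reflect f) = (\<lambda>x. - reflect (dpart b f) x)"
  using dpart_affine[OF assms, where a = 0 and s = "-1"] unfolding reflect_def[abs_def]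
  by (auto simp: differentiable_def)

section \<open>Stability of the bounds under algebraic operations\<close>

lemma wbd_add:
  assumes "wbd n m C f" "wbd n m C' h"
  shows "wbd n m (C + C') (\<lambda>x. f x + h x)"
  using assms
proof (induction n arbitrary: f h)
  case 0
  then show ?case
    by (auto simp: distrib_right intro!: norm_triangle_mono)
next
  case (Suc n)
  then show ?case
    by (auto simp: distrib_right dpart_add intro!: norm_triangle_mono)
qed

lemma wbd_cmult:
  assumes "wbd n m C f"
  shows "wbd n m (cmod c * C) (\<lambda>x. c * f x)"
  using assms
  by (induction n arbitrary: f) (auto simp: norm_mult mult.assoc dpart_cmult intro!: mult_left_mono)

lemma wbd_minus: "wbd n m C f \<Longrightarrow> wbd n m C (\<lambda>x. - f x)"
  using wbd_cmult[of n m C f "-1"] by simp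

lemma wbd_cnj:
  assumes "wbd n m C f"
  shows "wbd n m C (\<lambda>x. cnj (f x))"
  using assms
proof (induction n arbitrary: f)
  case (Suc n)
  then have "(\<lambda>x. cnj (f x)) differentiable at x" for x
    using has_derivative_cnj[OF frechet_works, of f x] by (auto simp: differentiable_def)
  with Suc show ?case by (auto simp: dpart_cnj)
qed auto

lemma wbd_reflect:
  assumes "wbd n m C f"
  shows "wbd n m C (reflect f)"
  using assms
proof (induction n arbitrary: f)
  case 0 then show ?case by (auto simp: reflect_def) (metis wt_minus)
next
  case (Suc n)
  then have "cmod (reflect f x) \<le> C * wt x powi m" for x
    by (auto simp: reflect_def) (metis wt_minus)
  with Suc show ?case by (auto simp: dpart_reflect intro!: wbd_minus)
qed

text \<open>Weights add up, and the factor \<open>2 ^ n\<close> counts the terms of the Leibniz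
  rule: every further derivative splits the product in two.\<close>

lemma wbd_mult:
  assumes "wbd n m C f" "wbd n k D h"
  shows "wbd n (m + k) (2 ^ n * C * D) (\<lambda>x. f x * h x)"
  using assms
proof (induction n arbitrary: f h)
  have base: "cmod (f x * h x) \<le> 2 ^ n * C * D * wt x powi (m + k)"
    if f: "wbd n m C f" and h: "wbd n k D h" for n f h and x :: 'a
  proof -
    have CD: "0 \<le> C" "0 \<le> D" using f h wbd_nonneg by blast+
    have "cmod (f x * h x) \<le> (C * wt x powi m) * (D * wt x powi k)"
      unfolding norm_mult using CD by (intro mult_mono wbd_bound[OF f] wbd_bound[OF h]) auto
    also have "\<dots> = 1 * (C * D * wt x powi (m + k))"
      by (simp add: wt_powi_add mult_ac)
    also have "\<dots> \<le> 2 ^ n * (C * D * wt x powi (m + k))"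
      using CD by (intro mult_right_mono) (auto simp: less_imp_le)
    finally show ?thesis by (simp add: mult_ac)
  qed
  {
    case 0
    then show ?case using base[OF 0] by simp
  next
    case (Suc n)
    note f = wbd_mono[OF Suc.prems(1), of n m C] and h = wbd_mono[OF Suc.prems(2), of n k D]
    have "wbd n (m + k) (2 ^ Suc n * C * D) (dpart b (\<lambda>x. f x * h x))" if b: "b \<in> Basis" for b
    proof -
      have "wbd n (m + k) (2 ^ n * C * D + 2 ^ n * C * D) (\<lambda>x. f x * dpart b h x + dpart b f x * h x)"
        using f h Suc.IH wbd_SucD(2)[OF Suc.prems(1) b] wbd_SucD(2)[OF Suc.prems(2) b] by (intro wbd_add) auto
      moreover have "dpart b (\<lambda>x. f x * h x) = (\<lambda>x. f x * dpart b h x + dpart b f x * h x)"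
        by (rule dpart_mult) (use Suc.prems in auto)
      ultimately show ?thesis by (simp add: mult_ac)
    qed
    then show ?case
      using base[OF Suc.prems] Suc.prems unfolding wbd.simps by (auto intro!: differentiable_mult)
  }
qed

section \<open>Schwartz functions and slowly increasing functions\<close>

text \<open>The head of the list is the outermost derivative, whereas \<open>wbd\<close> recurses on
  the innermost one. Peeling lists from the right reconciles the two recursions.\<close>

lemma partials_snoc: "partials (bs @ [b]) f = partials bs (dpart b f)"
  by (induction bs) (auto simp: dpart_def)

lemma wbd_iff_partials:
  "wbd n m C f \<longleftrightarrow> (\<forall>bs\<in>lists Basis. length bs \<le> n \<longrightarrow>
     (\<forall>x. cmod (partials bs f x) \<le> C * wt x powi m) \<and>
     (length bs < n \<longrightarrow> (\<forall>x. partials bs f differentiable at x)))"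
proof (induction n arbitrary: f)
  case 0
  then show ?case by auto
next
  case (Suc n)
  let ?P = "\<lambda>bs n f. (\<forall>x. cmod (partials bs f x) \<le> C * wt x powi m) \<and>
     (length bs < n \<longrightarrow> (\<forall>x. partials bs f differentiable at x))"
  have "(\<forall>bs\<in>lists Basis. length bs \<le> Suc n \<longrightarrow> ?P bs (Suc n) f) \<longleftrightarrow>
      ?P [] (Suc n) f \<and> (\<forall>b\<in>Basis. \<forall>bs\<in>lists Basis. length bs \<le> n \<longrightarrow> ?P (bs @ [b]) (Suc n) f)"
    (is "?L \<longleftrightarrow> ?R")
  proof
    assume L: ?L
    show ?R using L[rule_format, of "[]"] L[rule_format, of "_ @ [_]"] by auto
  next
    assume R: ?R
    show ?L
    proof (intro ballI impI)
      fix bs :: "'a list"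
      assume bs: "bs \<in> lists Basis" "length bs \<le> Suc n"
      show "?P bs (Suc n) f"
      proof (cases bs rule: rev_cases)
        case Nil then show ?thesis using R by auto
      next
        case (snoc cs b) then show ?thesis using R bs by auto
      qed
    qed
  qed
  then show ?case by (simp add: Suc partials_snoc)
qed

text \<open>Monotonicity in \<open>N\<close> allows a maximum over the finite index set; for this
  reason one natural number is often made to bound exponents and constants alike.\<close>

lemma ex_uniform_bound:
  fixes P :: "'i \<Rightarrow> nat \<Rightarrow> bool"
  assumes "finite I" "\<And>i. i \<in> I \<Longrightarrow> \<exists>N. P i N" "\<And>i N N'. P i N \<Longrightarrow> N \<le> N' \<Longrightarrow> P i N'"
  shows "\<exists>N. \<forall>i\<in>I. P i N"
  using assms(1,2)
proof (induction I rule: finite_induct)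
  case (insert i I)
  then obtain N1 where "\<forall>j\<in>I. P j N1" by auto
  moreover obtain N2 where "P i N2" using insert by auto
  ultimately have "\<forall>j\<in>insert i I. P j (max N1 N2)" using assms(3) by (metis insertE max.cobounded1 max.cobounded2)
  then show ?case ..
qed simp

lemma finite_lists_Basis: "finite {bs \<in> lists (Basis::'a::euclidean_space set). length bs \<le> n}"
proof -
  have "{bs \<in> lists (Basis::'a set). length bs \<le> n} = {bs. set bs \<subseteq> Basis \<and> length bs \<le> n}" by auto
  then show ?thesis using finite_lists_length_le[OF finite_Basis, of n] by simp
qed

lemma smooth_iff: "smooth f \<longleftrightarrow> (\<forall>bs\<in>lists Basis. \<forall>x. partials bs f differentiable at x)"
  by (simp add: smooth_def differentiable_on_def)

lemma weighted_le_iff: "weighted k f x \<le> C \<longleftrightarrow> cmod (f x) \<le> C * wt x powi (- int k)"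
  by (simp add: weighted_def wt_def[symmetric] power_int_minus_divide field_simps)

text \<open>Only finitely many derivatives have order at most \<open>n\<close>, so their separate
  suprema admit a common bound.\<close>

lemma schwartz_iff: "f \<in> schwartz \<longleftrightarrow> (\<forall>n k. \<exists>C. wbd n (- int k) C f)"
proof
  assume f: "f \<in> schwartz"
  show "\<forall>n k. \<exists>C. wbd n (- int k) C f"
  proof (intro allI)
    fix n k
    have "\<exists>N::nat. \<forall>bs\<in>{bs \<in> lists Basis. length bs \<le> n}. \<forall>x. weighted k (partials bs f) x \<le> N"
    proof (rule ex_uniform_bound[OF finite_lists_Basis])
      fix bs :: "'a list" assume "bs \<in> {bs \<in> lists Basis. length bs \<le> n}"
      then have "bdd_above (range (weighted k (partials bs f)))"
        using f by (auto simp: schwartz_def)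
      then obtain M where "\<And>x. weighted k (partials bs f) x \<le> M"
        by (auto simp: bdd_above_def)
      then show "\<exists>N::nat. \<forall>x. weighted k (partials bs f) x \<le> N"
        by (meson order_trans real_arch_simple)
    qed (meson of_nat_mono order_trans)
    then obtain N :: nat where "\<forall>bs\<in>{bs \<in> lists Basis. length bs \<le> n}. \<forall>x. weighted k (partials bs f) x \<le> N" ..
    moreover have "smooth f" using f by (simp add: schwartz_def)
    ultimately have "wbd n (- int k) N f"
      unfolding wbd_iff_partials by (auto simp: weighted_le_iff smooth_iff)
    then show "\<exists>C. wbd n (- int k) C f" by blast
  qed
next
  assume R: "\<forall>n k. \<exists>C. wbd n (- int k) C f"
  show "f \<in> schwartz"
    unfolding schwartz_def smooth_iff
  proof (intro CollectI conjI ballI allI)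
    fix bs :: "'a list" and x assume bs: "bs \<in> lists Basis"
    \<comment> \<open>One order more than the length of the list, since \<open>wbd\<close> yields
      differentiability only strictly below its order.\<close>
    obtain C where "wbd (Suc (length bs)) (- int 0) C f" using R by blast
    then show "partials bs f differentiable at x"
      unfolding wbd_iff_partials using bs by auto
  next
    fix k and bs :: "'a list" assume bs: "bs \<in> lists Basis"
    obtain C where "wbd (length bs) (- int k) C f" using R by blast
    then have "weighted k (partials bs f) x \<le> C" for x
      unfolding wbd_iff_partials weighted_le_iff using bs by auto
    then show "bdd_above (range (weighted k (partials bs f)))"
      by (auto simp: bdd_above_def)
  qed
qed

text \<open>The growth exponent may depend on the order \<open>n\<close>: derivatives of a function
  in O_M may grow at rates that increase with the order.\<close>

definition pbd :: "nat \<Rightarrow> ('a::euclidean_space \<Rightarrow> complex) \<Rightarrow> bool" where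
  "pbd n f \<longleftrightarrow> (\<exists>m C. wbd n (int m) C f)"

lemma pbdI: "wbd n (int m) C f \<Longrightarrow> pbd n f"
  by (auto simp: pbd_def)

lemma pbd_nat: "pbd n f \<longleftrightarrow> (\<exists>N. wbd n (int N) (real N) f)"
proof
  assume "pbd n f"
  then obtain m C where *: "wbd n (int m) C f" by (auto simp: pbd_def)
  have "wbd n (int (max m (nat \<lceil>C\<rceil>))) (real (max m (nat \<lceil>C\<rceil>))) f"
    by (rule wbd_mono[OF *]) (auto intro: order_trans[OF real_nat_ceiling_ge])
  then show "\<exists>N. wbd n (int N) (real N) f" ..
qed (auto simp: pbd_def)

text \<open>Made for functions whose derivative is an expression in the function itself, such as
  inverses, square roots and characters: an induction on the order then needs only a growth bound
  for the function. The exponents of the finitely many partial derivatives are merged into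
  one.\<close>

lemma pbd_Suc:
  "pbd (Suc n) f \<longleftrightarrow> pbd 0 f \<and> (\<forall>x. f differentiable at x) \<and> (\<forall>b\<in>Basis. pbd n (dpart b f))"
proof
  assume "pbd (Suc n) f"
  then show "pbd 0 f \<and> (\<forall>x. f differentiable at x) \<and> (\<forall>b\<in>Basis. pbd n (dpart b f))"
    by (auto simp: pbd_def) blast+
next
  assume R: "pbd 0 f \<and> (\<forall>x. f differentiable at x) \<and> (\<forall>b\<in>Basis. pbd n (dpart b f))"
  have "\<exists>N. \<forall>b\<in>Basis. wbd n (int N) (real N) (dpart b f)"
  proof (rule ex_uniform_bound)
    show "wbd n (int N') (real N') (dpart b f)" if "wbd n (int N) (real N) (dpart b f)" "N \<le> N'" for b N N'
      using wbd_mono[OF that(1)] that(2) by simp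
  qed (use R in \<open>auto simp: pbd_nat\<close>)
  then obtain N where N: "\<forall>b\<in>Basis. wbd n (int N) (real N) (dpart b f)" ..
  obtain M where M: "wbd 0 (int M) (real M) f" using R by (auto simp: pbd_nat)
  have "wbd 0 (int (max M N)) (real (max M N)) f"
    by (rule wbd_mono[OF M]) auto
  moreover have "wbd n (int (max M N)) (real (max M N)) (dpart b f)" if "b \<in> Basis" for b
    by (rule wbd_mono[OF N[rule_format, OF that]]) auto
  ultimately have "wbd (Suc n) (int (max M N)) (real (max M N)) f"
    using R by simp
  then show "pbd (Suc n) f" by (auto simp: pbd_nat)
qed

lemma pbd_mult: "pbd n f \<Longrightarrow> pbd n h \<Longrightarrow> pbd n (\<lambda>x. f x * h x)"
proof -
  assume "pbd n f" "pbd n h"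
  then obtain m C k D where "wbd n (int m) C f" "wbd n (int k) D h" by (auto simp: pbd_def)
  from wbd_mult[OF this] show ?thesis by (intro pbdI[of n "m + k"]) simp
qed

lemma pbd_cmult: "pbd n f \<Longrightarrow> pbd n (\<lambda>x. c * f x)"
  unfolding pbd_def by (blast intro: wbd_cmult)

lemma pbd_add: "pbd n f \<Longrightarrow> pbd n h \<Longrightarrow> pbd n (\<lambda>x. f x + h x)"
proof -
  assume "pbd n f" "pbd n h"
  then obtain N M where "wbd n (int N) (real N) f" "wbd n (int M) (real M) h" by (auto simp: pbd_nat)
  then have "wbd n (int (max N M)) (real N + real M) (\<lambda>x. f x + h x)"
    using wbd_mono[of n "int N" "real N" f n "int (max N M)" "real N"]
      wbd_mono[of n "int M" "real M" h n "int (max N M)" "real M"] by (intro wbd_add) simp_all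
  then show ?thesis by (rule pbdI)
qed

lemma slowly_increasing_iff: "f \<in> slowly_increasing \<longleftrightarrow> (\<forall>n. pbd n f)"
proof
  assume f: "f \<in> slowly_increasing"
  then have sm: "smooth f" by (simp add: slowly_increasing_def)
  show "\<forall>n. pbd n f"
  proof
    fix n
    have "\<exists>N::nat. \<forall>bs\<in>{bs \<in> lists Basis. length bs \<le> n}. \<forall>x. cmod (partials bs f x) \<le> N * wt x powi int N"
    proof (rule ex_uniform_bound[OF finite_lists_Basis])
      fix bs :: "'a list" assume "bs \<in> {bs \<in> lists Basis. length bs \<le> n}"
      then have "polynomially_bounded (partials bs f)"
        using f by (auto simp: slowly_increasing_def)
      then have "pbd 0 (partials bs f)"
        by (simp add: pbd_def polynomially_bounded_def wt_def) blast
      then show "\<exists>N::nat. \<forall>x. cmod (partials bs f x) \<le> N * wt x powi int N"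
        by (auto simp: pbd_nat)
    next
      fix bs :: "'a list" and N N' :: nat
      assume "\<forall>x. cmod (partials bs f x) \<le> real N * wt x powi int N" "N \<le> N'"
      then show "\<forall>x. cmod (partials bs f x) \<le> real N' * wt x powi int N'"
        using wbd_mono[of 0 "int N" "real N" "partials bs f" 0 "int N'" "real N'"] by auto
    qed
    then obtain N :: nat where "\<forall>bs\<in>{bs \<in> lists Basis. length bs \<le> n}. \<forall>x. cmod (partials bs f x) \<le> N * wt x powi int N" ..
    then have "wbd n (int N) N f"
      unfolding wbd_iff_partials using sm by (auto simp: smooth_iff)
    then show "pbd n f" by (auto simp: pbd_def)
  qed
next
  assume R: "\<forall>n. pbd n f"
  show "f \<in> slowly_increasing"
    unfolding slowly_increasing_def smooth_iff
  proof (intro CollectI conjI ballI allI)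
    fix bs :: "'a list" and x assume bs: "bs \<in> lists Basis"
    obtain N where "wbd (Suc (length bs)) (int N) N f" using R pbd_nat by blast
    then show "partials bs f differentiable at x"
      unfolding wbd_iff_partials using bs by auto
  next
    fix bs :: "'a list" assume bs: "bs \<in> lists Basis"
    obtain N where "wbd (length bs) (int N) N f" using R pbd_nat by blast
    then show "polynomially_bounded (partials bs f)"
      unfolding wbd_iff_partials polynomially_bounded_def wt_def[symmetric] using bs by fastforce
  qed
qed

lemma si_pbd: "f \<in> slowly_increasing \<Longrightarrow> pbd n f"
  by (simp add: slowly_increasing_iff)

lemma si_differentiable: "f \<in> slowly_increasing \<Longrightarrow> f differentiable at x"
  using pbd_Suc si_pbd by blast

lemma si_dpart: "f \<in> slowly_increasing \<Longrightarrow> b \<in> Basis \<Longrightarrow> dpart b f \<in> slowly_increasing"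
  unfolding slowly_increasing_iff by (metis pbd_Suc)

lemma si_mult:
  "f \<in> slowly_increasing \<Longrightarrow> h \<in> slowly_increasing \<Longrightarrow> (\<lambda>x. f x * h x) \<in> slowly_increasing"
  by (simp add: slowly_increasing_iff pbd_mult)

lemma si_cmult: "f \<in> slowly_increasing \<Longrightarrow> (\<lambda>x. c * f x) \<in> slowly_increasing"
  by (simp add: slowly_increasing_iff pbd_cmult)

lemma si_add:
  "f \<in> slowly_increasing \<Longrightarrow> h \<in> slowly_increasing \<Longrightarrow> (\<lambda>x. f x + h x) \<in> slowly_increasing"
  by (simp add: slowly_increasing_iff pbd_add)

lemma si_diff:
  "f \<in> slowly_increasing \<Longrightarrow> h \<in> slowly_increasing \<Longrightarrow> (\<lambda>x. f x - h x) \<in> slowly_increasing"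
  using si_add[of f "\<lambda>x. -1 * h x"] si_cmult[of h "-1"] by simp

lemma si_cnj: "f \<in> slowly_increasing \<Longrightarrow> (\<lambda>x. cnj (f x)) \<in> slowly_increasing"
  unfolding slowly_increasing_iff pbd_def using wbd_cnj by blast

lemma schwartz_si: "f \<in> schwartz \<Longrightarrow> f \<in> slowly_increasing"
  unfolding schwartz_iff slowly_increasing_iff
proof
  fix n assume "\<forall>n k. \<exists>C. wbd n (- int k) C f"
  then obtain C where "wbd n (- int 0) C f" by blast
  then show "pbd n f" by (intro pbdI[of n 0 C]) simp
qed

lemma schwartz_differentiable: "f \<in> schwartz \<Longrightarrow> f differentiable at x"
  by (rule si_differentiable[OF schwartz_si])

lemma schwartz_continuous: "f \<in> schwartz \<Longrightarrow> continuous_on UNIV f"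
  by (simp add: schwartz_differentiable differentiable_imp_continuous_on differentiable_at_imp_differentiable_on)

lemma schwartz_wbd: "f \<in> schwartz \<Longrightarrow> \<exists>C. wbd n (- int k) C f"
  by (simp add: schwartz_iff)

lemma schwartz_dpart: "f \<in> schwartz \<Longrightarrow> b \<in> Basis \<Longrightarrow> dpart b f \<in> schwartz"
  unfolding schwartz_iff by (metis wbd_SucD(2))

lemma schwartz_lin:
  assumes "f \<in> schwartz" "h \<in> schwartz"
  shows "(\<lambda>x. a * f x + b * h x) \<in> schwartz"
  unfolding schwartz_iff
proof (intro allI)
  fix n k
  obtain C D where "wbd n (- int k) C f" "wbd n (- int k) D h" using assms schwartz_wbd by metis
  then have "wbd n (- int k) (cmod a * C + cmod b * D) (\<lambda>x. a * f x + b * h x)"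
    by (intro wbd_add wbd_cmult)
  then show "\<exists>C. wbd n (- int k) C (\<lambda>x. a * f x + b * h x)" ..
qed

lemma schwartz_diff: "f \<in> schwartz \<Longrightarrow> h \<in> schwartz \<Longrightarrow> (\<lambda>x. f x - h x) \<in> schwartz"
  using schwartz_lin[of f h 1 "-1"] by simp

lemma schwartz_cmult: "f \<in> schwartz \<Longrightarrow> (\<lambda>x. c * f x) \<in> schwartz"
  using schwartz_lin[of f f c 0] by simp

lemma schwartz_zero: "(\<lambda>x. 0) \<in> schwartz"
proof -
  have "wbd n m 0 (\<lambda>x::'a. 0)" for n m
  proof (induction n)
    case (Suc n)
    have "dpart b (\<lambda>x::'a. 0) = (\<lambda>x. 0)" for b :: 'a
      by (intro ext dpart_eqI[of _ "\<lambda>_. 0", simplified]) simp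
    then show ?case using Suc by simp
  qed simp
  then show ?thesis by (auto simp: schwartz_iff)
qed

lemma schwartz_cnj: "f \<in> schwartz \<Longrightarrow> (\<lambda>x. cnj (f x)) \<in> schwartz"
  unfolding schwartz_iff using wbd_cnj by blast

lemma schwartz_reflect: "f \<in> schwartz \<Longrightarrow> reflect f \<in> schwartz"
  unfolding schwartz_iff using wbd_reflect by blast

text \<open>\<open>k'\<close> and \<open>K\<close> are chosen before \<open>f\<close>, so the
  estimate expresses continuity of multiplication by \<open>u\<close> and not just stability of the
  Schwartz space. The growth exponent of \<open>u\<close> is paid for by extra decay of
  \<open>f\<close>.\<close>

lemma wbd_si_mult:
  assumes "u \<in> slowly_increasing"
  shows "\<exists>k' K. \<forall>f C. wbd n (- int k') C f \<longrightarrow> wbd n (- int k) (K * C) (\<lambda>x. u x * f x)"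
proof -
  obtain m D where D: "wbd n (int m) D u" using si_pbd[OF assms, of n] by (auto simp: pbd_def)
  have "wbd n (- int k) ((2 ^ n * D) * C) (\<lambda>x. u x * f x)" if "wbd n (- int (k + m)) C f" for f C
    using wbd_mult[OF D that] by simp
  then show ?thesis by blast
qed

lemma schwartz_mult:
  assumes "u \<in> slowly_increasing" "f \<in> schwartz"
  shows "(\<lambda>x. u x * f x) \<in> schwartz"
  unfolding schwartz_iff
proof (intro allI)
  fix n k
  obtain k' K where *: "\<forall>f C. wbd n (- int k') C f \<longrightarrow> wbd n (- int k) (K * C) (\<lambda>x. u x * f x)"
    using wbd_si_mult[OF assms(1)] by blast
  obtain C where "wbd n (- int k') C f" using schwartz_wbd[OF assms(2)] by blast
  with * show "\<exists>C. wbd n (- int k) C (\<lambda>x. u x * f x)" by blast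
qed

text \<open>The derivative \<open>- (1/f) * f' * (1/f)\<close> is built from \<open>1/f\<close> and
  \<open>f'\<close>, so polynomial growth of \<open>1/f\<close> alone passes to all its
  derivatives.\<close>

lemma si_inverse:
  assumes f: "f \<in> slowly_increasing" and nz: "\<And>x. f x \<noteq> 0" and bd: "pbd 0 (\<lambda>x. inverse (f x))"
  shows "(\<lambda>x. inverse (f x)) \<in> slowly_increasing"
proof -
  have D: "((\<lambda>x. inverse (f x)) has_derivative (\<lambda>h. - (inverse (f x) * dpart h f x * inverse (f x)))) (at x)" for x
    by (rule Deriv.has_derivative_inverse[OF nz frechet_works[OF si_differentiable[OF f]]])
  have "pbd n (\<lambda>x. inverse (f x))" for n
  proof (induction n)
    case (Suc n)
    have "pbd n (dpart b (\<lambda>x. inverse (f x)))" if b: "b \<in> Basis" for b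
    proof -
      have "pbd n (\<lambda>x. (-1) * (inverse (f x) * dpart b f x * inverse (f x)))"
        by (intro pbd_cmult pbd_mult Suc si_pbd si_dpart f b)
      moreover have "dpart b (\<lambda>x. inverse (f x)) = (\<lambda>x. (-1) * (inverse (f x) * dpart b f x * inverse (f x)))"
        using dpart_eqI[OF D] by auto
      ultimately show ?thesis by simp
    qed
    then show ?case using bd D by (subst pbd_Suc) (auto simp: differentiable_def)
  qed (rule bd)
  then show ?thesis by (simp add: slowly_increasing_iff)
qed

text \<open>Positivity keeps \<open>f\<close> off the branch cut of \<open>csqrt\<close>. The
  derivative is a product of \<open>csqrt f\<close>, \<open>1/f\<close> and \<open>f'\<close>, which
  makes the induction on the order close.\<close>

lemma si_csqrt:
  assumes f: "f \<in> slowly_increasing" and pos: "\<And>x. f x \<in> \<real> \<and> 0 < Re (f x)"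
    and inv: "(\<lambda>x. inverse (f x)) \<in> slowly_increasing"
  shows "(\<lambda>x. csqrt (f x)) \<in> slowly_increasing"
proof -
  have nz: "f x \<noteq> 0" for x using pos[of x] by auto
  have D: "((\<lambda>x. csqrt (f x)) has_derivative (\<lambda>h. (1/2) * (csqrt (f x) * inverse (f x)) * dpart h f x)) (at x)" for x
  proof -
    have "f x \<notin> \<real>\<^sub>\<le>\<^sub>0" using pos[of x] by (auto simp: complex_nonpos_Reals_iff)
    then have "(csqrt has_derivative (*) (inverse (2 * csqrt (f x)))) (at (f x))"
      using has_field_derivative_csqrt[of "f x"] unfolding has_field_derivative_def by blast
    from has_derivative_compose[OF frechet_works[OF si_differentiable[OF f]] this]
    have "((\<lambda>x. csqrt (f x)) has_derivative (\<lambda>h. inverse (2 * csqrt (f x)) * dpart h f x)) (at x)" .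
    \<comment> \<open>The reciprocal of the root would need a growth bound of its own; rewritten as
      \<open>csqrt f\<close> times \<open>1/f\<close> it is covered by the induction hypothesis and
      by \<open>inv\<close>.\<close>
    moreover have "inverse (2 * csqrt (f x)) = (1/2) * (csqrt (f x) * inverse (f x))"
    proof -
      have "csqrt (f x) * csqrt (f x) = f x" by (metis power2_csqrt power2_eq_square)
      with nz[of x] show ?thesis by (auto simp: field_simps)
    qed
    ultimately show ?thesis by simp
  qed
  obtain m C where mC: "wbd 0 (int m) C f" using si_pbd[OF f, of 0] by (auto simp: pbd_def)
  have "cmod (csqrt (f x)) \<le> (C + 1) * wt x powi int m" for x
  proof -
    have "(cmod (csqrt (f x)))\<^sup>2 = cmod (f x)" by (simp flip: norm_power)
    \<comment> \<open>The inequality \<open>t \<le> t^2 + 1\<close>, from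
      \<open>(t - 1/2)^2 \<ge> 0\<close>, trades the root for \<open>f\<close> and avoids
      half-integer weights.\<close>
    moreover have "cmod (csqrt (f x)) \<le> (cmod (csqrt (f x)))\<^sup>2 + 1"
      using zero_le_power2[of "cmod (csqrt (f x)) - 1/2"] by (simp add: power2_eq_square algebra_simps)
    moreover have "cmod (f x) \<le> C * wt x powi int m" by (rule wbd_bound[OF mC])
    moreover have "1 \<le> wt x powi int m" by simp
    ultimately show ?thesis unfolding distrib_right by linarith
  qed
  then have bd: "pbd 0 (\<lambda>x. csqrt (f x))" by (auto simp: pbd_def)
  have "pbd n (\<lambda>x. csqrt (f x))" for n
  proof (induction n)
    case (Suc n)
    have "pbd n (dpart b (\<lambda>x. csqrt (f x)))" if b: "b \<in> Basis" for b
    proof -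
      have "pbd n (\<lambda>x. (1/2) * (csqrt (f x) * inverse (f x) * dpart b f x))"
        by (intro pbd_cmult pbd_mult Suc si_pbd[OF inv] si_pbd[OF si_dpart[OF f b]])
      moreover have "dpart b (\<lambda>x. csqrt (f x)) = (\<lambda>x. (1/2) * (csqrt (f x) * inverse (f x) * dpart b f x))"
        using dpart_eqI[OF D] by (auto simp: mult.assoc)
      ultimately show ?thesis by simp
    qed
    then show ?case using bd D by (subst pbd_Suc) (auto simp: differentiable_def)
  qed (rule bd)
  then show ?thesis by (simp add: slowly_increasing_iff)
qed

section \<open>Elementary slowly increasing functions\<close>

lemma wbd_const:
  assumes "cmod c \<le> C" "0 \<le> m"
  shows "wbd n m C (\<lambda>x::'a::euclidean_space. c)"
  using assms(1)
proof (induction n arbitrary: c)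
  have base: "cmod c \<le> C * wt x powi m" if "cmod c \<le> C" for x :: 'a and c
    using mult_mono[OF that wt_powi_mono[OF assms(2), of x]] order_trans[OF norm_ge_zero that] by simp
  {
    case 0
    then show ?case using base by simp
  next
    case (Suc n)
    have "dpart b (\<lambda>x::'a. c) = (\<lambda>x. 0)" for b :: 'a
      by (intro ext dpart_eqI[of _ "\<lambda>_. 0", simplified]) simp
    then show ?case using Suc.IH[of 0] base[OF Suc.prems] order_trans[OF norm_ge_zero Suc.prems] by simp
  }
qed

lemma si_const: "(\<lambda>x. c) \<in> slowly_increasing"
  unfolding slowly_increasing_iff using wbd_const[of c "cmod c" 0] pbdI[of _ 0] by auto

lemma dpart_inner: "dpart b (\<lambda>x. complex_of_real (x \<bullet> a)) = (\<lambda>x. complex_of_real (b \<bullet> a))"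
proof
  fix x
  have "((\<lambda>x. complex_of_real (x \<bullet> a)) has_derivative (\<lambda>h. complex_of_real (h \<bullet> a))) (at x)"
    by (auto intro!: derivative_eq_intros)
  then show "dpart b (\<lambda>x. complex_of_real (x \<bullet> a)) x = complex_of_real (b \<bullet> a)"
    by (rule dpart_eqI)
qed

lemma wbd_inner: "wbd n 1 (norm a) (\<lambda>x. complex_of_real (x \<bullet> a))"
proof -
  have *: "\<bar>x \<bullet> a\<bar> \<le> norm a * wt x" for x
    using Cauchy_Schwarz_ineq2[of x a] mult_left_mono[OF norm_le_wt[of x], of "norm a"] by (simp add: mult.commute)
  have D: "(\<lambda>x. complex_of_real (x \<bullet> a)) differentiable at x" for x
    by (auto intro!: derivative_eq_intros simp: differentiable_def)
  have "wbd n 1 (norm a) (\<lambda>x. complex_of_real (b \<bullet> a))" if "b \<in> Basis" for n b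
    using that Cauchy_Schwarz_ineq2[of b a] by (intro wbd_const) auto
  then show ?thesis using * D by (cases n) (auto simp: dpart_inner)
qed

lemma si_inner: "(\<lambda>x. complex_of_real (x \<bullet> a)) \<in> slowly_increasing"
  unfolding slowly_increasing_iff using wbd_inner[of _ a] pbdI[of _ 1] by auto

definition charf :: "'a::euclidean_space \<Rightarrow> 'a \<Rightarrow> complex" where
  "charf \<xi> x = exp (\<i> * complex_of_real (\<xi> \<bullet> x))"

lemma norm_charf [simp]: "cmod (charf \<xi> x) = 1"
  by (simp add: charf_def)

lemma charf_deriv: "(charf \<xi> has_derivative (\<lambda>h. (\<i> * complex_of_real (\<xi> \<bullet> h)) * charf \<xi> x)) (at x)"
proof -
  have "((\<lambda>x. \<i> * complex_of_real (\<xi> \<bullet> x)) has_derivative (\<lambda>h. \<i> * complex_of_real (\<xi> \<bullet> h))) (at x)"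
    by (auto intro!: derivative_eq_intros)
  from has_derivative_compose[OF this DERIV_exp[unfolded has_field_derivative_def]]
  show ?thesis unfolding charf_def[abs_def] by (simp add: mult.commute)
qed

lemma dpart_charf: "dpart b (charf \<xi>) = (\<lambda>x. (\<i> * complex_of_real (\<xi> \<bullet> b)) * charf \<xi> x)"
  by (intro ext dpart_eqI[OF charf_deriv])

lemma si_charf: "charf \<xi> \<in> slowly_increasing"
proof -
  have bd: "pbd 0 (charf \<xi>)" by (intro pbdI[of 0 0 1]) simp
  have "pbd n (charf \<xi>)" for n
  proof (induction n)
    case (Suc n)
    then have "pbd n (dpart b (charf \<xi>))" for b unfolding dpart_charf by (rule pbd_cmult)
    then show ?case using bd charf_deriv[of \<xi>] by (subst pbd_Suc) (auto simp: differentiable_def)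
  qed (rule bd)
  then show ?thesis by (simp add: slowly_increasing_iff)
qed

lemma wt_deriv: "(wt has_derivative (\<lambda>h. 2 * (x \<bullet> h))) (at x)"
  unfolding wt_def[abs_def] power2_norm_eq_inner
  by (auto intro!: derivative_eq_intros simp: inner_commute)

text \<open>Differentiation produces \<open>2 * m * (x \<bullet> b) * wt x powi (m - 1)\<close>; the
  linear form costs one weight and the lowered exponent gives it back, so the weight
  \<open>m\<close> is the same for all orders. This sharp form is wanted for negative
  \<open>m\<close>, where membership in O_M would lose the decay.\<close>

lemma wbd_wt: "\<exists>C. wbd n m C (\<lambda>x::'a::euclidean_space. complex_of_real (wt x powi m))"
proof -
  have D: "((\<lambda>x::'a. complex_of_real (wt x powi m)) has_derivative
      (\<lambda>h. complex_of_real (of_int m * wt x powi (m - 1) * (2 * (x \<bullet> h))))) (at x)" for x :: 'a and m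
  proof -
    have "((\<lambda>z. z powi m) has_field_derivative of_int m * wt x powi (m - 1)) (at (wt x))"
      using DERIV_power_int[OF DERIV_ident, where x = "wt x" and n = m and s = UNIV] by simp
    then have "((\<lambda>z. z powi m) has_derivative (*) (of_int m * wt x powi (m - 1))) (at (wt x))"
      unfolding has_field_derivative_def .
    from has_derivative_of_real[OF has_derivative_compose[OF wt_deriv this]] show ?thesis .
  qed
  have dp: "dpart b (\<lambda>x::'a. complex_of_real (wt x powi m)) =
      (\<lambda>x. (2 * of_int m) * (complex_of_real (x \<bullet> b) * complex_of_real (wt x powi (m - 1))))" for b m
    by (intro ext, subst dpart_eqI[OF D]) (simp add: mult_ac)
  have df: "(\<lambda>x::'a. complex_of_real (wt x powi m)) differentiable at x" for x m
    using D by (auto simp: differentiable_def)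
  show ?thesis
  proof (induction n arbitrary: m)
    case 0
    have "wbd 0 m 1 (\<lambda>x::'a. complex_of_real (wt x powi m))" by (simp add: norm_power_int less_imp_le)
    then show ?case ..
  next
    case (Suc n)
    obtain C where C: "wbd n (m - 1) C (\<lambda>x::'a. complex_of_real (wt x powi (m - 1)))" using Suc.IH by blast
    let ?C = "cmod (2 * of_int m) * (2 ^ n * 1 * C)"
    have "wbd n m ?C (dpart b (\<lambda>x::'a. complex_of_real (wt x powi m)))" if "b \<in> Basis" for b
    proof -
      have "wbd n 1 1 (\<lambda>x. complex_of_real (x \<bullet> b))" using wbd_inner[of n b] that by simp
      from wbd_cmult[OF wbd_mult[OF this C], of "2 * of_int m"] show ?thesis unfolding dp by simp
    qed
    moreover have "0 \<le> ?C" using wbd_nonneg[OF C] by simp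
    ultimately have "wbd (Suc n) m (max 1 ?C) (\<lambda>x::'a. complex_of_real (wt x powi m))"
      using df wbd_mono[of n m ?C _ n m "max 1 ?C"]
        mult_right_mono[of 1 "max 1 ?C" "wt _ powi m"] by (auto simp: norm_power_int less_imp_le)
    then show ?case ..
  qed
qed

lemma si_wt: "(\<lambda>x. complex_of_real (wt x powi m)) \<in> slowly_increasing"
  unfolding slowly_increasing_iff
proof
  fix n
  obtain C where "wbd n m C (\<lambda>x::'a. complex_of_real (wt x powi m))" using wbd_wt by blast
  then have "wbd n (int (nat m)) C (\<lambda>x::'a. complex_of_real (wt x powi m))" by (rule wbd_mono) auto
  then show "pbd n (\<lambda>x::'a. complex_of_real (wt x powi m))" by (rule pbdI)
qed

section \<open>Gaussian regularization\<close>

definition gauss :: "real \<Rightarrow> 'a::euclidean_space \<Rightarrow> complex" where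
  "gauss d x = complex_of_real (exp (- d * (norm x)\<^sup>2))"

lemma gauss_deriv: "(gauss d has_derivative (\<lambda>h. (- 2 * complex_of_real d) * (complex_of_real (x \<bullet> h) * gauss d x))) (at x)"
proof -
  have "((\<lambda>x. - d * (x \<bullet> x)) has_derivative (\<lambda>h. - d * (2 * (x \<bullet> h)))) (at x)"
    by (auto intro!: derivative_eq_intros simp: inner_commute)
  from has_derivative_compose[OF this DERIV_exp[unfolded has_field_derivative_def]]
  have "((\<lambda>x. complex_of_real (exp (- d * (x \<bullet> x)))) has_derivative
      (\<lambda>h. complex_of_real (exp (- d * (x \<bullet> x)) * (- d * (2 * (x \<bullet> h)))))) (at x)"
    by (rule has_derivative_of_real)
  then show ?thesis unfolding gauss_def[abs_def] power2_norm_eq_inner by (simp add: mult_ac)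
qed

lemma gauss_differentiable: "gauss d differentiable at x"
  using gauss_deriv by (auto simp: differentiable_def)

lemma dpart_gauss: "dpart b (gauss d) = (\<lambda>x. (- 2 * complex_of_real d) * (complex_of_real (x \<bullet> b) * gauss d x))"
  by (intro ext dpart_eqI[OF gauss_deriv])

text \<open>The factor \<open>d\<close> gained by differentiating is kept explicit, as it makes the
  error of the regularization linear in \<open>d\<close>; the price is one power of the
  weight.\<close>

lemma wbd_dpart_gauss:
  fixes b :: "'a::euclidean_space"
  assumes "wbd n m C (gauss d :: 'a \<Rightarrow> complex)" "b \<in> Basis"
  shows "wbd n (1 + m) (2 * \<bar>d\<bar> * (2 ^ n * C)) (dpart b (gauss d))"
proof -
  have "wbd n 1 1 (\<lambda>x. complex_of_real (x \<bullet> b))" using wbd_inner[of n b] assms(2) by simp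
  from wbd_cmult[OF wbd_mult[OF this assms(1)], of "- 2 * complex_of_real d"]
  show ?thesis unfolding dpart_gauss by (simp add: norm_mult)
qed

lemma gauss_half: "gauss (d / 2) x * gauss (d / 2) x = gauss d x"
  by (simp add: gauss_def flip: of_real_mult exp_add)

lemma cnj_gauss [simp]: "cnj (gauss d x) = gauss d x"
  by (simp add: gauss_def)

lemma gauss_schwartz:
  assumes d: "0 < d"
  shows "gauss d \<in> (schwartz :: ('a::euclidean_space \<Rightarrow> complex) set)"
proof -
  have base: "\<exists>C. \<forall>x::'a. cmod (gauss d x) \<le> C * wt x powi (- int k)" for k
  proof (cases k)
    case 0
    then show ?thesis using d by (intro exI[of _ 1]) (auto simp: gauss_def)
  next
    case (Suc j)
    have "cmod (gauss d x) \<le> (exp d * (k / d) ^ k) * wt x powi (- int k)" for x :: 'a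
    proof -
      have k: "real k > 0" using Suc by simp
      \<comment> \<open>Raising \<open>t \<le> exp t\<close> with \<open>t = d * wt x / k\<close> to
        the power \<open>k\<close> gives decay of order \<open>k\<close>; the constant
        \<open>exp d * (k / d) ^ k\<close> results from this.\<close>
      have "d * wt x / k \<le> exp (d * wt x / k)" using exp_ge_add_one_self[of "d * wt x / k"] by linarith
      then have "(d * wt x / k) ^ k \<le> exp (d * wt x / k) ^ k"
        using d k by (intro power_mono) (auto intro!: divide_nonneg_nonneg mult_nonneg_nonneg simp: less_imp_le)
      also have "\<dots> = exp (d * wt x)"
        using k by (simp flip: exp_of_nat_mult)
      also have "\<dots> = exp d / cmod (gauss d x)"
        by (simp add: gauss_def wt_def algebra_simps flip: exp_diff)
      finally have "cmod (gauss d x) * (d * wt x / k) ^ k \<le> exp d"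
        by (simp add: gauss_def field_simps)
      then show ?thesis using d k by (simp add: power_int_minus_divide power_divide power_mult_distrib field_simps)
    qed
    then show ?thesis by blast
  qed
  have "\<exists>C. wbd n (- int k) C (gauss d :: 'a \<Rightarrow> complex)" for n k
  proof (induction n arbitrary: k)
    case 0
    show ?case using base by simp
  next
    case (Suc n)
    \<comment> \<open>Decay of order \<open>k + 1\<close> is requested because the linear factor in
      the derivative uses up one power.\<close>
    obtain C where C: "wbd n (- int (Suc k)) C (gauss d :: 'a \<Rightarrow> complex)" using Suc by blast
    obtain C' where C': "\<And>x::'a. cmod (gauss d x) \<le> C' * wt x powi (- int k)" using base by blast
    let ?C = "2 * \<bar>d\<bar> * (2 ^ n * C)"
    have "wbd n (- int k) (max C' ?C) (dpart b (gauss d :: 'a \<Rightarrow> complex))" if "b \<in> Basis" for b :: 'a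
      by (rule wbd_mono[OF wbd_dpart_gauss[OF C that]]) auto
    moreover have "cmod (gauss d x) \<le> max C' ?C * wt x powi (- int k)" for x :: 'a
      by (rule order_trans[OF C' mult_right_mono]) (auto simp: less_imp_le)
    ultimately have "wbd (Suc n) (- int k) (max C' ?C) (gauss d :: 'a \<Rightarrow> complex)"
      by (simp add: gauss_differentiable del: max.bounded_iff)
    then show ?case ..
  qed
  then show ?thesis by (simp add: schwartz_iff)
qed

lemma wbd_gauss_uniform:
  assumes w: "wbd n m (d * C) (\<lambda>x::'a::euclidean_space. gauss d x - 1)" and d: "d \<in> {0<..1}" and m: "0 \<le> m"
  shows "wbd n m (C + 1) (gauss d :: 'a \<Rightarrow> complex)"
proof -
  have "0 \<le> C" using wbd_nonneg[OF w] d by (simp add: zero_le_mult_iff)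
  then have "d * C \<le> C" using d by (intro mult_left_le_one_le) auto
  moreover have "wbd n m (d * C + 1) (\<lambda>x::'a. (gauss d x - 1) + 1)" by (intro wbd_add[OF w] wbd_const m) simp
  ultimately have "wbd n m (C + 1) (\<lambda>x::'a. (gauss d x - 1) + 1)" by (elim wbd_mono) auto
  then show ?thesis by simp
qed

text \<open>Convergence to 1 is not uniform in \<open>x\<close>, hence the growing weight. At order
  0 the bound is \<open>1 - exp (- t) \<le> t\<close> with \<open>t = d * (norm x)^2\<close>, which
  costs one power of the weight; each derivative costs another one, which explains
  \<open>n + 1\<close>.\<close>

lemma gauss_minus_one:
  "\<exists>C. \<forall>d\<in>{0<..1}. wbd n (int n + 1) (d * C) (\<lambda>x::'a::euclidean_space. gauss d x - 1)"
proof (induction n)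
  have base: "cmod (gauss d x - 1) \<le> d * wt x" if "d \<in> {0<..1}" for d and x :: 'a
  proof -
    have "cmod (gauss d x - 1) = \<bar>exp (- d * (norm x)\<^sup>2) - 1\<bar>"
      unfolding gauss_def by (metis norm_of_real of_real_1 of_real_diff)
    also have "\<dots> = 1 - exp (- d * (norm x)\<^sup>2)" using that by simp
    also have "\<dots> \<le> d * (norm x)\<^sup>2" using exp_ge_add_one_self[of "- d * (norm x)\<^sup>2"] by simp
    also have "\<dots> \<le> d * wt x" using that by (simp add: wt_def)
    finally show ?thesis .
  qed
  {
    case 0
    then show ?case using base by (intro exI[of _ 1]) auto
  next
    case (Suc n)
    then obtain C where C: "\<And>d. d \<in> {0<..1} \<Longrightarrow> wbd n (int n + 1) (d * C) (\<lambda>x::'a. gauss d x - 1)" by blast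
    let ?C = "2 * (2 ^ n * (C + 1))"
    have "wbd (Suc n) (int (Suc n) + 1) (d * max 1 ?C) (\<lambda>x::'a. gauss d x - 1)" if d: "d \<in> {0<..1}" for d
    proof -
      have D: "((\<lambda>x::'a. gauss d x - 1) has_derivative (\<lambda>h. (- 2 * complex_of_real d) * (complex_of_real (x \<bullet> h) * gauss d x))) (at x)" for x
        using has_derivative_diff[OF gauss_deriv has_derivative_const] by simp
      have dp: "dpart b (\<lambda>x::'a. gauss d x - 1) = dpart b (gauss d)" for b
        unfolding dpart_gauss by (intro ext dpart_eqI[OF D])
      have g: "wbd n (int n + 1) (C + 1) (gauss d :: 'a \<Rightarrow> complex)" by (rule wbd_gauss_uniform[OF C[OF d] d]) simp
      have "d * ?C \<le> d * max 1 ?C" using d by (intro mult_left_mono) auto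
      then have "2 * \<bar>d\<bar> * (2 ^ n * (C + 1)) \<le> d * max 1 ?C" using d by (simp add: mult_ac)
      then have "wbd n (int (Suc n) + 1) (d * max 1 ?C) (dpart b (\<lambda>x::'a. gauss d x - 1))" if "b \<in> Basis" for b :: 'a
        unfolding dp by (intro wbd_mono[OF wbd_dpart_gauss[OF g that]]) auto
      moreover have "cmod (gauss d x - 1) \<le> d * max 1 ?C * wt x powi (int (Suc n) + 1)" for x :: 'a
      proof (rule order_trans[OF base[OF d] mult_mono])
        show "wt x \<le> wt x powi (int (Suc n) + 1)" using wt_powi_mono[of 1 "int (Suc n) + 1" x] by simp
      qed (use d in auto)
      moreover have "(\<lambda>x::'a. gauss d x - 1) differentiable at x" for x using D by (auto simp: differentiable_def)
      ultimately show ?thesis unfolding wbd.simps by blast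
    qed
    then show ?case by blast
  }
qed

text \<open>The point is a constant independent of \<open>d\<close>: the decay of the Gaussian
  degenerates as \<open>d\<close> tends to 0, and a growing weight is accepted in exchange.\<close>

lemma gauss_uniform:
  "\<exists>C. \<forall>d\<in>{0<..1}. wbd n (int n + 1) C (gauss d :: 'a::euclidean_space \<Rightarrow> complex)"
proof -
  obtain C where C: "\<And>d. d \<in> {0<..1} \<Longrightarrow> wbd n (int n + 1) (d * C) (\<lambda>x::'a. gauss d x - 1)"
    using gauss_minus_one by blast
  have "wbd n (int n + 1) (C + 1) (gauss d :: 'a \<Rightarrow> complex)" if "d \<in> {0<..1}" for d
    by (rule wbd_gauss_uniform[OF C[OF that] that]) simp
  then show ?thesis by blast
qed

text \<open>The decay of \<open>f\<close> compensates the growth \<open>n + 1\<close> of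
  \<open>gauss d - 1\<close>, so the regularization converges at rate \<open>d\<close> in every
  seminorm.\<close>

lemma gauss_approx:
  assumes "f \<in> schwartz"
  shows "\<exists>C. \<forall>d\<in>{0<..1}. wbd n (- int k) (d * C) (\<lambda>x. gauss d x * f x - f x)"
proof -
  obtain C where C: "\<And>d. d \<in> {0<..1} \<Longrightarrow> wbd n (int n + 1) (d * C) (\<lambda>x::'a. gauss d x - 1)"
    using gauss_minus_one by blast
  obtain D where D: "wbd n (- int (k + n + 1)) D f" using schwartz_wbd[OF assms] by blast
  have "wbd n (- int k) (d * (2 ^ n * C * D)) (\<lambda>x. gauss d x * f x - f x)" if "d \<in> {0<..1}" for d
    using wbd_mult[OF C[OF that] D] by (simp add: algebra_simps)
  then show ?thesis by blast
qed

section \<open>The topology of the Schwartz space\<close>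

lemma weighted_sup_le:
  assumes "\<And>x. cmod (f x) \<le> C * wt x powi (- int k)"
  shows "weighted_sup k f \<le> C"
  unfolding weighted_sup_def by (rule cSUP_least) (simp_all add: weighted_le_iff assms)

text \<open>A real supremum carries information only over a bounded range; the bound with
  \<open>D\<close>, of arbitrary size, provides this.\<close>

lemma weighted_sup_bound:
  assumes "cmod (f x) \<le> C * wt x powi (- int k)" "\<And>x. cmod (f x) \<le> D * wt x powi (- int k)"
  shows "cmod (f x) \<le> weighted_sup k f * wt x powi (- int k)"
proof -
  have "bdd_above (range (weighted k f))"
    using assms(2) weighted_le_iff unfolding bdd_above_def by blast
  then have "weighted k f x \<le> weighted_sup k f"
    unfolding weighted_sup_def by (rule cSUP_upper[OF UNIV_I])
  then show ?thesis by (simp add: weighted_le_iff)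
qed

text \<open>The bounds \<open>wbd n (- int k)\<close> form a directed family: finitely many seminorm
  conditions follow from one bound with the largest order and weight and the smallest radius.
  Neighbourhoods thus become balls of single norms.\<close>

lemma eventually_schwartz_nhds:
  assumes f: "f \<in> schwartz"
  shows "eventually P (schwartz_nhds f) \<longleftrightarrow>
    (\<exists>n k e. 0 < e \<and> (\<forall>h\<in>schwartz. wbd n (- int k) e (\<lambda>x. h x - f x) \<longrightarrow> P h))"
proof
  let ?I = "UNIV \<times> lists Basis \<times> {0<..} :: (nat \<times> 'a list \<times> real) set"
  let ?S = "\<lambda>(k, bs, e). {h \<in> schwartz. weighted_sup k (partials bs (\<lambda>x. h x - f x)) < e}"
  assume "eventually P (schwartz_nhds f)"
  then have "eventually P (INF i\<in>?I. principal (?S i))"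
    unfolding schwartz_nhds_def by (simp add: case_prod_beta')
  then obtain X where X: "X \<subseteq> ?I" "finite X" "eventually P (INF i\<in>X. principal (?S i))"
    unfolding eventually_INF[of _ _ ?I] by blast
  have ev: "\<And>h. (\<forall>i\<in>X. h \<in> ?S i) \<Longrightarrow> P h"
    using X(3) unfolding INF_principal_finite[OF X(2)] eventually_principal by blast
  have "\<exists>n k e. 0 < e \<and> (\<forall>h\<in>schwartz. wbd n (- int k) e (\<lambda>x. h x - f x) \<longrightarrow> (\<forall>i\<in>X. h \<in> ?S i))"
    using X(2,1)
  proof (induction X rule: finite_induct)
    case empty
    show ?case by (auto intro!: exI[of _ 1])
  next
    case (insert i X)
    have "X \<subseteq> ?I" using insert.prems by blast
    from insert.IH[OF this] obtain n k e where IH: "0 < e" "\<And>h. h\<in>schwartz \<Longrightarrow> wbd n (- int k) e (\<lambda>x. h x - f x) \<Longrightarrow> \<forall>i\<in>X. h \<in> ?S i"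
      by blast
    obtain k' bs e' where i: "i = (k', bs, e')" "bs \<in> lists Basis" "0 < e'" using insert.prems by auto
    \<comment> \<open>The radius is halved because \<open>wbd\<close> bounds are weak inequalities
      while the seminorm condition is strict.\<close>
    have "h \<in> ?S i \<and> (\<forall>i\<in>X. h \<in> ?S i)"
      if h: "h \<in> schwartz" and w: "wbd (max n (length bs)) (- int (max k k')) (min e (e' / 2)) (\<lambda>x. h x - f x)" for h
    proof
      show "\<forall>i\<in>X. h \<in> ?S i"
        by (rule IH(2)[OF h wbd_mono[OF w]]) auto
      have "wbd (length bs) (- int k') (e' / 2) (\<lambda>x. h x - f x)" by (rule wbd_mono[OF w]) auto
      then have "cmod (partials bs (\<lambda>x. h x - f x) x) \<le> e' / 2 * wt x powi (- int k')" for x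
        unfolding wbd_iff_partials using i(2) by blast
      then have "weighted_sup k' (partials bs (\<lambda>x. h x - f x)) \<le> e' / 2" by (rule weighted_sup_le)
      then show "h \<in> ?S i" using h i by auto
    qed
    then show ?case using IH(1) i(3)
      by (intro exI[of _ "max n (length bs)"] exI[of _ "max k k'"] exI[of _ "min e (e' / 2)"]) auto
  qed
  then show "\<exists>n k e. 0 < e \<and> (\<forall>h\<in>schwartz. wbd n (- int k) e (\<lambda>x. h x - f x) \<longrightarrow> P h)"
    using ev by meson
next
  assume "\<exists>n k e. 0 < e \<and> (\<forall>h\<in>schwartz. wbd n (- int k) e (\<lambda>x. h x - f x) \<longrightarrow> P h)"
  then obtain n k e where e: "0 < e" "\<And>h. h \<in> schwartz \<Longrightarrow> wbd n (- int k) e (\<lambda>x. h x - f x) \<Longrightarrow> P h" by blast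
  have *: "\<forall>\<^sub>F h in schwartz_nhds f. h \<in> schwartz \<and> weighted_sup k (partials bs (\<lambda>x. h x - f x)) < e"
    if "bs \<in> lists Basis" for bs
  proof -
    have "schwartz_nhds f \<le> principal {h \<in> schwartz. weighted_sup k (partials bs (\<lambda>x. h x - f x)) < e}"
      unfolding schwartz_nhds_def by (rule INF_lower2[of "(k, bs, e)"]) (use that e in auto)
    then show ?thesis by (simp add: le_principal)
  qed
  have "\<forall>\<^sub>F h in schwartz_nhds f. \<forall>bs\<in>{bs \<in> lists Basis. length bs \<le> n}.
      h \<in> schwartz \<and> weighted_sup k (partials bs (\<lambda>x. h x - f x)) < e"
    by (rule eventually_ball_finite[OF finite_lists_Basis]) (use * in auto)
  then show "eventually P (schwartz_nhds f)"
  proof (rule eventually_mono)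
    fix h assume h: "\<forall>bs\<in>{bs \<in> lists Basis. length bs \<le> n}.
      h \<in> schwartz \<and> weighted_sup k (partials bs (\<lambda>x. h x - f x)) < e"
    then have hS: "h \<in> schwartz" by (metis (mono_tags, lifting) le0 list.size(3) lists.Nil mem_Collect_eq)
    \<comment> \<open>A bound of unspecified size: it certifies that the suprema range over bounded
      sets and supplies differentiability, while the radius \<open>e\<close> comes from the
      neighbourhood.\<close>
    obtain D where D: "wbd (Suc n) (- int k) D (\<lambda>x. h x - f x)" using schwartz_wbd[OF schwartz_diff[OF hS f]] by blast
    have "wbd n (- int k) e (\<lambda>x. h x - f x)"
      unfolding wbd_iff_partials
    proof (intro ballI impI conjI allI)
      fix bs :: "'a list" and x assume bs: "bs \<in> lists Basis" "length bs \<le> n"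
      have D': "cmod (partials bs (\<lambda>x. h x - f x) x) \<le> D * wt x powi (- int k)" for x
        using D bs unfolding wbd_iff_partials by auto
      have "cmod (partials bs (\<lambda>x. h x - f x) x) \<le> weighted_sup k (partials bs (\<lambda>x. h x - f x)) * wt x powi (- int k)"
        by (rule weighted_sup_bound) (rule D')+
      also have "\<dots> \<le> e * wt x powi (- int k)" using h bs by (intro mult_right_mono) (auto simp: less_imp_le)
      finally show "cmod (partials bs (\<lambda>x. h x - f x) x) \<le> e * wt x powi (- int k)" .
    next
      fix bs :: "'a list" and x assume bs: "bs \<in> lists Basis" "length bs \<le> n"
      then show "partials bs (\<lambda>x. h x - f x) differentiable at x"
        using D unfolding wbd_iff_partials by auto
    qed
    with hS e(2) show "P h" by blast
  qed
qed

text \<open>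
  Boundedness of \<open>A\<close> from some weighted norm to the norm with indices \<open>n\<close>, \<open>k\<close>. A single \<open>N\<close> serves
  as order, weight and constant, so that finitely many such \<open>N\<close> have a common bound.
\<close>

definition wbd_op :: "nat \<Rightarrow> nat \<Rightarrow> (('a::euclidean_space \<Rightarrow> complex) \<Rightarrow> 'b::euclidean_space \<Rightarrow> complex) \<Rightarrow> nat \<Rightarrow> bool" where
  "wbd_op n k A N \<longleftrightarrow> (\<forall>f\<in>schwartz. \<forall>C. wbd N (- int N) C f \<longrightarrow> wbd n (- int k) (real N * C) (A f))"

text \<open>Continuous linear operators between Schwartz spaces, with continuity stated through
  seminorm estimates. The estimates also force the values to be Schwartz functions.\<close>

definition schwartz_op :: "(('a::euclidean_space \<Rightarrow> complex) \<Rightarrow> 'b::euclidean_space \<Rightarrow> complex) \<Rightarrow> bool" where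
  "schwartz_op A \<longleftrightarrow>
     (\<forall>f\<in>schwartz. \<forall>h\<in>schwartz. \<forall>a b. A (\<lambda>x. a * f x + b * h x) = (\<lambda>x. a * A f x + b * A h x)) \<and>
     (\<forall>n k. \<exists>N. wbd_op n k A N)"

lemma wbd_opD: "wbd_op n k A N \<Longrightarrow> f \<in> schwartz \<Longrightarrow> wbd N (- int N) C f \<Longrightarrow> wbd n (- int k) (real N * C) (A f)"
  by (simp add: wbd_op_def)

lemma wbd_opI:
  assumes "\<And>f C. f \<in> schwartz \<Longrightarrow> wbd n' (- int k') C f \<Longrightarrow> wbd n (- int k) (K * C) (A f)"
  shows "\<exists>N. wbd_op n k A N"
proof -
  let ?N = "max (max n' k') (nat \<lceil>K\<rceil>)"
  have "wbd n (- int k) (real ?N * C) (A f)" if f: "f \<in> schwartz" "wbd ?N (- int ?N) C f" for f C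
  proof -
    have "wbd n' (- int k') C f" by (rule wbd_mono[OF f(2)]) auto
    from assms[OF f(1) this] show ?thesis
    proof (rule wbd_mono)
      have "K \<le> real ?N" using real_nat_ceiling_ge[of K] by linarith
      then show "K * C \<le> real ?N * C" using wbd_nonneg[OF f(2)] by (rule mult_right_mono)
    qed auto
  qed
  then show ?thesis unfolding wbd_op_def by blast
qed

lemma wbd_op_mono:
  assumes "wbd_op n k A N" "N \<le> M"
  shows "wbd_op n k A M"
  unfolding wbd_op_def
proof (intro ballI allI impI)
  fix f :: "'a \<Rightarrow> complex" and C assume f: "f \<in> schwartz" "wbd M (- int M) C f"
  have "wbd N (- int N) C f" by (rule wbd_mono[OF f(2)]) (use assms in auto)
  from wbd_opD[OF assms(1) f(1) this] show "wbd n (- int k) (real M * C) (A f)"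
    by (rule wbd_mono) (use assms(2) wbd_nonneg[OF f(2)] in \<open>auto intro: mult_right_mono\<close>)
qed

lemma schwartz_op_bound:
  assumes "schwartz_op A"
  obtains N where "0 < N" "wbd_op n k A N"
proof -
  obtain N where "wbd_op n k A N" using assms unfolding schwartz_op_def by blast
  then have "wbd_op n k A (Suc N)" by (rule wbd_op_mono) simp
  then show ?thesis using that[of "Suc N"] by simp
qed

lemma wbd_op_comp:
  fixes A :: "('b::euclidean_space \<Rightarrow> complex) \<Rightarrow> 'c::euclidean_space \<Rightarrow> complex"
    and B :: "('a::euclidean_space \<Rightarrow> complex) \<Rightarrow> 'b \<Rightarrow> complex"
  assumes A: "wbd_op n k A N" and B: "schwartz_op B" "\<And>f. f \<in> schwartz \<Longrightarrow> B f \<in> schwartz"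
  shows "\<exists>M. wbd_op n k (\<lambda>f. A (B f)) M"
proof -
  obtain M where M: "wbd_op N N B M" using schwartz_op_bound[OF B(1)] by blast
  show ?thesis
  proof (rule wbd_opI)
    show "wbd n (- int k) (real N * real M * C) (A (B f))" if "f \<in> schwartz" "wbd M (- int M) C f" for f C
      using wbd_opD[OF A B(2)[OF that(1)] wbd_opD[OF M that]] by (simp add: mult.assoc)
  qed
qed

lemma schwartz_op_in:
  assumes "schwartz_op A" "f \<in> schwartz"
  shows "A f \<in> schwartz"
  unfolding schwartz_iff
proof (intro allI)
  fix n k
  obtain N where N: "wbd_op n k A N" using schwartz_op_bound[OF assms(1)] by blast
  obtain C where "wbd N (- int N) C f" using schwartz_wbd[OF assms(2)] by blast
  from wbd_opD[OF N assms(2) this] show "\<exists>C. wbd n (- int k) C (A f)" ..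
qed

lemma schwartz_op_lin:
  "schwartz_op A \<Longrightarrow> f \<in> schwartz \<Longrightarrow> h \<in> schwartz \<Longrightarrow> A (\<lambda>x. a * f x + b * h x) = (\<lambda>x. a * A f x + b * A h x)"
  by (simp add: schwartz_op_def)

lemma schwartz_op_diff:
  "schwartz_op A \<Longrightarrow> f \<in> schwartz \<Longrightarrow> h \<in> schwartz \<Longrightarrow> A (\<lambda>x. f x - h x) = (\<lambda>x. A f x - A h x)"
  using schwartz_op_lin[of A f h 1 "-1"] by simp

lemma schwartz_op_comp:
  fixes A :: "('b::euclidean_space \<Rightarrow> complex) \<Rightarrow> 'c::euclidean_space \<Rightarrow> complex"
    and B :: "('a::euclidean_space \<Rightarrow> complex) \<Rightarrow> 'b \<Rightarrow> complex"
  assumes "schwartz_op A" "schwartz_op B"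
  shows "schwartz_op (\<lambda>f. A (B f))"
  unfolding schwartz_op_def
proof (intro conjI allI ballI)
  fix f h a b assume "f \<in> (schwartz :: ('a \<Rightarrow> complex) set)" "h \<in> (schwartz :: ('a \<Rightarrow> complex) set)"
  then show "A (B (\<lambda>x. a * f x + b * h x)) = (\<lambda>x. a * A (B f) x + b * A (B h) x)"
    using assms by (simp add: schwartz_op_lin schwartz_op_in)
next
  show "\<exists>N. wbd_op n k (\<lambda>f. A (B f)) N" for n k
    using schwartz_op_bound[OF assms(1)] wbd_op_comp[OF _ assms(2) schwartz_op_in[OF assms(2)]] by metis
qed

text \<open>By linearity the estimate for \<open>h - f\<close> gives continuity at every
  \<open>f\<close>. Fields, whose continuity is stated with \<open>schwartz_nhds\<close>, are
  composed with operators by means of this.\<close>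

lemma filterlim_schwartz_op:
  assumes A: "schwartz_op A" and f: "f \<in> schwartz"
  shows "filterlim A (schwartz_nhds (A f)) (schwartz_nhds f)"
  unfolding filterlim_iff
proof (intro allI impI)
  fix P assume "eventually P (schwartz_nhds (A f))"
  then obtain n k e where e: "0 < e" "\<And>h. h \<in> schwartz \<Longrightarrow> wbd n (- int k) e (\<lambda>x. h x - A f x) \<Longrightarrow> P h"
    unfolding eventually_schwartz_nhds[OF schwartz_op_in[OF A f]] by blast
  obtain N where N: "0 < N" "wbd_op n k A N" using schwartz_op_bound[OF A] by blast
  have "P (A h)" if h: "h \<in> schwartz" "wbd N (- int N) (e / N) (\<lambda>x. h x - f x)" for h
  proof (rule e(2))
    show "A h \<in> schwartz" by (rule schwartz_op_in[OF A h(1)])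
    show "wbd n (- int k) e (\<lambda>x. A h x - A f x)"
      using wbd_opD[OF N(2) schwartz_diff[OF h(1) f] h(2)] N(1) by (simp add: schwartz_op_diff[OF A h(1) f])
  qed
  moreover have "0 < e / N" using e N by simp
  ultimately show "\<forall>\<^sub>F x in schwartz_nhds f. P (A x)"
    unfolding eventually_schwartz_nhds[OF f] by blast
qed

section \<open>Basic continuous operators\<close>

lemma schwartz_op_mult: "u \<in> slowly_increasing \<Longrightarrow> schwartz_op (\<lambda>f x. u x * f x)"
  unfolding schwartz_op_def
proof (intro conjI allI ballI)
  assume u: "u \<in> slowly_increasing"
  show "\<exists>N. wbd_op n k (\<lambda>f x. u x * f x) N" for n k
    using wbd_si_mult[OF u, of n k] wbd_opI[of _ _ n k _ "\<lambda>f x. u x * f x"] by blast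
qed (simp add: algebra_simps)

lemma schwartz_op_reflect: "schwartz_op reflect"
  unfolding schwartz_op_def
proof (intro conjI allI ballI)
  show "\<exists>N. wbd_op n k reflect N" for n k
    by (rule wbd_opI[of n k _ _ 1]) (simp add: wbd_reflect)
qed (simp add: reflect_def fun_eq_iff)

lemma schwartz_op_dpart: "b \<in> Basis \<Longrightarrow> schwartz_op (dpart b)"
  unfolding schwartz_op_def
proof (intro conjI allI ballI)
  assume b: "b \<in> Basis"
  show "\<exists>N. wbd_op n k (dpart b) N" for n k
    by (rule wbd_opI[of "Suc n" k _ _ 1]) (use b in simp)
next
  fix f h :: "'a \<Rightarrow> complex" and u v assume S: "f \<in> schwartz" "h \<in> schwartz"
  have d: "(\<lambda>x. c * f x) differentiable at x" if "f \<in> schwartz" for c x and f :: "'a \<Rightarrow> complex"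
    using schwartz_differentiable[OF schwartz_cmult[OF that]] .
  show "dpart b (\<lambda>x. u * f x + v * h x) = (\<lambda>x. u * dpart b f x + v * dpart b h x)"
    using S by (simp add: dpart_add d dpart_cmult schwartz_differentiable)
qed

lemma schwartz_op_add:
  fixes A :: "('a::euclidean_space \<Rightarrow> complex) \<Rightarrow> 'b::euclidean_space \<Rightarrow> complex"
  assumes "schwartz_op A" "schwartz_op B"
  shows "schwartz_op (\<lambda>f x. A f x + B f x)"
  unfolding schwartz_op_def
proof (intro conjI allI ballI)
  fix f h a b assume "f \<in> (schwartz :: ('a \<Rightarrow> complex) set)" "h \<in> (schwartz :: ('a \<Rightarrow> complex) set)"
  then show "(\<lambda>x. A (\<lambda>x. a * f x + b * h x) x + B (\<lambda>x. a * f x + b * h x) x) =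
      (\<lambda>x. a * (A f x + B f x) + b * (A h x + B h x))"
    using assms by (simp add: schwartz_op_lin algebra_simps)
next
  fix n k
  obtain N M where N: "wbd_op n k A N" and M: "wbd_op n k B M"
    using schwartz_op_bound[OF assms(1)] schwartz_op_bound[OF assms(2)] by metis
  show "\<exists>N. wbd_op n k (\<lambda>f x. A f x + B f x) N"
  proof (rule wbd_opI)
    show "wbd n (- int k) ((real N + real M) * C) (\<lambda>x. A f x + B f x)"
      if f: "f \<in> schwartz" "wbd (max N M) (- int (max N M)) C f" for f C
      unfolding distrib_right
      by (intro wbd_add wbd_opD[OF N f(1)] wbd_opD[OF M f(1)] wbd_mono[OF f(2)]) auto
  qed
qed

lemma schwartz_op_id: "schwartz_op (\<lambda>f. f)"
  using schwartz_op_mult[OF si_const[of 1]] by simp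

section \<open>Tempered distributions\<close>

text \<open>Continuity is replaced by a single seminorm estimate and extensionality is dropped, so
  that functionals can be composed with operators without restricting their domain each
  time.\<close>

definition tempered_functional :: "(('a::euclidean_space \<Rightarrow> complex) \<Rightarrow> complex) \<Rightarrow> bool" where
  "tempered_functional T \<longleftrightarrow>
     (\<forall>f\<in>schwartz. \<forall>h\<in>schwartz. \<forall>a b. T (\<lambda>x. a * f x + b * h x) = a * T f + b * T h) \<and>
     (\<exists>n k K. \<forall>f\<in>schwartz. \<forall>C. wbd n (- int k) C f \<longrightarrow> cmod (T f) \<le> K * C)"

lemma tempered_functional_lin:
  "tempered_functional T \<Longrightarrow> f \<in> schwartz \<Longrightarrow> h \<in> schwartz \<Longrightarrow> T (\<lambda>x. a * f x + b * h x) = a * T f + b * T h"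
  by (simp add: tempered_functional_def)

lemma tempered_functional_diff:
  "tempered_functional T \<Longrightarrow> f \<in> schwartz \<Longrightarrow> h \<in> schwartz \<Longrightarrow> T (\<lambda>x. f x - h x) = T f - T h"
  using tempered_functional_lin[of T f h 1 "-1"] by simp

lemma tempered_functional_cmult:
  "tempered_functional T \<Longrightarrow> f \<in> schwartz \<Longrightarrow> T (\<lambda>x. a * f x) = a * T f"
  using tempered_functional_lin[of T f f a 0] by simp

lemma tempered_functional_bound:
  assumes "tempered_functional T"
  obtains n k K where "0 < K" "\<And>f C. f \<in> schwartz \<Longrightarrow> wbd n (- int k) C f \<Longrightarrow> cmod (T f) \<le> K * C"
proof -
  obtain n k K where K: "\<And>f C. f \<in> schwartz \<Longrightarrow> wbd n (- int k) C f \<Longrightarrow> cmod (T f) \<le> K * C"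
    using assms unfolding tempered_functional_def by meson
  have "cmod (T f) \<le> (\<bar>K\<bar> + 1) * C" if "f \<in> schwartz" "wbd n (- int k) C f" for f C
    by (rule order_trans[OF K[OF that]]) (use wbd_nonneg[OF that(2)] in \<open>auto intro!: mult_right_mono\<close>)
  then show ?thesis by (intro that[of "\<bar>K\<bar> + 1" n k]) auto
qed

lemma tempered_functional_comp:
  fixes A :: "('b::euclidean_space \<Rightarrow> complex) \<Rightarrow> 'a::euclidean_space \<Rightarrow> complex"
  assumes "tempered_functional T" "schwartz_op A"
  shows "tempered_functional (\<lambda>f. T (A f))"
  unfolding tempered_functional_def
proof (intro conjI allI ballI)
  fix f h a b assume "f \<in> (schwartz :: ('b \<Rightarrow> complex) set)" "h \<in> (schwartz :: ('b \<Rightarrow> complex) set)"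
  then show "T (A (\<lambda>x. a * f x + b * h x)) = a * T (A f) + b * T (A h)"
    using assms by (simp add: schwartz_op_lin schwartz_op_in tempered_functional_lin)
next
  obtain n k K1 where 1: "\<And>f C. f \<in> schwartz \<Longrightarrow> wbd n (- int k) C f \<Longrightarrow> cmod (T f) \<le> K1 * C"
    using tempered_functional_bound[OF assms(1)] by metis
  obtain N where N: "wbd_op n k A N" using schwartz_op_bound[OF assms(2)] by blast
  have "cmod (T (A f)) \<le> K1 * real N * C" if "f \<in> schwartz" "wbd N (- int N) C f" for f C
    using 1[OF schwartz_op_in[OF assms(2) that(1)] wbd_opD[OF N that]] by (simp add: mult.assoc)
  then show "\<exists>n k K. \<forall>f\<in>schwartz. \<forall>C. wbd n (- int k) C f \<longrightarrow> cmod (T (A f)) \<le> K * C" by blast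
qed

lemma tempered_functional_tendsto:
  assumes T: "tempered_functional T" and f: "f \<in> schwartz"
  shows "(T \<longlongrightarrow> T f) (schwartz_nhds f)"
proof (rule tendstoI)
  fix e :: real assume e: "0 < e"
  obtain n k K where K: "0 < K" "\<And>f C. f \<in> schwartz \<Longrightarrow> wbd n (- int k) C f \<Longrightarrow> cmod (T f) \<le> K * C"
    using tempered_functional_bound[OF T] by metis
  have "dist (T h) (T f) < e" if h: "h \<in> schwartz" "wbd n (- int k) (e / (2 * K)) (\<lambda>x. h x - f x)" for h
    using K(2)[OF schwartz_diff[OF h(1) f] h(2)] K(1) e
    by (simp add: tempered_functional_diff[OF T h(1) f] dist_norm)
  moreover have "0 < e / (2 * K)" using e K by simp
  ultimately show "\<forall>\<^sub>F h in schwartz_nhds f. dist (T h) (T f) < e"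
    unfolding eventually_schwartz_nhds[OF f] by blast
qed

text \<open>Continuity at 0 yields a ball on which \<open>T\<close> stays below 1, and homogeneity
  turns this into a seminorm estimate.\<close>

lemma tempered_iff:
  "T \<in> tempered_distributions \<longleftrightarrow> T \<in> extensional schwartz \<and> tempered_functional T"
proof
  assume R: "T \<in> extensional schwartz \<and> tempered_functional T"
  then show "T \<in> tempered_distributions"
    by (simp add: tempered_distributions_def tempered_functional_tendsto tempered_functional_lin)
next
  assume T: "T \<in> tempered_distributions"
  then have lin: "T (\<lambda>x. a * f x + b * h x) = a * T f + b * T h" if "f \<in> schwartz" "h \<in> schwartz" for f h a b
    using that by (simp add: tempered_distributions_def)
  have T0: "T (\<lambda>x. 0) = 0" using lin[OF schwartz_zero schwartz_zero, of 0 0] by simp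
  have "(T \<longlongrightarrow> T (\<lambda>x. 0)) (schwartz_nhds (\<lambda>x. 0))"
    using T schwartz_zero by (auto simp: tempered_distributions_def)
  then have "\<forall>\<^sub>F h in schwartz_nhds (\<lambda>x. 0). dist (T h) 0 < 1"
    unfolding T0 by (rule tendstoD) simp
  then obtain n k e where e: "0 < e" "\<And>h. h \<in> schwartz \<Longrightarrow> wbd n (- int k) e h \<Longrightarrow> cmod (T h) < 1"
    unfolding eventually_schwartz_nhds[OF schwartz_zero] by auto
  have "cmod (T f) \<le> 1 / e * C" if f: "f \<in> schwartz" "wbd n (- int k) C f" for f C
  \<comment> \<open>A zero bound cannot be rescaled to \<open>e\<close>; it forces \<open>f\<close>
    to vanish.\<close>
  proof (cases "C = 0")
    case True
    then have "f x = 0" for x using wbd_bound[OF f(2), of x] by simp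
    then have "f = (\<lambda>x. 0)" by auto
    then show ?thesis using True T0 by simp
  next
    case False
    then have C: "0 < C" using wbd_nonneg[OF f(2)] by simp
    let ?c = "complex_of_real (e / C)"
    have "wbd n (- int k) e (\<lambda>x. ?c * f x)" using wbd_cmult[OF f(2), of ?c] C e(1) by (simp add: norm_divide)
    then have "cmod (T (\<lambda>x. ?c * f x)) < 1" using e(2)[OF schwartz_cmult[OF f(1)]] by blast
    moreover have "T (\<lambda>x. ?c * f x) = ?c * T f" using lin[OF f(1) f(1), of ?c 0] by simp
    ultimately have "e / C * cmod (T f) < 1" using C e(1) by (simp add: norm_mult norm_divide)
    then show ?thesis using C e(1) by (simp add: field_simps)
  qed
  then have "tempered_functional T" unfolding tempered_functional_def using lin by blast
  then show "T \<in> extensional schwartz \<and> tempered_functional T"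
    using T by (simp add: tempered_distributions_def)
qed

lemma tempered_restrict: "tempered_functional T \<Longrightarrow> (\<lambda>h\<in>schwartz. T h) \<in> tempered_distributions"
  unfolding tempered_iff tempered_functional_def
  by (auto simp: schwartz_lin)

lemma tempered_functional_gauss:
  assumes T: "tempered_functional T" and f: "f \<in> schwartz"
  shows "((\<lambda>d. T (\<lambda>x. gauss d x * f x)) \<longlongrightarrow> T f) (at_right 0)"
proof -
  obtain n k K where K: "0 < K" "\<And>f C. f \<in> schwartz \<Longrightarrow> wbd n (- int k) C f \<Longrightarrow> cmod (T f) \<le> K * C"
    using tempered_functional_bound[OF T] by metis
  obtain C where C: "\<And>d. d \<in> {0<..1} \<Longrightarrow> wbd n (- int k) (d * C) (\<lambda>x. gauss d x * f x - f x)"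
    using gauss_approx[OF f] by blast
  have "cmod (T (\<lambda>x. gauss d x * f x) - T f) \<le> K * (d * C)" if d: "d \<in> {0<..1}" for d
  proof -
    have g: "(\<lambda>x. gauss d x * f x) \<in> schwartz"
      using d by (intro schwartz_mult[OF schwartz_si[OF gauss_schwartz] f]) auto
    show ?thesis
      using K(2)[OF schwartz_diff[OF g f] C[OF d]] by (simp add: tempered_functional_diff[OF T g f])
  qed
  then have "\<forall>\<^sub>F d in at_right 0. norm (T (\<lambda>x. gauss d x * f x) - T f) \<le> K * (d * C)"
    by (intro eventually_at_rightI[of 0 1]) auto
  moreover have "((\<lambda>d. K * (d * C)) \<longlongrightarrow> 0) (at_right 0)"
    by (auto intro!: tendsto_eq_intros)
  ultimately have "((\<lambda>d. T (\<lambda>x. gauss d x * f x) - T f) \<longlongrightarrow> 0) (at_right 0)"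
    by (rule Lim_null_comparison)
  then show ?thesis by (simp add: LIM_zero_iff)
qed

lemma tempered_functional_eqI:
  assumes T: "tempered_functional T" "tempered_functional S"
    and eq: "\<And>d. 0 < d \<Longrightarrow> T (\<lambda>x. gauss d x * f x) = S (\<lambda>x. gauss d x * f x)"
    and f: "f \<in> schwartz"
  shows "T f = S f"
proof -
  have "\<forall>\<^sub>F d in at_right 0. T (\<lambda>x. gauss d x * f x) = S (\<lambda>x. gauss d x * f x)"
    using eq by (intro eventually_at_rightI[of 0 1]) auto
  then have "((\<lambda>d. T (\<lambda>x. gauss d x * f x)) \<longlongrightarrow> S f) (at_right 0)"
    using tempered_functional_gauss[OF T(2) f] by (simp add: tendsto_cong)
  then show ?thesis
    using tempered_functional_gauss[OF T(1) f] tendsto_unique trivial_limit_at_right_real by blast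
qed

section \<open>Integration\<close>

text \<open>\<open>lborel\<close> is the image of the product of one-dimensional Lebesgue measures
  under the map that assembles coordinates, so products of one-variable functions integrate
  factorwise. This serves the integrability of the weight and the Gaussian integral.\<close>

lemma
  fixes \<phi> :: "'a::euclidean_space \<Rightarrow> real \<Rightarrow> 'b::{real_normed_field,banach,second_countable_topology}"
  assumes "\<And>b. b \<in> Basis \<Longrightarrow> integrable lborel (\<phi> b)"
  shows integrable_lborel_prod: "integrable lborel (\<lambda>x. \<Prod>b\<in>Basis. \<phi> b (x \<bullet> b))"
    and integral_lborel_prod: "(LINT x|lborel. (\<Prod>b\<in>Basis. \<phi> b (x \<bullet> b))) = (\<Prod>b\<in>Basis. LINT t|lborel. \<phi> b t)"
proof -
  interpret product_sigma_finite "\<lambda>b::'a. lborel :: real measure" ..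
  have m: "(\<lambda>f. \<Sum>b\<in>Basis. f b *\<^sub>R b) \<in> measurable (\<Pi>\<^sub>M b\<in>(Basis::'a set). lborel) borel" by measurable
  have [measurable]: "\<phi> b \<in> borel_measurable borel" if "b \<in> Basis" for b
    using borel_measurable_integrable[OF assms[OF that]] by simp
  have b: "(\<lambda>x. \<Prod>b\<in>Basis. \<phi> b (x \<bullet> b)) \<in> borel_measurable borel"
    by (rule borel_measurable_prod) measurable
  have c: "((\<Sum>b\<in>Basis. f b *\<^sub>R b) \<bullet> c) = f c" if "c \<in> Basis" for c :: 'a and f
    using that by (simp add: inner_sum_left inner_Basis if_distrib sum.delta cong: if_cong)
  have e: "(\<lambda>f. \<Prod>b\<in>Basis. \<phi> b ((\<Sum>b\<in>Basis. f b *\<^sub>R b) \<bullet> b)) = (\<lambda>f. \<Prod>b\<in>Basis. \<phi> b (f b))"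
    by (intro ext prod.cong refl) (simp add: c)
  show "integrable lborel (\<lambda>x. \<Prod>b\<in>Basis. \<phi> b (x \<bullet> b))"
    unfolding lborel_eq[where 'a='a] integrable_distr_eq[OF m b] e
    by (rule product_integrable_prod[OF finite_Basis assms])
  show "(LINT x|lborel. (\<Prod>b\<in>Basis. \<phi> b (x \<bullet> b))) = (\<Prod>b\<in>Basis. LINT t|lborel. \<phi> b t)"
    unfolding lborel_eq[where 'a='a] integral_distr[OF m b] e
    by (rule product_integral_prod[OF finite_Basis assms])
qed

text \<open>Every coordinate satisfies \<open>1 + (x \<bullet> b)^2 \<le> wt x\<close>, so the power
  \<open>DIM('a)\<close> of \<open>1 / wt x\<close> is dominated by the product of the functions
  \<open>1 / (1 + t^2)\<close>, one for each coordinate.\<close>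

lemma integrable_wt: "integrable lborel (\<lambda>x::'a::euclidean_space. wt x powi (- int DIM('a)))"
proof (rule Bochner_Integration.integrable_bound)
  have "integrable lborel (\<lambda>t::real. inverse (1 + t\<^sup>2))"
    using integrable_inverse_1_plus_square by (simp add: set_integrable_def)
  then show "integrable lborel (\<lambda>x::'a. \<Prod>b\<in>Basis. inverse (1 + (x \<bullet> b)\<^sup>2))"
    by (rule integrable_lborel_prod)
  show "(\<lambda>x::'a. wt x powi (- int DIM('a))) \<in> borel_measurable lborel"
    unfolding wt_def power_int_minus power_int_of_nat by measurable
  show "AE x::'a in lborel. norm (wt x powi (- int DIM('a))) \<le> norm (\<Prod>b\<in>Basis. inverse (1 + (x \<bullet> b)\<^sup>2))"
  proof (intro always_eventually allI)
    fix x :: 'a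
    have "inverse (wt x) \<le> inverse (1 + (x \<bullet> b)\<^sup>2)" if "b \<in> Basis" for b
    proof (rule le_imp_inverse_le)
      have "\<bar>x \<bullet> b\<bar>\<^sup>2 \<le> (norm x)\<^sup>2" using that by (intro power_mono Basis_le_norm) auto
      then show "1 + (x \<bullet> b)\<^sup>2 \<le> wt x" by (simp add: wt_def)
    qed (simp add: add_pos_nonneg)
    then have "(\<Prod>b\<in>(Basis::'a set). inverse (wt x)) \<le> (\<Prod>b\<in>Basis. inverse (1 + (x \<bullet> b)\<^sup>2))"
      by (intro prod_mono) (auto simp: less_imp_le)
    moreover have "0 \<le> (\<Prod>b\<in>Basis. inverse (1 + (x \<bullet> b)\<^sup>2))" by (intro prod_nonneg) auto
    ultimately show "norm (wt x powi (- int DIM('a))) \<le> norm (\<Prod>b\<in>Basis. inverse (1 + (x \<bullet> b)\<^sup>2))"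
      by (simp add: power_int_minus power_inverse less_imp_le)
  qed
qed

lemma integrable_wt_le:
  assumes "k \<le> - int DIM('a)"
  shows "integrable lborel (\<lambda>x::'a::euclidean_space. C * wt x powi k)"
proof -
  have "integrable lborel (\<lambda>x::'a. wt x powi k)"
  proof (rule Bochner_Integration.integrable_bound[OF integrable_wt])
    have "(\<lambda>x::'a. wt x powi k) = (\<lambda>x. inverse (wt x ^ nat (- k)))"
      using assms power_int_minus[of "wt _" "- k"] by (intro ext) (simp add: power_int_nonneg_exp power_int_def power_inverse)
    then show "(\<lambda>x::'a. wt x powi k) \<in> borel_measurable lborel"
      unfolding wt_def by simp
  qed (use assms in \<open>auto simp: less_imp_le intro: wt_powi_mono\<close>)
  then show ?thesis by simp
qed

lemma integrable_by_wt:
  fixes f :: "'a::euclidean_space \<Rightarrow> complex"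
  assumes "continuous_on UNIV f" "\<And>x. cmod (f x) \<le> C * wt x powi (- int DIM('a))"
  shows "integrable lborel f"
proof (rule Bochner_Integration.integrable_bound[OF integrable_wt_le[of "- int DIM('a)" C]])
  show "f \<in> borel_measurable lborel"
    using borel_measurable_continuous_onI[OF assms(1)] by simp
  show "AE x in lborel. norm (f x) \<le> norm (C * wt x powi - int DIM('a))"
    using assms(2) by (intro always_eventually allI) (metis abs_ge_self order_trans real_norm_def)
qed simp

lemma schwartz_integrable: "f \<in> schwartz \<Longrightarrow> integrable lborel f"
  by (metis integrable_by_wt schwartz_continuous schwartz_wbd wbd_bound)

lemma schwartz_measurable [measurable_dest]: "f \<in> schwartz \<Longrightarrow> f \<in> borel_measurable borel"
  by (simp add: borel_measurable_continuous_onI schwartz_continuous)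

definition wt_int :: "'a::euclidean_space itself \<Rightarrow> real" where
  "wt_int _ = (LINT x|lborel. wt (x::'a) powi (- int DIM('a)))"

lemma norm_integral_le:
  fixes f :: "'a::euclidean_space \<Rightarrow> complex"
  assumes "\<And>x. cmod (f x) \<le> C * wt x powi (- int DIM('a))"
  shows "cmod (LINT x|lborel. f x) \<le> C * wt_int TYPE('a)"
proof (cases "integrable lborel f")
  case True
  have "cmod (LINT x|lborel. f x) \<le> (LINT x|lborel. cmod (f x))" by (rule integral_norm_bound)
  also have "\<dots> \<le> (LINT x|lborel. C * wt (x::'a) powi (- int DIM('a)))"
    using True assms by (intro integral_mono integrable_wt_le) auto
  finally show ?thesis by (simp add: wt_int_def)
next
  \<comment> \<open>The integral of a non-integrable function is 0 by convention, so the right-hand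
    side merely has to be nonnegative.\<close>
  case False
  have "0 \<le> C" using order_trans[OF norm_ge_zero assms[of 0]] by simp
  moreover have "0 \<le> wt_int TYPE('a)" unfolding wt_int_def by (intro integral_nonneg_AE) (auto simp: less_imp_le)
  ultimately show ?thesis using False by (simp add: not_integrable_integral_eq)
qed

text \<open>Dominated convergence for the normalized remainder, along sequences tending to
  \<open>x\<close>. Convexity of \<open>U\<close> gives the mean value inequality, hence the
  Lipschitz constant \<open>H y\<close> of the integrand on all of \<open>U\<close>.\<close>

lemma has_derivative_integral:
  fixes G :: "'a::euclidean_space \<Rightarrow> 'y \<Rightarrow> complex" and G' :: "'a \<Rightarrow> 'y \<Rightarrow> 'a \<Rightarrow> complex"
  assumes U: "open U" "convex U" "x \<in> U"
    and G: "\<And>x. x \<in> U \<Longrightarrow> integrable M (G x)"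
    and der: "\<And>x y. x \<in> U \<Longrightarrow> ((\<lambda>x. G x y) has_derivative G' x y) (at x)"
    and bd: "\<And>x y h. x \<in> U \<Longrightarrow> cmod (G' x y h) \<le> H y * norm h"
    and H: "integrable M H" "\<And>y. 0 \<le> H y"
    and G': "\<And>h. integrable M (\<lambda>y. G' x y h)"
  shows "((\<lambda>x. LINT y|M. G x y) has_derivative (\<lambda>h. LINT y|M. G' x y h)) (at x)"
proof -
  have lin: "bounded_linear (G' x y)" for y
    using der[OF U(3)] by (rule has_derivative_bounded_linear)
  have "bounded_linear (\<lambda>h. LINT y|M. G' x y h)"
  proof (rule bounded_linear_intro)
    show "(LINT y|M. G' x y (h + k)) = (LINT y|M. G' x y h) + (LINT y|M. G' x y k)" for h k
      using G' by (simp add: linear_add[OF bounded_linear.linear[OF lin]])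
    show "(LINT y|M. G' x y (r *\<^sub>R h)) = r *\<^sub>R (LINT y|M. G' x y h)" for r h
      using G' by (simp add: linear_cmul[OF bounded_linear.linear[OF lin]])
    show "norm (LINT y|M. G' x y h) \<le> norm h * (LINT y|M. H y)" for h
    proof -
      have "norm (LINT y|M. G' x y h) \<le> (LINT y|M. norm (G' x y h))" by (rule integral_norm_bound)
      also have "\<dots> \<le> (LINT y|M. H y * norm h)" using bd[OF U(3)] G' H by (intro integral_mono) auto
      finally show ?thesis using H by (simp add: mult.commute)
    qed
  qed
  moreover have "((\<lambda>z. norm (((LINT y|M. G z y) - (LINT y|M. G x y)) - (LINT y|M. G' x y (z - x))) / norm (z - x)) \<longlongrightarrow> 0) (at x within U)"
    unfolding tendsto_at_iff_sequentially comp_def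
  proof (intro allI impI)
    fix X assume X: "\<forall>i. X i \<in> U - {x}" "X \<longlonglongrightarrow> x"
    let ?q = "\<lambda>n y. norm ((G (X n) y - G x y) - G' x y (X n - x)) / norm (X n - x)"
    have Xn: "norm (X n - x) > 0" "X n \<in> U" for n using X by auto
    have int: "integrable M (?q n)" for n
      using G[OF U(3)] G[OF Xn(2)] G' by (intro integrable_divide integrable_norm Bochner_Integration.integrable_diff)
    have "(\<lambda>n. LINT y|M. ?q n y) \<longlonglongrightarrow> (LINT y|M. 0)"
    proof (rule integral_dominated_convergence)
      \<comment> \<open>One \<open>H y\<close> bounds the increment by the mean value inequality,
        the other one bounds the derivative at \<open>x\<close>.\<close>
      show "integrable M (\<lambda>y. 2 * H y)" using H by simp
      show "?q n \<in> borel_measurable M" for n using int by (rule borel_measurable_integrable)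
      show "AE y in M. (\<lambda>n. ?q n y) \<longlonglongrightarrow> 0"
      proof (intro always_eventually allI)
        fix y
        have "((\<lambda>z. norm (G z y - G x y - G' x y (z - x)) / norm (z - x)) \<longlongrightarrow> 0) (at x)"
          using der[OF U(3)] unfolding has_derivative_iff_norm by blast
        then show "(\<lambda>n. ?q n y) \<longlonglongrightarrow> 0"
          using X unfolding tendsto_at_iff_sequentially comp_def by blast
      qed
      show "AE y in M. norm (?q n y) \<le> 2 * H y" for n
      proof (intro always_eventually allI)
        fix y
        have "norm (G (X n) y - G x y) \<le> H y * norm (X n - x)"
        proof (rule differentiable_bound[OF U(2) _ _ Xn(2) U(3)])
          show "((\<lambda>x. G x y) has_derivative G' z y) (at z within U)" if "z \<in> U" for z
            using der[OF that] by (rule has_derivative_at_withinI)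
          show "onorm (G' z y) \<le> H y" if "z \<in> U" for z
            using bd[OF that] H(2) by (intro onorm_bound)
        qed
        moreover have "norm (G' x y (X n - x)) \<le> H y * norm (X n - x)" by (rule bd[OF U(3)])
        moreover have "norm ((G (X n) y - G x y) - G' x y (X n - x)) \<le> norm (G (X n) y - G x y) + norm (G' x y (X n - x))"
          by (rule norm_triangle_ineq4)
        ultimately show "norm (?q n y) \<le> 2 * H y" using Xn(1)[of n] by (simp add: divide_le_eq)
      qed
    qed simp_all
    then have lim: "(\<lambda>n. LINT y|M. ?q n y) \<longlonglongrightarrow> 0" by simp
    show "(\<lambda>n. norm (((LINT y|M. G (X n) y) - (LINT y|M. G x y)) - (LINT y|M. G' x y (X n - x))) / norm (X n - x)) \<longlonglongrightarrow> 0"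
    proof (rule Lim_null_comparison[OF always_eventually lim], intro allI)
      fix n
      have "((LINT y|M. G (X n) y) - (LINT y|M. G x y)) - (LINT y|M. G' x y (X n - x))
          = (LINT y|M. (G (X n) y - G x y) - G' x y (X n - x))"
        using G[OF U(3)] G[OF Xn(2)] G' by simp
      also have "norm \<dots> \<le> (LINT y|M. norm ((G (X n) y - G x y) - G' x y (X n - x)))" by (rule integral_norm_bound)
      finally show "norm (norm (((LINT y|M. G (X n) y) - (LINT y|M. G x y)) - (LINT y|M. G' x y (X n - x))) / norm (X n - x))
          \<le> (LINT y|M. ?q n y)" by (simp add: divide_right_mono)
    qed
  qed
  ultimately have "((\<lambda>x. LINT y|M. G x y) has_derivative (\<lambda>h. LINT y|M. G' x y h)) (at x within U)"
    unfolding has_derivative_iff_norm by blast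
  then show ?thesis using at_within_open[OF U(3,1)] by simp
qed

lemma norm_deriv_bound:
  fixes c :: "'a::euclidean_space \<Rightarrow> complex"
  assumes "\<And>b. b \<in> Basis \<Longrightarrow> cmod (c b) \<le> D"
  shows "cmod (\<Sum>b\<in>Basis. (h \<bullet> b) *\<^sub>R c b) \<le> (real DIM('a) * D) * norm h"
proof -
  have "cmod (\<Sum>b\<in>Basis. (h \<bullet> b) *\<^sub>R c b) \<le> (\<Sum>b\<in>(Basis::'a set). norm h * D)"
  proof (rule sum_norm_le)
    fix b :: 'a assume b: "b \<in> Basis"
    show "cmod ((h \<bullet> b) *\<^sub>R c b) \<le> norm h * D"
      unfolding norm_scaleR using b assms[OF b] by (intro mult_mono Basis_le_norm) auto
  qed
  then show ?thesis by (simp add: mult_ac)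
qed

section \<open>Changes of variables and translations\<close>

lemma integral_affine:
  fixes f :: "'a::euclidean_space \<Rightarrow> complex"
  assumes "c \<noteq> 0" and f: "f \<in> borel_measurable borel"
  shows "(LINT x|lborel. f x) = \<bar>c\<bar> ^ DIM('a) *\<^sub>R (LINT x|lborel. f (a + c *\<^sub>R x))"
proof -
  have "(LINT x|lborel. f x) = (LINT x|density (distr lborel borel (\<lambda>x. a + c *\<^sub>R x)) (\<lambda>_. \<bar>c\<bar> ^ DIM('a)). f x)"
    using lborel_affine[OF assms(1), of a] by simp
  also have "\<dots> = \<bar>c\<bar> ^ DIM('a) *\<^sub>R (LINT x|lborel. f (a + c *\<^sub>R x))"
    using f by (subst integral_density) (simp_all add: integral_distr)
  finally show ?thesis .
qed

lemma integral_shift: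
  fixes f :: "'a::euclidean_space \<Rightarrow> complex"
  assumes "f \<in> borel_measurable borel"
  shows "(LINT y|lborel. f (a + y)) = (LINT y|lborel. f y)"
  using integral_affine[OF _ assms, of 1 a] by simp

lemma integral_reflect:
  fixes f :: "'a::euclidean_space \<Rightarrow> complex"
  assumes "f \<in> borel_measurable borel"
  shows "(LINT y|lborel. f (- y)) = (LINT y|lborel. f y)"
  using integral_affine[OF _ assms, of "-1" 0] by simp

lemma wbd_translate:
  assumes "wbd n (- int k) C f"
  shows "wbd n (- int k) (C * (2 * wt a) ^ k) (\<lambda>x. f (a + x))"
  using assms
proof (induction n arbitrary: f)
  have base: "cmod (f (a + x)) \<le> (C * (2 * wt a) ^ k) * wt x powi (- int k)" if f: "wbd n (- int k) C f" for n f x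
  proof -
    have "wt x \<le> 2 * (wt (a + x) * wt (- a))" using wt_add[of "a + x" "- a"] by simp
    then have "wt x ^ k \<le> (2 * wt a * wt (a + x)) ^ k" by (intro power_mono) (auto simp: mult_ac)
    then have "wt (a + x) powi (- int k) \<le> (2 * wt a) ^ k * wt x powi (- int k)"
      by (simp add: power_int_minus field_simps)
    from order_trans[OF wbd_bound[OF f] mult_left_mono[OF this wbd_nonneg[OF f]]] show ?thesis
      by (simp add: mult.assoc)
  qed
  {
    case 0
    then show ?case using base[OF 0] by simp
  next
    case (Suc n)
    have d: "f differentiable at x" for x using Suc.prems by simp
    have "dpart b (\<lambda>x. f (a + x)) = (\<lambda>x. dpart b f (a + x))" for b
      using dpart_affine(2)[OF d, of b a 1] by simp
    moreover have "(\<lambda>x. f (a + x)) differentiable at x" for x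
      using dpart_affine(1)[OF d, of a 1] by (auto simp: differentiable_def)
    ultimately show ?case using base[OF Suc.prems] Suc by simp
  }
qed

lemma schwartz_translate: "f \<in> schwartz \<Longrightarrow> (\<lambda>x. f (a + x)) \<in> schwartz"
  unfolding schwartz_iff using wbd_translate by blast

text \<open>Translation invariance of Lebesgue measure: the integral of \<open>f (x + y)\<close>
  over \<open>y\<close> does not depend on \<open>x\<close>, so its derivative, computed under the
  integral, is 0.\<close>

lemma integral_dpart_eq_0:
  fixes f :: "'a::euclidean_space \<Rightarrow> complex"
  assumes f: "f \<in> schwartz" and b: "b \<in> Basis"
  shows "(LINT x|lborel. dpart b f x) = 0"
proof -
  let ?d = "DIM('a)"
  obtain C where C: "wbd 1 (- int ?d) C f" using schwartz_wbd[OF f] by blast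
  have C0: "0 \<le> C" by (rule wbd_nonneg[OF C])
  let ?H = "\<lambda>y::'a. (?d * (C * 4 ^ ?d)) * wt y powi (- int ?d)"
  have "((\<lambda>x. LINT y|lborel. f (x + y)) has_derivative (\<lambda>h. LINT y|lborel. (\<Sum>b\<in>Basis. (h \<bullet> b) *\<^sub>R dpart b f (0 + y)))) (at 0)"
  \<comment> \<open>The unit ball keeps \<open>wt x \<le> 2\<close>, so a single dominating function
    serves all shifts; with the factor 2 of \<open>wt_add\<close> this gives the constant 4.\<close>
  proof (rule has_derivative_integral[where U = "ball 0 1" and H = ?H])
    show "integrable lborel (\<lambda>y. f (x + y))" for x
      by (rule schwartz_integrable[OF schwartz_translate[OF f]])
    show "((\<lambda>x. f (x + y)) has_derivative (\<lambda>h. \<Sum>b\<in>Basis. (h \<bullet> b) *\<^sub>R dpart b f (x + y))) (at x)" for x y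
      using has_derivative_compose[OF has_derivative_add[OF has_derivative_ident has_derivative_const] has_derivative_dpart[OF schwartz_differentiable[OF f]]]
      by simp
    show "cmod (\<Sum>b\<in>Basis. (h \<bullet> b) *\<^sub>R dpart b f (x + y)) \<le> ?H y * norm h" if "x \<in> ball 0 1" for x y h
    proof -
      have "cmod (dpart b f (x + y)) \<le> (C * 4 ^ ?d) * wt y powi (- int ?d)" if "b \<in> Basis" for b
      proof -
        have "wbd 0 (- int ?d) C (dpart b f)" using C that by simp
        then have "cmod (dpart b f (x + y)) \<le> C * wt (x + y) powi (- int ?d)" by (rule wbd_bound)
        also have "wt (x + y) powi (- int ?d) \<le> 4 ^ ?d * wt y powi (- int ?d)"
        proof -
          have "wt x \<le> 2" using \<open>x \<in> ball 0 1\<close> by (simp add: wt_def power_le_one)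
          have "wt y \<le> 2 * (wt (x + y) * wt (- x))" using wt_add[of "x + y" "- x"] by simp
          also have "\<dots> \<le> 2 * (wt (x + y) * 2)" using \<open>wt x \<le> 2\<close> by (intro mult_left_mono) (auto simp: less_imp_le)
          finally have "wt y ^ ?d \<le> (4 * wt (x + y)) ^ ?d" by (intro power_mono) (auto simp: less_imp_le)
          then show ?thesis by (simp add: power_int_minus field_simps)
        qed
        finally show ?thesis using C0 by (simp add: mult.assoc mult_left_mono)
      qed
      from norm_deriv_bound[OF this] show ?thesis by (simp add: mult.assoc)
    qed
    show "integrable lborel ?H" by (rule integrable_wt_le) simp
    show "integrable lborel (\<lambda>y. \<Sum>b\<in>Basis. (h \<bullet> b) *\<^sub>R dpart b f (0 + y))" for h
      by (intro Bochner_Integration.integrable_sum integrable_scaleR_right) (simp add: schwartz_integrable schwartz_dpart f)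
  qed (use C0 in \<open>auto simp: less_imp_le\<close>)
  moreover have "(\<lambda>x. LINT y|lborel. f (x + y)) = (\<lambda>x. LINT y|lborel. f y)"
    by (intro ext integral_shift schwartz_measurable f)
  ultimately have "((\<lambda>x::'a. LINT y|lborel. f y) has_derivative (\<lambda>h. LINT y|lborel. (\<Sum>b\<in>Basis. (h \<bullet> b) *\<^sub>R dpart b f (0 + y)))) (at 0)"
    by simp
  from has_derivative_unique[OF this has_derivative_const]
  have "(LINT y|lborel. (\<Sum>c\<in>Basis. (b \<bullet> c) *\<^sub>R dpart c f (0 + y))) = 0" by metis
  moreover have "(\<Sum>c\<in>Basis. (b \<bullet> c) *\<^sub>R dpart c f y) = dpart b f y" for y
    using b by (simp add: inner_Basis if_distrib[of "\<lambda>r. r *\<^sub>R _"] sum.delta' cong: if_cong)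
  ultimately show ?thesis by simp
qed

section \<open>The Fourier transform\<close>

abbreviation ftc :: "'a::euclidean_space itself \<Rightarrow> complex" where
  "ftc _ \<equiv> complex_of_real ((2 * pi) powr (- (real DIM('a) / 2)))"

lemma fourier_charf: "fourier f \<xi> = ftc TYPE('a) * (LINT x|lborel. charf (- \<xi>) x * f x)"
  for f :: "'a::euclidean_space \<Rightarrow> complex"
  by (simp add: fourier_def charf_def)

lemma inv_fourier_charf: "inv_fourier f \<xi> = ftc TYPE('a) * (LINT x|lborel. charf \<xi> x * f x)"
  for f :: "'a::euclidean_space \<Rightarrow> complex"
  by (simp add: inv_fourier_def charf_def inner_commute)

lemma inv_fourier_reflect: "inv_fourier f = reflect (fourier f)"
  by (simp add: fun_eq_iff reflect_def fourier_charf inv_fourier_charf)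

lemma charf_mult_schwartz: "f \<in> schwartz \<Longrightarrow> (\<lambda>x. charf \<xi> x * f x) \<in> schwartz"
  by (rule schwartz_mult[OF si_charf])

lemma fourier_of_reflect:
  assumes "f \<in> schwartz"
  shows "fourier (reflect f) = reflect (fourier f)"
proof
  fix \<xi> :: 'a
  have "(LINT x|lborel. charf (- \<xi>) x * f (- x)) = (LINT x|lborel. charf \<xi> x * f x)"
    using integral_reflect[OF schwartz_measurable[OF charf_mult_schwartz[OF assms]], of \<xi>]
    by (simp add: charf_def)
  then show "fourier (reflect f) \<xi> = reflect (fourier f) \<xi>"
    by (simp add: fourier_charf reflect_def)
qed

lemma cnj_fourier: "cnj (fourier f \<xi>) = inv_fourier (\<lambda>x. cnj (f x)) \<xi>"
proof -
  have "cnj (LINT x|lborel. charf (- \<xi>) x * f x) = (LINT x|lborel. cnj (charf (- \<xi>) x * f x))"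
    by (rule Bochner_Integration.integral_cnj[symmetric])
  then show ?thesis by (simp add: fourier_charf inv_fourier_charf) (simp add: charf_def exp_cnj)
qed

lemma fourier_lin:
  assumes "f \<in> schwartz" "h \<in> schwartz"
  shows "fourier (\<lambda>x. a * f x + b * h x) = (\<lambda>\<xi>. a * fourier f \<xi> + b * fourier h \<xi>)"
proof
  fix \<xi> :: 'a
  have "(LINT x|lborel. charf (- \<xi>) x * (a * f x + b * h x)) =
      (LINT x|lborel. a * (charf (- \<xi>) x * f x) + b * (charf (- \<xi>) x * h x))"
    by (simp add: algebra_simps)
  also have "\<dots> = a * (LINT x|lborel. charf (- \<xi>) x * f x) + b * (LINT x|lborel. charf (- \<xi>) x * h x)"
    using assms by (simp add: schwartz_integrable charf_mult_schwartz)
  finally show "fourier (\<lambda>x. a * f x + b * h x) \<xi> = a * fourier f \<xi> + b * fourier h \<xi>"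
    by (simp add: fourier_charf algebra_simps)
qed

lemma fourier_deriv:
  fixes f :: "'a::euclidean_space \<Rightarrow> complex"
  assumes f: "f \<in> schwartz"
  shows "fourier f differentiable at \<xi>"
    and "dpart b (fourier f) = fourier (\<lambda>x. (- \<i>) * (complex_of_real (x \<bullet> b) * f x))"
proof -
  have xf: "(\<lambda>x. complex_of_real (x \<bullet> h) * f x) \<in> schwartz" for h by (rule schwartz_mult[OF si_inner f])
  let ?G' = "\<lambda>\<xi> x h. (- \<i>) * (complex_of_real (x \<bullet> h) * (charf (- \<xi>) x * f x))"
  \<comment> \<open>One power beyond the integrable weight, to absorb the factor
    \<open>x \<bullet> h\<close> produced by differentiation.\<close>
  obtain C where C: "wbd 0 (- int (Suc DIM('a))) C f" using schwartz_wbd[OF f] by blast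
  have D: "((\<lambda>\<xi>. LINT x|lborel. charf (- \<xi>) x * f x) has_derivative (\<lambda>h. LINT x|lborel. ?G' \<xi> x h)) (at \<xi>)" for \<xi>
  proof (rule has_derivative_integral[where U = UNIV and H = "\<lambda>x. C * wt x powi (- int DIM('a))"])
    show "integrable lborel (\<lambda>x. charf (- \<xi>) x * f x)" for \<xi>
      by (rule schwartz_integrable[OF charf_mult_schwartz[OF f]])
    show "((\<lambda>\<xi>. charf (- \<xi>) x * f x) has_derivative ?G' \<xi> x) (at \<xi>)" for x \<xi>
    proof -
      have "((\<lambda>\<xi>. charf (- x) \<xi>) has_derivative (\<lambda>h. (\<i> * complex_of_real (- x \<bullet> h)) * charf (- x) \<xi>)) (at \<xi>)"
        by (rule charf_deriv)
      from has_derivative_mult_left[OF this, of "f x"] show ?thesis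
        by (simp add: charf_def inner_commute mult_ac)
    qed
    show "cmod (?G' \<xi> x h) \<le> C * wt x powi (- int DIM('a)) * norm h" for \<xi> x h
    proof -
      have "cmod (?G' \<xi> x h) = \<bar>x \<bullet> h\<bar> * cmod (f x)" by (simp add: norm_mult)
      also have "\<dots> \<le> (wt x * norm h) * (C * wt x powi (- int (Suc DIM('a))))"
      proof (intro mult_mono wbd_bound[OF C])
        show "\<bar>x \<bullet> h\<bar> \<le> wt x * norm h"
          using Cauchy_Schwarz_ineq2[of x h] mult_right_mono[OF norm_le_wt[of x], of "norm h"] by simp
      qed (auto simp: less_imp_le)
      also have "\<dots> = C * (wt x powi 1 * wt x powi (- int (Suc DIM('a)))) * norm h"
        by (simp only: power_int_1_right mult_ac)
      also have "\<dots> = C * wt x powi (- int DIM('a)) * norm h"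
        by (simp only: wt_powi_add[symmetric]) simp
      finally show ?thesis .
    qed
    show "integrable lborel (\<lambda>x::'a. C * wt x powi (- int DIM('a)))" by (rule integrable_wt_le) simp
    have "(\<lambda>x. ?G' \<xi> x h) = (\<lambda>x. (- \<i>) * (charf (- \<xi>) x * (complex_of_real (x \<bullet> h) * f x)))" for h
      by (simp add: mult_ac)
    moreover have "integrable lborel (\<lambda>x. (- \<i>) * (charf (- \<xi>) x * (complex_of_real (x \<bullet> h) * f x)))" for h
      by (intro integrable_mult_right schwartz_integrable charf_mult_schwartz xf)
    ultimately show "integrable lborel (\<lambda>x. ?G' \<xi> x h)" for h by simp
  qed (use wbd_nonneg[OF C] in \<open>auto simp: less_imp_le\<close>)
  have D': "(fourier f has_derivative (\<lambda>h. ftc TYPE('a) * (LINT x|lborel. ?G' \<xi> x h))) (at \<xi>)" for \<xi>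
    unfolding fourier_charf[abs_def] by (rule has_derivative_mult_right[OF D])
  then show "fourier f differentiable at \<xi>" by (auto simp: differentiable_def)
  show "dpart b (fourier f) = fourier (\<lambda>x. (- \<i>) * (complex_of_real (x \<bullet> b) * f x))"
  proof
    fix \<xi> :: 'a
    have "dpart b (fourier f) \<xi> = ftc TYPE('a) * (LINT x|lborel. ?G' \<xi> x b)" by (rule dpart_eqI[OF D'])
    also have "(LINT x|lborel. ?G' \<xi> x b) = (LINT x|lborel. charf (- \<xi>) x * ((- \<i>) * (complex_of_real (x \<bullet> b) * f x)))"
      by (rule Bochner_Integration.integral_cong) (simp_all add: mult_ac)
    finally show "dpart b (fourier f) \<xi> = fourier (\<lambda>x. (- \<i>) * (complex_of_real (x \<bullet> b) * f x)) \<xi>"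
      unfolding fourier_charf .
  qed
qed

text \<open>Integration by parts without boundary terms: the derivative of
  \<open>charf (- \<xi>) x * f x\<close> has integral 0, and the product rule splits it into the two
  transforms.\<close>

lemma fourier_dpart:
  fixes f :: "'a::euclidean_space \<Rightarrow> complex"
  assumes f: "f \<in> schwartz" and b: "b \<in> Basis"
  shows "fourier (dpart b f) \<xi> = \<i> * complex_of_real (\<xi> \<bullet> b) * fourier f \<xi>"
proof -
  have "dpart b (\<lambda>x. charf (- \<xi>) x * f x) =
      (\<lambda>x. charf (- \<xi>) x * dpart b f x + (\<i> * complex_of_real (- \<xi> \<bullet> b)) * (charf (- \<xi>) x * f x))"
    using dpart_mult[OF si_differentiable[OF si_charf] schwartz_differentiable[OF f], of b "- \<xi>"]
    by (simp add: dpart_charf mult.assoc)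
  then have "0 = (LINT x|lborel. charf (- \<xi>) x * dpart b f x + (\<i> * complex_of_real (- \<xi> \<bullet> b)) * (charf (- \<xi>) x * f x))"
    using integral_dpart_eq_0[OF charf_mult_schwartz[OF f] b, of "- \<xi>"] by simp
  also have "\<dots> = (LINT x|lborel. charf (- \<xi>) x * dpart b f x) + (\<i> * complex_of_real (- \<xi> \<bullet> b)) * (LINT x|lborel. charf (- \<xi>) x * f x)"
    using schwartz_integrable[OF charf_mult_schwartz[OF f], of "- \<xi>"]
      schwartz_integrable[OF charf_mult_schwartz[OF schwartz_dpart[OF f b]], of "- \<xi>"] by simp
  finally have "(LINT x|lborel. charf (- \<xi>) x * dpart b f x) = \<i> * complex_of_real (\<xi> \<bullet> b) * (LINT x|lborel. charf (- \<xi>) x * f x)"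
    by (simp add: eq_neg_iff_add_eq_0 add_eq_0_iff)
  then show ?thesis by (simp add: fourier_charf mult_ac)
qed

text \<open>Its Fourier symbol is exactly \<open>wt\<close>, so its k-th power yields decay of order
  k of a transform at once, with no expansion into monomials.\<close>

definition one_minus_laplace :: "('a::euclidean_space \<Rightarrow> complex) \<Rightarrow> 'a \<Rightarrow> complex" where
  "one_minus_laplace f = (\<lambda>x. f x + (\<Sum>b\<in>Basis. - dpart b (dpart b f) x))"

lemma schwartz_op_sum:
  fixes A :: "'i \<Rightarrow> ('a::euclidean_space \<Rightarrow> complex) \<Rightarrow> 'a \<Rightarrow> complex"
  assumes "finite I" "\<And>i. i \<in> I \<Longrightarrow> schwartz_op (A i)"
  shows "schwartz_op (\<lambda>f x. \<Sum>i\<in>I. A i f x)"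
  using assms
proof (induction I rule: finite_induct)
  case empty
  show ?case using schwartz_op_mult[OF si_const[of 0]] by simp
next
  case (insert i I)
  then show ?case using schwartz_op_add[of "A i" "\<lambda>f x. \<Sum>i\<in>I. A i f x"] by simp
qed

lemma schwartz_op_minus: "schwartz_op A \<Longrightarrow> schwartz_op (\<lambda>f x. - A f x)"
  using schwartz_op_comp[OF schwartz_op_mult[OF si_const[of "-1"]], of A] by simp

lemma schwartz_op_one_minus_laplace: "schwartz_op one_minus_laplace"
  unfolding one_minus_laplace_def[abs_def]
  by (intro schwartz_op_add schwartz_op_id schwartz_op_sum schwartz_op_minus finite_Basis
      schwartz_op_comp[OF schwartz_op_dpart schwartz_op_dpart])

lemma fourier_sum:
  assumes "finite I" "\<And>i. i \<in> I \<Longrightarrow> f i \<in> schwartz"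
  shows "(\<lambda>x. \<Sum>i\<in>I. f i x) \<in> schwartz \<and> fourier (\<lambda>x. \<Sum>i\<in>I. f i x) = (\<lambda>\<xi>. \<Sum>i\<in>I. fourier (f i) \<xi>)"
  using assms
proof (induction I rule: finite_induct)
  case empty
  show ?case using schwartz_zero fourier_lin[OF schwartz_zero schwartz_zero, of 0 0] by simp
next
  case (insert i I)
  then show ?case
    using schwartz_lin[of "f i" "\<lambda>x. \<Sum>i\<in>I. f i x" 1 1] fourier_lin[of "f i" "\<lambda>x. \<Sum>i\<in>I. f i x" 1 1] by simp
qed

lemma fourier_one_minus_laplace:
  fixes f :: "'a::euclidean_space \<Rightarrow> complex"
  assumes f: "f \<in> schwartz"
  shows "fourier (one_minus_laplace f) = (\<lambda>\<xi>. complex_of_real (wt \<xi>) * fourier f \<xi>)"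
proof
  fix \<xi> :: 'a
  have S: "dpart b f \<in> schwartz" "dpart b (dpart b f) \<in> schwartz" "(\<lambda>x. - dpart b (dpart b f) x) \<in> schwartz"
    if "b \<in> Basis" for b
    using that f schwartz_cmult[of "dpart b (dpart b f)" "-1"] by (simp_all add: schwartz_dpart)
  have "fourier (one_minus_laplace f) \<xi> = fourier f \<xi> + fourier (\<lambda>x. \<Sum>b\<in>Basis. - dpart b (dpart b f) x) \<xi>"
    unfolding one_minus_laplace_def
    using fourier_lin[OF f, of "\<lambda>x. \<Sum>b\<in>Basis. - dpart b (dpart b f) x" 1 1] fourier_sum[OF finite_Basis, of "\<lambda>b x. - dpart b (dpart b f) x"] S(3) by simp
  also have "fourier (\<lambda>x. \<Sum>b\<in>Basis. - dpart b (dpart b f) x) \<xi> = (\<Sum>b\<in>Basis. fourier (\<lambda>x. - dpart b (dpart b f) x) \<xi>)"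
    using fourier_sum[OF finite_Basis, of "\<lambda>b x. - dpart b (dpart b f) x"] S(3) by simp
  also have "\<dots> = (\<Sum>b\<in>Basis. complex_of_real ((\<xi> \<bullet> b)\<^sup>2) * fourier f \<xi>)"
  proof (rule sum.cong[OF refl])
    fix b :: 'a assume b: "b \<in> Basis"
    have i: "\<i> * a * (\<i> * a * z) = - (a * a * z)" for a z
    proof -
      have "\<i> * a * (\<i> * a * z) = (\<i> * \<i>) * (a * a * z)" by (simp only: mult_ac)
      then show ?thesis by simp
    qed
    have "fourier (\<lambda>x. - dpart b (dpart b f) x) \<xi> = - fourier (dpart b (dpart b f)) \<xi>"
      using fourier_lin[OF S(2)[OF b] S(2)[OF b], of "-1" 0] by simp
    also have "\<dots> = complex_of_real ((\<xi> \<bullet> b)\<^sup>2) * fourier f \<xi>"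
      using fourier_dpart[OF S(1)[OF b] b] fourier_dpart[OF f b] by (simp add: power2_eq_square i)
    finally show "fourier (\<lambda>x. - dpart b (dpart b f) x) \<xi> = complex_of_real ((\<xi> \<bullet> b)\<^sup>2) * fourier f \<xi>" .
  qed
  also have "\<dots> = complex_of_real (\<xi> \<bullet> \<xi>) * fourier f \<xi>"
    by (simp add: euclidean_inner[of \<xi> \<xi>] power2_eq_square sum_distrib_right)
  finally show "fourier (one_minus_laplace f) \<xi> = complex_of_real (wt \<xi>) * fourier f \<xi>"
    by (simp add: wt_def power2_norm_eq_inner distrib_right)
qed

lemma schwartz_op_power:
  fixes A :: "('a::euclidean_space \<Rightarrow> complex) \<Rightarrow> 'a \<Rightarrow> complex"
  shows "schwartz_op A \<Longrightarrow> schwartz_op (A ^^ k)"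
proof (induction k)
  case 0
  have "(A ^^ 0) = (\<lambda>f. f)" by (simp add: fun_eq_iff)
  then show ?case using schwartz_op_id by metis
next
  case (Suc k)
  from schwartz_op_comp[OF Suc.prems Suc.IH[OF Suc.prems]] show ?case by (simp add: o_def)
qed

lemma fourier_one_minus_laplace_power:
  "f \<in> schwartz \<Longrightarrow> fourier ((one_minus_laplace ^^ k) f) = (\<lambda>\<xi>. complex_of_real (wt \<xi> ^ k) * fourier f \<xi>)"
proof (induction k)
  case (Suc k)
  then show ?case
    using fourier_one_minus_laplace[OF schwartz_op_in[OF schwartz_op_power[OF schwartz_op_one_minus_laplace] Suc.prems]]
    by (simp add: mult_ac)
qed simp

text \<open>Decay of \<open>fourier f\<close> is read off from powers of
  \<open>one_minus_laplace\<close> applied to \<open>f\<close>. Derivatives of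
  \<open>fourier f\<close> are transforms of \<open>- \<i> * (x \<bullet> b) * f\<close>, to which
  the induction hypothesis applies.\<close>

lemma schwartz_op_fourier: "schwartz_op (fourier :: ('a::euclidean_space \<Rightarrow> complex) \<Rightarrow> 'a \<Rightarrow> complex)"
proof -
  let ?F = "fourier :: ('a \<Rightarrow> complex) \<Rightarrow> 'a \<Rightarrow> complex"
  have base: "\<exists>N. wbd_op 0 k ?F N" for k
  proof -
    \<comment> \<open>The target weight \<open>DIM('a)\<close> makes the integral defining the
      transform converge absolutely, with \<open>wt_int\<close> as its bound.\<close>
    obtain N where N: "wbd_op 0 DIM('a) (one_minus_laplace ^^ k :: ('a \<Rightarrow> complex) \<Rightarrow> 'a \<Rightarrow> complex) N"
      using schwartz_op_bound[OF schwartz_op_power[OF schwartz_op_one_minus_laplace]] by metis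
    let ?K = "cmod (ftc TYPE('a)) * (real N * wt_int TYPE('a))"
    show ?thesis
    proof (rule wbd_opI)
      fix f :: "'a \<Rightarrow> complex" and C assume f: "f \<in> schwartz" "wbd N (- int N) C f"
      have "cmod (?F f \<xi>) \<le> ?K * C * wt \<xi> powi (- int k)" for \<xi>
      proof -
        have "cmod (LINT x|lborel. charf (- \<xi>) x * (one_minus_laplace ^^ k) f x) \<le> (real N * C) * wt_int TYPE('a)"
          by (rule norm_integral_le) (use wbd_bound[OF wbd_opD[OF N f]] in \<open>auto simp: norm_mult\<close>)
        then have "cmod (?F ((one_minus_laplace ^^ k) f) \<xi>) \<le> cmod (ftc TYPE('a)) * ((real N * C) * wt_int TYPE('a))"
          unfolding fourier_charf norm_mult by (rule mult_left_mono) simp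
        then have "wt \<xi> ^ k * cmod (?F f \<xi>) \<le> ?K * C"
          unfolding fourier_one_minus_laplace_power[OF f(1)] by (simp add: norm_mult norm_power abs_of_nonneg mult_ac)
        then show ?thesis by (simp add: power_int_minus field_simps)
      qed
      then show "wbd 0 (- int k) (?K * C) (?F f)" by simp
    qed
  qed
  have "\<exists>N. wbd_op n k ?F N" for n k
  proof (induction n)
    case 0
    show ?case by (rule base)
  next
    case (Suc n)
    let ?X = "\<lambda>b f x. (- \<i>) * (complex_of_real (x \<bullet> b) * f x)"
    have X: "schwartz_op (?X b)" for b :: 'a
      using schwartz_op_comp[OF schwartz_op_mult[OF si_const] schwartz_op_mult[OF si_inner]] .
    have "\<exists>N. \<forall>b\<in>(Basis::'a set). wbd_op n k (\<lambda>f. ?F (?X b f)) N"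
    proof (rule ex_uniform_bound[OF finite_Basis _ wbd_op_mono])
      show "\<exists>N. wbd_op n k (\<lambda>f. ?F (?X b f)) N" for b :: 'a
        using Suc wbd_op_comp[OF _ X schwartz_op_in[OF X]] by blast
    qed
    then obtain N where N: "\<And>b. b \<in> Basis \<Longrightarrow> wbd_op n k (\<lambda>f. ?F (?X b f)) N" by blast
    obtain M where M: "wbd_op 0 k ?F M" using base by blast
    let ?L = "max M N"
    have N': "wbd_op n k (\<lambda>f. ?F (?X b f)) ?L" if "b \<in> Basis" for b using wbd_op_mono[OF N[OF that]] by simp
    have M': "wbd_op 0 k ?F ?L" using wbd_op_mono[OF M] by simp
    have "wbd (Suc n) (- int k) (real ?L * C) (?F f)" if f: "f \<in> schwartz" "wbd ?L (- int ?L) C f" for f C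
    proof -
      have "wbd n (- int k) (real ?L * C) (dpart b (?F f))" if "b \<in> Basis" for b
        unfolding fourier_deriv(2)[OF f(1)] by (rule wbd_opD[OF N'[OF that] f])
      then show ?thesis using wbd_opD[OF M' f] fourier_deriv(1)[OF f(1)] unfolding wbd.simps by blast
    qed
    then show ?case unfolding wbd_op_def by blast
  qed
  then show ?thesis unfolding schwartz_op_def using fourier_lin by blast
qed

lemma schwartz_op_inv_fourier: "schwartz_op inv_fourier"
  using schwartz_op_comp[OF schwartz_op_reflect schwartz_op_fourier]
  by (simp add: inv_fourier_reflect[abs_def])

lemmas fourier_schwartz = schwartz_op_in[OF schwartz_op_fourier]
lemmas inv_fourier_schwartz = schwartz_op_in[OF schwartz_op_inv_fourier]

section \<open>Fourier inversion\<close>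

text \<open>Taken from the characteristic function of the standard normal distribution, after
  multiplying its density by \<open>sqrt (2 * pi)\<close>.\<close>

lemma gaussian_fourier_real:
  "integrable lborel (\<lambda>x. iexp (t * x) * complex_of_real (exp (- x\<^sup>2 / 2)))"
  "(LINT x|lborel. iexp (t * x) * complex_of_real (exp (- x\<^sup>2 / 2))) =
     complex_of_real (sqrt (2 * pi) * exp (- t\<^sup>2 / 2))"
proof -
  have e: "iexp (t * x) * complex_of_real (exp (- x\<^sup>2 / 2)) =
      complex_of_real (sqrt (2 * pi)) * (std_normal_density x *\<^sub>R iexp (t * x))" for x
    by (simp add: std_normal_density_def scaleR_conv_of_real mult_ac real_sqrt_gt_zero flip: of_real_mult)
  have "integrable lborel (\<lambda>x. std_normal_density x *\<^sub>R iexp (t * x))"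
    by (rule Bochner_Integration.integrable_bound[of _ std_normal_density]) (auto simp: integrable_normal_density)
  then show "integrable lborel (\<lambda>x. iexp (t * x) * complex_of_real (exp (- x\<^sup>2 / 2)))"
    unfolding e by (rule integrable_mult_right)
  have "char std_normal_distribution t = (LINT x|lborel. std_normal_density x *\<^sub>R iexp (t * x))"
    unfolding char_def by (subst integral_density) auto
  then have "(LINT x|lborel. std_normal_density x *\<^sub>R iexp (t * x)) = complex_of_real (exp (- t\<^sup>2 / 2))"
    by (simp add: char_std_normal_distribution)
  then show "(LINT x|lborel. iexp (t * x) * complex_of_real (exp (- x\<^sup>2 / 2))) =
     complex_of_real (sqrt (2 * pi) * exp (- t\<^sup>2 / 2))"
    unfolding e integral_mult_right_zero by simp
qed

lemma ftc_sqrt: "ftc TYPE('a::euclidean_space) * complex_of_real (sqrt (2 * pi) ^ DIM('a)) = 1"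
proof -
  have "sqrt (2 * pi) ^ DIM('a) = (2 * pi) powr (real DIM('a) / 2)"
    by (simp add: powr_half_sqrt[symmetric] powr_realpow[symmetric] powr_powr)
  then show ?thesis by (simp add: powr_minus flip: of_real_mult)
qed

lemma fourier_gauss: "fourier (gauss (1 / 2)) = (gauss (1 / 2) :: 'a::euclidean_space \<Rightarrow> complex)"
proof
  fix \<xi> :: 'a
  have g: "gauss (1 / 2) x = (\<Prod>b\<in>Basis. complex_of_real (exp (- (x \<bullet> b)\<^sup>2 / 2)))" for x :: 'a
  proof -
    have "gauss (1 / 2) x = complex_of_real (exp (\<Sum>b\<in>Basis. - (x \<bullet> b)\<^sup>2 / 2))"
      unfolding gauss_def power2_norm_eq_inner
      by (subst euclidean_inner) (simp add: power2_eq_square sum_divide_distrib sum_negf)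
    then show ?thesis by (simp add: exp_sum)
  qed
  have c: "charf (- \<xi>) x = (\<Prod>b\<in>Basis. iexp (- (\<xi> \<bullet> b) * (x \<bullet> b)))" for x :: 'a
  proof -
    have "\<i> * complex_of_real (- \<xi> \<bullet> x) = (\<Sum>b\<in>Basis. \<i> * complex_of_real (- (\<xi> \<bullet> b) * (x \<bullet> b)))"
      by (subst euclidean_inner) (simp add: sum_distrib_left)
    then show ?thesis unfolding charf_def by (simp add: exp_sum)
  qed
  have "(LINT x|lborel. charf (- \<xi>) x * gauss (1 / 2) x) =
      (LINT x|lborel. (\<Prod>b\<in>Basis. iexp (- (\<xi> \<bullet> b) * (x \<bullet> b)) * complex_of_real (exp (- (x \<bullet> b)\<^sup>2 / 2))))"
    unfolding g c by (simp only: prod.distrib)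
  also have "\<dots> = (\<Prod>b\<in>Basis. complex_of_real (sqrt (2 * pi) * exp (- (- (\<xi> \<bullet> b))\<^sup>2 / 2)))"
    by (rule integral_lborel_prod[of "\<lambda>b t. iexp (- (\<xi> \<bullet> b) * t) * complex_of_real (exp (- t\<^sup>2 / 2))",
          OF gaussian_fourier_real(1), unfolded gaussian_fourier_real(2)])
  also have "\<dots> = complex_of_real (sqrt (2 * pi) ^ DIM('a)) * gauss (1 / 2) \<xi>"
    unfolding g of_real_mult prod.distrib by simp
  finally show "fourier (gauss (1 / 2)) \<xi> = gauss (1 / 2) \<xi>"
    unfolding fourier_charf using ftc_sqrt[where 'a='a] by (simp only: mult.assoc[symmetric] mult_1)
qed

text \<open>The kernel \<open>u\<close> has modulus at most 1, so the integrability of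
  \<open>f\<close> and \<open>h\<close> separately gives the condition for Fubini's theorem.\<close>

lemma integrable_product_measure:
  fixes f h :: "'a::euclidean_space \<Rightarrow> complex"
  assumes f: "f \<in> schwartz" and h: "h \<in> schwartz"
    and u: "continuous_on UNIV (\<lambda>p. u (fst p) (snd p))" "\<And>x y. cmod (u x y) \<le> 1"
  shows "integrable (lborel \<Otimes>\<^sub>M lborel) (\<lambda>(x, y). u x y * (f x * h y))"
proof (rule lborel_pair.Fubini_integrable)
  have [measurable]: "f \<in> borel_measurable borel" "h \<in> borel_measurable borel"
    "(\<lambda>p. u (fst p) (snd p)) \<in> borel_measurable borel"
    using f h u(1) by (auto intro: schwartz_measurable borel_measurable_continuous_onI)
  have um[measurable]: "(\<lambda>p. u (fst p) (snd p)) \<in> borel_measurable (lborel \<Otimes>\<^sub>M lborel)"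
    unfolding lborel_prod by simp
  show m: "(\<lambda>(x, y). u x y * (f x * h y)) \<in> borel_measurable (lborel \<Otimes>\<^sub>M lborel)"
    unfolding case_prod_beta' by measurable
  have ux: "(\<lambda>y. u x y) \<in> borel_measurable borel" for x
  proof -
    have "continuous_on UNIV (\<lambda>y. u (fst (x, y)) (snd (x, y)))"
      by (rule continuous_on_compose2[OF u(1)]) (auto intro!: continuous_intros)
    then show ?thesis by (intro borel_measurable_continuous_onI) simp
  qed
  have i: "integrable lborel (\<lambda>y. u x y * (f x * h y))" for x
  proof (rule Bochner_Integration.integrable_bound)
    show "integrable lborel (\<lambda>y. f x * h y)" using schwartz_integrable[OF h] by simp
    show "(\<lambda>y. u x y * (f x * h y)) \<in> borel_measurable lborel" using ux by simp
    show "AE y in lborel. norm (u x y * (f x * h y)) \<le> norm (f x * h y)"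
      using u(2) by (intro always_eventually allI) (auto simp: norm_mult intro!: mult_left_le_one_le)
  qed
  show "AE x in lborel. integrable lborel (\<lambda>y. case (x, y) of (x, y) \<Rightarrow> u x y * (f x * h y))" using i by simp
  show "integrable lborel (\<lambda>x. LINT y|lborel. norm (case (x, y) of (x, y) \<Rightarrow> u x y * (f x * h y)))"
  proof (rule Bochner_Integration.integrable_bound)
    show "integrable lborel (\<lambda>x. cmod (f x) * (LINT y|lborel. cmod (h y)))"
      using schwartz_integrable[OF f] by simp
    show "(\<lambda>x. LINT y|lborel. norm (case (x, y) of (x, y) \<Rightarrow> u x y * (f x * h y))) \<in> borel_measurable lborel"
      using m by (intro lborel.borel_measurable_lebesgue_integral) (simp add: case_prod_beta')
    show "AE x in lborel. norm (LINT y|lborel. norm (case (x, y) of (x, y) \<Rightarrow> u x y * (f x * h y)))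
        \<le> norm (cmod (f x) * (LINT y|lborel. cmod (h y)))"
    proof (intro always_eventually allI)
      fix x
      have "(LINT y|lborel. norm (u x y * (f x * h y))) \<le> (LINT y|lborel. cmod (f x) * cmod (h y))"
        using schwartz_integrable[OF h] u(2)
        by (intro integral_mono integrable_norm[OF i]) (auto simp: norm_mult intro!: mult_left_le_one_le)
      moreover have "0 \<le> (LINT y|lborel. norm (u x y * (f x * h y)))" by simp
      ultimately show "norm (LINT y|lborel. norm (case (x, y) of (x, y) \<Rightarrow> u x y * (f x * h y)))
        \<le> norm (cmod (f x) * (LINT y|lborel. cmod (h y)))" by simp
    qed
  qed
qed

text \<open>Fubini, since the kernel is symmetric in its two arguments.\<close>

lemma fourier_exchange:
  fixes f h :: "'a::euclidean_space \<Rightarrow> complex"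
  assumes f: "f \<in> schwartz" and h: "h \<in> schwartz"
  shows "(LINT x|lborel. fourier f x * h x) = (LINT x|lborel. f x * fourier h x)"
proof -
  have u: "continuous_on UNIV (\<lambda>p. charf (- fst p) (snd p))" for p :: "'a \<times> 'a"
    unfolding charf_def by (intro continuous_intros)
  have i: "integrable (lborel \<Otimes>\<^sub>M lborel) (\<lambda>(x, y). charf (- x) y * (f x * h y))"
    by (rule integrable_product_measure[OF f h u]) simp
  have "(LINT y|lborel. fourier f y * h y) = ftc TYPE('a) * (LINT y|lborel. LINT x|lborel. charf (- x) y * (f x * h y))"
    unfolding fourier_charf by (simp add: charf_def inner_commute mult_ac flip: integral_mult_left_zero integral_mult_right_zero)
  also have "\<dots> = ftc TYPE('a) * (LINT x|lborel. LINT y|lborel. charf (- x) y * (f x * h y))"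
    using lborel_pair.Fubini_integral[OF i] by simp
  also have "\<dots> = (LINT x|lborel. f x * fourier h x)"
    unfolding fourier_charf by (simp add: mult_ac flip: integral_mult_left_zero integral_mult_right_zero)
  finally show ?thesis .
qed

lemma fourier_gauss_scaled:
  fixes y :: "'a::euclidean_space"
  assumes s: "0 < s"
  shows "s ^ DIM('a) *\<^sub>R fourier (gauss (s\<^sup>2 / 2)) (s *\<^sub>R y) = gauss (1 / 2) y"
proof -
  have [measurable]: "(\<lambda>x. charf (- y) x * gauss (1 / 2) x) \<in> borel_measurable borel"
    by (intro schwartz_measurable charf_mult_schwartz gauss_schwartz) simp
  have "gauss (1 / 2) y = ftc TYPE('a) * (LINT x|lborel. charf (- y) x * gauss (1 / 2) x)"
    using fun_cong[OF fourier_gauss, of y] by (simp add: fourier_charf)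
  also have "\<dots> = ftc TYPE('a) * (s ^ DIM('a) *\<^sub>R (LINT x|lborel. charf (- y) (s *\<^sub>R x) * gauss (1 / 2) (s *\<^sub>R x)))"
    using integral_affine[of s "\<lambda>x. charf (- y) x * gauss (1 / 2) x" 0] s by simp
  also have "(\<lambda>x. charf (- y) (s *\<^sub>R x) * gauss (1 / 2) (s *\<^sub>R x)) = (\<lambda>x. charf (- (s *\<^sub>R y)) x * gauss (s\<^sup>2 / 2) x)"
    using s by (simp add: charf_def gauss_def power_mult_distrib)
  finally show ?thesis by (simp add: fourier_charf)
qed

text \<open>Moving the transform from \<open>f\<close> to a wide Gaussian and rescaling, the
  integral of \<open>gauss (s\<^sup>2 / 2) x * fourier f x\<close> equals that of
  \<open>gauss (1 / 2) y * f (s *\<^sub>R y)\<close>. As \<open>s\<close> tends to 0, the former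
  tends to the integral of \<open>fourier f\<close> and the latter to \<open>f 0\<close> times the
  mass of the Gaussian.\<close>

lemma fourier_inversion_zero:
  fixes f :: "'a::euclidean_space \<Rightarrow> complex"
  assumes f: "f \<in> schwartz"
  shows "ftc TYPE('a) * (LINT x|lborel. fourier f x) = f 0"
proof -
  define s where "s n = 1 / real (Suc n)" for n
  have s: "0 < s n" for n by (simp add: s_def)
  have s0: "s \<longlonglongrightarrow> 0" unfolding s_def by (rule LIMSEQ_Suc[OF lim_1_over_n])
  have eq: "(LINT x|lborel. gauss ((s n)\<^sup>2 / 2) x * fourier f x) = (LINT y|lborel. gauss (1 / 2) y * f (s n *\<^sub>R y))" for n
  proof -
    have g: "gauss ((s n)\<^sup>2 / 2) \<in> (schwartz :: ('a \<Rightarrow> complex) set)" using s[of n] by (intro gauss_schwartz) simp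
    have m: "(\<lambda>y. fourier (gauss ((s n)\<^sup>2 / 2)) y * f y) \<in> borel_measurable borel"
      by (intro schwartz_measurable schwartz_mult schwartz_si fourier_schwartz g f)
    have "(LINT x|lborel. gauss ((s n)\<^sup>2 / 2) x * fourier f x) = (LINT x|lborel. fourier (gauss ((s n)\<^sup>2 / 2)) x * f x)"
      by (rule fourier_exchange[OF g f, symmetric])
    also have "\<dots> = (s n) ^ DIM('a) *\<^sub>R (LINT y|lborel. fourier (gauss ((s n)\<^sup>2 / 2)) (s n *\<^sub>R y) * f (s n *\<^sub>R y))"
      using integral_affine[OF _ m, of "s n" 0] s[of n] by simp
    also have "\<dots> = (LINT y|lborel. ((s n) ^ DIM('a) *\<^sub>R fourier (gauss ((s n)\<^sup>2 / 2)) (s n *\<^sub>R y)) * f (s n *\<^sub>R y))"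
      by simp
    finally show ?thesis unfolding fourier_gauss_scaled[OF s] .
  qed
  have gs: "gauss (1 / 2) \<in> (schwartz :: ('a \<Rightarrow> complex) set)" by (rule gauss_schwartz) simp
  have "(\<lambda>n. LINT x|lborel. gauss ((s n)\<^sup>2 / 2) x * fourier f x) \<longlonglongrightarrow> (LINT x|lborel. fourier f x)"
  proof (rule integral_dominated_convergence[where w = "\<lambda>x. cmod (fourier f x)"])
    show "integrable lborel (\<lambda>x. cmod (fourier f x))" using schwartz_integrable[OF fourier_schwartz[OF f]] by simp
    show "fourier f \<in> borel_measurable lborel" using schwartz_measurable[OF fourier_schwartz[OF f]] by simp
    show "(\<lambda>x. gauss ((s n)\<^sup>2 / 2) x * fourier f x) \<in> borel_measurable lborel" for n
      using s[of n] by (simp, intro schwartz_measurable schwartz_mult schwartz_si gauss_schwartz fourier_schwartz f) simp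
    have "(\<lambda>n. gauss ((s n)\<^sup>2 / 2) x * fourier f x) \<longlonglongrightarrow> fourier f x" for x
      unfolding gauss_def using s0 by (auto intro!: tendsto_eq_intros)
    then show "AE x in lborel. (\<lambda>n. gauss ((s n)\<^sup>2 / 2) x * fourier f x) \<longlonglongrightarrow> fourier f x" by simp
    show "AE x in lborel. norm (gauss ((s n)\<^sup>2 / 2) x * fourier f x) \<le> cmod (fourier f x)" for n
      by (intro always_eventually allI) (auto simp: norm_mult gauss_def intro!: mult_left_le_one_le)
  qed
  moreover have "(\<lambda>n. LINT y|lborel. gauss (1 / 2) y * f (s n *\<^sub>R y)) \<longlonglongrightarrow> (LINT y|lborel. gauss (1 / 2) (y::'a) * f 0)"
  proof -
    obtain C where C: "wbd 0 (- int 0) C f" using schwartz_wbd[OF f] by blast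
    have fb: "cmod (f x) \<le> C" for x using wbd_bound[OF C] by simp
    show ?thesis
    proof (rule integral_dominated_convergence[where w = "\<lambda>x::'a. cmod (gauss (1 / 2) x) * C"])
      show "integrable lborel (\<lambda>x::'a. cmod (gauss (1 / 2) x) * C)" using schwartz_integrable[OF gs] by simp
      show "(\<lambda>y::'a. gauss (1 / 2) y * f 0) \<in> borel_measurable lborel" using schwartz_measurable[OF gs] by simp
      show "(\<lambda>y. gauss (1 / 2) y * f (s n *\<^sub>R y)) \<in> borel_measurable lborel" for n
        using schwartz_measurable[OF gs] schwartz_measurable[OF f] by simp
      have "(\<lambda>n. f (s n *\<^sub>R y)) \<longlonglongrightarrow> f 0" for y
      proof -
        have "(\<lambda>n. s n *\<^sub>R y) \<longlonglongrightarrow> 0" using s0 by (auto intro!: tendsto_eq_intros)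
        then show ?thesis
          using schwartz_continuous[OF f] by (auto simp: continuous_on_eq_continuous_at intro: isCont_tendsto_compose)
      qed
      then show "AE y in lborel. (\<lambda>n. gauss (1 / 2) y * f (s n *\<^sub>R y)) \<longlonglongrightarrow> gauss (1 / 2) y * f 0"
        by (intro always_eventually allI tendsto_mult tendsto_const)
      show "AE y in lborel. norm (gauss (1 / 2) y * f (s n *\<^sub>R y)) \<le> cmod (gauss (1 / 2) y) * C" for n
        by (intro always_eventually allI) (auto simp: norm_mult intro!: mult_left_mono fb)
    qed
  qed
  ultimately have "(LINT x|lborel. fourier f x) = (LINT y|lborel. gauss (1 / 2) (y::'a) * f 0)"
    unfolding eq by (rule LIMSEQ_unique)
  also have "\<dots> = (LINT y|lborel. gauss (1 / 2) (y::'a)) * f 0" by simp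
  finally have "ftc TYPE('a) * (LINT x|lborel. fourier f x) = (ftc TYPE('a) * (LINT y|lborel. gauss (1 / 2) (y::'a))) * f 0"
    by (simp only: mult.assoc)
  \<comment> \<open>The normalized mass of the Gaussian is its transform at 0, that is
    \<open>gauss (1 / 2) 0 = 1\<close>.\<close>
  moreover have "ftc TYPE('a) * (LINT y|lborel. gauss (1 / 2) (y::'a)) = 1"
    using fun_cong[OF fourier_gauss, of "0::'a"] by (simp add: fourier_charf charf_def gauss_def)
  ultimately show ?thesis by simp
qed

lemma fourier_translate:
  assumes "f \<in> schwartz"
  shows "fourier (\<lambda>x. f (a + x)) \<xi> = charf a \<xi> * fourier f \<xi>"
proof -
  have m: "(\<lambda>x. charf (- \<xi>) x * f x) \<in> borel_measurable borel"
    by (intro schwartz_measurable charf_mult_schwartz assms)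
  have e: "charf (- \<xi>) x = charf a \<xi> * charf (- \<xi>) (a + x)" for x
    by (simp add: charf_def inner_commute inner_add_right algebra_simps flip: exp_add)
  have "(LINT x|lborel. charf (- \<xi>) x * f (a + x)) = charf a \<xi> * (LINT x|lborel. charf (- \<xi>) (a + x) * f (a + x))"
    by (subst e) (simp add: mult.assoc)
  then show ?thesis unfolding fourier_charf integral_shift[OF m] by simp
qed

text \<open>A translation carries inversion at 0 to an arbitrary point.\<close>

lemma inv_fourier_fourier:
  assumes f: "f \<in> schwartz"
  shows "inv_fourier (fourier f) = f"
proof
  fix x
  have "f x = ftc TYPE('a) * (LINT \<xi>|lborel. fourier (\<lambda>y. f (x + y)) \<xi>)"
    using fourier_inversion_zero[OF schwartz_translate[OF f, of x]] by simp
  then show "inv_fourier (fourier f) x = f x"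
    by (simp add: inv_fourier_charf fourier_translate[OF f])
qed

lemma fourier_inv_fourier:
  assumes f: "f \<in> schwartz"
  shows "fourier (inv_fourier f) = f"
  using inv_fourier_fourier[OF f] fourier_of_reflect[OF fourier_schwartz[OF f]]
  by (simp add: inv_fourier_reflect)

lemma inv_fourier_exchange:
  fixes f h :: "'a::euclidean_space \<Rightarrow> complex"
  assumes f: "f \<in> schwartz" and h: "h \<in> schwartz"
  shows "(LINT x|lborel. inv_fourier f x * h x) = (LINT x|lborel. f x * inv_fourier h x)"
  using fourier_exchange[OF inv_fourier_schwartz[OF f] inv_fourier_schwartz[OF h]]
  by (simp add: fourier_inv_fourier f h)

text \<open>The function \<open>h (x - y)\<close> of \<open>y\<close> is the inverse transform of a
  modulated \<open>inv_fourier h\<close>; moving \<open>inv_fourier\<close> across the integral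
  gives the convolution theorem, with the factor \<open>ftc\<close> due to the symmetric
  normalization.\<close>

lemma fun_convolution_fourier:
  fixes f h :: "'a::euclidean_space \<Rightarrow> complex"
  assumes f: "f \<in> schwartz" and h: "h \<in> schwartz"
  shows "ftc TYPE('a) * fun_convolution f h x = fourier (\<lambda>\<xi>. inv_fourier f \<xi> * inv_fourier h \<xi>) x"
proof -
  have k: "(\<lambda>\<xi>. charf (- x) \<xi> * inv_fourier h \<xi>) \<in> schwartz" by (intro charf_mult_schwartz inv_fourier_schwartz h)
  have ik: "inv_fourier (\<lambda>\<xi>. charf (- x) \<xi> * inv_fourier h \<xi>) y = h (x - y)" for y
  proof -
    have e: "charf y \<xi> * (charf (- x) \<xi> * inv_fourier h \<xi>) = charf (- (x - y)) \<xi> * inv_fourier h \<xi>" for \<xi>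
      by (simp add: charf_def inner_diff_left algebra_simps flip: exp_add mult.assoc)
    have "inv_fourier (\<lambda>\<xi>. charf (- x) \<xi> * inv_fourier h \<xi>) y = fourier (inv_fourier h) (x - y)"
      unfolding inv_fourier_charf[of _ y] e fourier_charf ..
    then show ?thesis by (simp add: fourier_inv_fourier h)
  qed
  have "(LINT \<xi>|lborel. charf (- x) \<xi> * (inv_fourier f \<xi> * inv_fourier h \<xi>)) =
      (LINT \<xi>|lborel. inv_fourier f \<xi> * (charf (- x) \<xi> * inv_fourier h \<xi>))"
    by (simp add: mult_ac)
  also have "\<dots> = (LINT y|lborel. f y * h (x - y))"
    unfolding inv_fourier_exchange[OF f k] ik ..
  finally show ?thesis by (simp add: fourier_charf fun_convolution_def)
qed

section \<open>Covariance kernels of stationary fields\<close>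

text \<open>
  Composed with \<open>diagonal_integral\<close>, a stationary covariance \<open>\<rho>\<close> becomes a covariance distribution
  on the product space.
\<close>

definition diagonal_integral :: "('a::euclidean_space \<times> 'a \<Rightarrow> complex) \<Rightarrow> 'a \<Rightarrow> complex" where
  "diagonal_integral \<Phi> z = (LINT y|lborel. \<Phi> (z + y, y))"

lemma wt_Pair: "wt y \<le> wt (z, y)" "wt (z - y) \<le> 2 * wt (z, y)"
proof -
  show "wt y \<le> wt (z, y)" unfolding wt_def by (simp add: norm_Pair)
  have "(norm (z - y))\<^sup>2 \<le> (norm z + norm y)\<^sup>2"
    by (intro power_mono norm_triangle_ineq4) simp
  also have "\<dots> \<le> 2 * ((norm z)\<^sup>2 + (norm y)\<^sup>2)"
    using sum_squares_bound[of "norm z" "norm y"] by (simp add: power2_sum)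
  also have "\<dots> = 2 * (norm (z, y))\<^sup>2" by (simp add: norm_Pair)
  finally show "wt (z - y) \<le> 2 * wt (z, y)" by (simp add: wt_def)
qed

lemma diagonal_slice:
  fixes \<Phi> :: "'a::euclidean_space \<times> 'a \<Rightarrow> complex"
  assumes "\<Phi> \<in> schwartz"
  shows "integrable lborel (\<lambda>y. \<Phi> (z + y, y))"
proof -
  let ?d = "DIM('a)"
  obtain C where C: "wbd 0 (- int ?d) C \<Phi>" using schwartz_wbd[OF assms] by blast
  show ?thesis
  proof (rule integrable_by_wt)
    show "continuous_on UNIV (\<lambda>y. \<Phi> (z + y, y))"
      by (rule continuous_on_compose2[OF schwartz_continuous[OF assms]]) (auto intro!: continuous_intros)
    show "cmod (\<Phi> (z + y, y)) \<le> C * wt y powi (- int ?d)" for y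
      using wbd_bound[OF C, of "(z + y, y)"] wbd_nonneg[OF C] wt_Pair(1)[of y "z + y"]
      by (elim order_trans) (auto intro!: mult_left_mono le_imp_inverse_le power_mono simp: power_int_minus)
  qed
qed

lemma dpart_eq_sum: "f differentiable at x \<Longrightarrow> dpart h f x = (\<Sum>b\<in>Basis. (h \<bullet> b) *\<^sub>R dpart b f x)"
  by (rule dpart_eqI[OF has_derivative_dpart])

lemma diagonal_integral_deriv:
  fixes \<Phi> :: "'a::euclidean_space \<times> 'a \<Rightarrow> complex"
  assumes \<Phi>: "\<Phi> \<in> schwartz"
  shows "diagonal_integral \<Phi> differentiable at z"
    and "dpart b (diagonal_integral \<Phi>) = diagonal_integral (dpart (b, 0) \<Phi>)"
proof -
  let ?d = "DIM('a)"
  obtain C where C: "wbd 1 (- int ?d) C \<Phi>" using schwartz_wbd[OF \<Phi>] by blast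
  have C0: "0 \<le> C" by (rule wbd_nonneg[OF C])
  note df = schwartz_differentiable[OF \<Phi>]
  have D: "((\<lambda>z. LINT y|lborel. \<Phi> (z + y, y)) has_derivative (\<lambda>h. LINT y|lborel. dpart (h, 0) \<Phi> (z + y, y))) (at z)" for z
  proof (rule has_derivative_integral[where U = UNIV and H = "\<lambda>y. real DIM('a \<times> 'a) * C * wt y powi (- int ?d)"])
    show "integrable lborel (\<lambda>y. \<Phi> (z + y, y))" for z by (rule diagonal_slice[OF \<Phi>])
    show "((\<lambda>z. \<Phi> (z + y, y)) has_derivative (\<lambda>h. dpart (h, 0) \<Phi> (z + y, y))) (at z)" for z y
    proof -
      have "((\<lambda>z. (z + y, y)) has_derivative (\<lambda>h. (h, 0))) (at z)" by (auto intro!: derivative_eq_intros)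
      from has_derivative_compose[OF this frechet_works[OF df]] show ?thesis .
    qed
    show "cmod (dpart (h, 0) \<Phi> (z + y, y)) \<le> real DIM('a \<times> 'a) * C * wt y powi (- int ?d) * norm h" for z y h
    proof -
      have "cmod (dpart c \<Phi> (z + y, y)) \<le> C * wt y powi (- int ?d)" if "c \<in> Basis" for c
      proof -
        have "wbd 0 (- int ?d) C (dpart c \<Phi>)" using C that by simp
        from wbd_bound[OF this, of "(z + y, y)"] show ?thesis
          using C0 wt_Pair(1)[of y "z + y"]
          by (elim order_trans) (auto intro!: mult_left_mono le_imp_inverse_le power_mono simp: power_int_minus)
      qed
      from norm_deriv_bound[of "\<lambda>c. dpart c \<Phi> (z + y, y)", OF this, of "(h, 0)"]
      show ?thesis unfolding dpart_eq_sum[OF df, of "(h, 0)"] by (simp add: norm_Pair mult_ac)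
    qed
    show "integrable lborel (\<lambda>y::'a. real DIM('a \<times> 'a) * C * wt y powi (- int ?d))" by (rule integrable_wt_le) simp
    show "integrable lborel (\<lambda>y. dpart (h, 0) \<Phi> (z + y, y))" for h
      unfolding dpart_eq_sum[OF df, of "(h, 0)"]
      by (intro Bochner_Integration.integrable_sum integrable_scaleR_right diagonal_slice schwartz_dpart \<Phi>)
  qed (use C0 in auto)
  then show "diagonal_integral \<Phi> differentiable at z"
    unfolding diagonal_integral_def[abs_def] by (auto simp: differentiable_def)
  show "dpart b (diagonal_integral \<Phi>) = diagonal_integral (dpart (b, 0) \<Phi>)"
    unfolding diagonal_integral_def[abs_def] by (intro ext dpart_eqI[OF D])
qed

text \<open>The weight at \<open>(z + y, y)\<close> dominates both \<open>wt y\<close> and half of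
  \<open>wt z\<close>: \<open>k\<close> powers become decay in \<open>z\<close>, and the other
  \<open>DIM('a)\<close> make the integral over \<open>y\<close> finite.\<close>

lemma wbd_diagonal_integral:
  fixes \<Phi> :: "'a::euclidean_space \<times> 'a \<Rightarrow> complex"
  assumes "\<Phi> \<in> schwartz" "wbd n (- int (k + DIM('a))) C \<Phi>"
  shows "wbd n (- int k) (2 ^ k * wt_int TYPE('a) * C) (diagonal_integral \<Phi>)"
  using assms
proof (induction n arbitrary: \<Phi>)
  have base: "cmod (diagonal_integral \<Phi> z) \<le> (2 ^ k * wt_int TYPE('a) * C) * wt z powi (- int k)"
    if "wbd n (- int (k + DIM('a))) C \<Phi>" for n \<Phi> and z :: 'a
  proof -
    have "cmod (\<Phi> (z + y, y)) \<le> (C * 2 ^ k * wt z powi (- int k)) * wt y powi (- int DIM('a))" for y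
    proof -
      let ?p = "(z + y, y)"
      have "wt z \<le> 2 * wt ?p" using wt_Pair(2)[of "z + y" y] by simp
      then have 1: "inverse (wt ?p) ^ k \<le> 2 ^ k * inverse (wt z) ^ k"
        by (subst power_mult_distrib[symmetric], intro power_mono) (auto simp: field_simps)
      have 2: "inverse (wt ?p) ^ DIM('a) \<le> inverse (wt y) ^ DIM('a)"
        using wt_Pair(1)[of y "z + y"] by (intro power_mono le_imp_inverse_le) auto
      have "cmod (\<Phi> ?p) \<le> C * wt ?p powi (- int (k + DIM('a)))" by (rule wbd_bound[OF that])
      also have "\<dots> = C * (inverse (wt ?p) ^ k * inverse (wt ?p) ^ DIM('a))"
        unfolding power_int_minus power_int_of_nat power_add by (simp add: power_inverse)
      also have "\<dots> \<le> C * ((2 ^ k * inverse (wt z) ^ k) * inverse (wt y) ^ DIM('a))"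
        using 1 2 wbd_nonneg[OF that] by (intro mult_left_mono mult_mono) auto
      finally show ?thesis by (simp add: power_int_minus power_inverse mult_ac)
    qed
    from norm_integral_le[OF this] show ?thesis by (simp add: diagonal_integral_def mult_ac)
  qed
  {
    case 0
    then show ?case using base[OF 0(2)] by simp
  next
    case (Suc n)
    have "wbd n (- int k) (2 ^ k * wt_int TYPE('a) * C) (dpart b (diagonal_integral \<Phi>))" if "b \<in> Basis" for b
    proof -
      have b: "(b, 0) \<in> Basis" using that by (simp add: Basis_prod_def)
      show ?thesis unfolding diagonal_integral_deriv(2)[OF Suc.prems(1)]
        by (rule Suc.IH[OF schwartz_dpart[OF Suc.prems(1) b] wbd_SucD(2)[OF Suc.prems(2) b]])
    qed
    then show ?case using base[OF Suc.prems(2)] diagonal_integral_deriv(1)[OF Suc.prems(1)] by simp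
  }
qed

lemma schwartz_op_diagonal_integral: "schwartz_op diagonal_integral"
  unfolding schwartz_op_def
proof (intro conjI ballI allI)
  fix f h :: "'a \<times> 'a \<Rightarrow> complex" and a b assume "f \<in> schwartz" "h \<in> schwartz"
  then show "diagonal_integral (\<lambda>x. a * f x + b * h x) = (\<lambda>x. a * diagonal_integral f x + b * diagonal_integral h x)"
    unfolding diagonal_integral_def by (simp add: diagonal_slice)
next
  show "\<exists>N. wbd_op n k (diagonal_integral :: _ \<Rightarrow> 'a \<Rightarrow> complex) N" for n k
    by (rule wbd_opI[OF wbd_diagonal_integral])
qed

text \<open>A shift of the integration variable by \<open>z\<close>. It makes \<open>\<rho>\<close>
  composed with \<open>diagonal_integral\<close> satisfy the stationarity identity on
  tensors.\<close>

lemma diagonal_integral_tensor: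
  assumes f: "f \<in> schwartz" and h: "h \<in> schwartz"
  shows "diagonal_integral (tensor f h) = fun_convolution f (reflect h)"
proof
  fix z :: 'a
  have m: "(\<lambda>y. f y * reflect h (z - y)) \<in> borel_measurable borel"
  proof (intro borel_measurable_times)
    show "f \<in> borel_measurable borel" by (rule schwartz_measurable[OF f])
    show "(\<lambda>y. reflect h (z - y)) \<in> borel_measurable borel"
      using schwartz_measurable[OF h] unfolding reflect_def by measurable
  qed
  show "diagonal_integral (tensor f h) z = fun_convolution f (reflect h) z"
    unfolding diagonal_integral_def fun_convolution_def
    using integral_shift[OF m, of z] by (simp add: tensor_def reflect_def)
qed

section \<open>Positive functionals\<close>

text \<open>
  The Gaussian factor in the proof makes the square root of the difference of a multiple of
  \<open>wt powi (- 2 * K)\<close> and \<open>\<bar>h\<bar>\<^sup>2\<close> a Schwartz function.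
\<close>

lemma positive_functional_bound:
  fixes T :: "('a::euclidean_space \<Rightarrow> complex) \<Rightarrow> complex"
  assumes T: "tempered_functional T"
    and pos: "\<And>h. h \<in> schwartz \<Longrightarrow> 0 \<le> Re (T (\<lambda>x. h x * cnj (h x)))"
  shows "\<exists>K C. \<forall>h\<in>schwartz. \<forall>M>0. (\<forall>x. cmod (h x) \<le> M * wt x powi (- int K)) \<longrightarrow>
    Re (T (\<lambda>x. h x * cnj (h x))) \<le> C * M\<^sup>2"
proof -
  obtain n k K0 where K0: "0 < K0" "\<And>f C. f \<in> schwartz \<Longrightarrow> wbd n (- int k) C f \<Longrightarrow> cmod (T f) \<le> K0 * C"
    using tempered_functional_bound[OF T] by metis
  \<comment> \<open>The exponent pays for the weight \<open>k\<close> in the estimate of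
    \<open>T\<close> and for the growth \<open>n + 1\<close> of the Gaussian:
    \<open>n + 1 - 2 * (k + n + 1) \<le> - k\<close>.\<close>
  let ?K = "k + n + 1" and ?w = "\<lambda>x::'a. complex_of_real (wt x powi (- 2 * int (k + n + 1)))"
  obtain Cg where Cg: "\<And>d. d \<in> {0<..1} \<Longrightarrow> wbd n (int n + 1) Cg (gauss d :: 'a \<Rightarrow> complex)"
    using gauss_uniform by blast
  obtain Cw where Cw: "wbd n (- 2 * int ?K) Cw ?w" using wbd_wt by blast
  let ?C1 = "2 ^ n * Cg * Cw"
  have gw: "(\<lambda>x. gauss d x * ?w x) \<in> schwartz" "cmod (T (\<lambda>x. gauss d x * ?w x)) \<le> K0 * ?C1" if d: "d \<in> {0<..1}" for d
  proof -
    show S: "(\<lambda>x. gauss d x * ?w x) \<in> schwartz"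
      using schwartz_mult[OF si_wt gauss_schwartz[of d]] d by (simp add: mult.commute)
    have "wbd n (- int k) ?C1 (\<lambda>x. gauss d x * ?w x)"
      by (rule wbd_mono[OF wbd_mult[OF Cg[OF d] Cw]]) auto
    then show "cmod (T (\<lambda>x. gauss d x * ?w x)) \<le> K0 * ?C1" by (rule K0(2)[OF S])
  qed
  have "Re (T (\<lambda>x. h x * cnj (h x))) \<le> (2 * (K0 * ?C1)) * M\<^sup>2"
    if h: "h \<in> schwartz" and M: "0 < M" and bd: "\<And>x. cmod (h x) \<le> M * wt x powi (- int ?K)" for h M
  proof -
    let ?hh = "\<lambda>x. h x * cnj (h x)"
    \<comment> \<open>The factor 2 leaves \<open>M\<^sup>2 * wt x powi (- 2 * int ?K)\<close> as a
      lower bound of \<open>q\<close>. With factor 1, \<open>q\<close> might vanish and its root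
      fail to be smooth; the margin bounds \<open>1/q\<close> polynomially.\<close>
    define q where "q x = complex_of_real (2 * M\<^sup>2) * ?w x - ?hh x" for x
    have hh: "?hh \<in> schwartz" by (intro schwartz_mult schwartz_si schwartz_cnj h)
    have q_si: "q \<in> slowly_increasing"
      unfolding q_def[abs_def] by (intro si_diff si_cmult si_wt schwartz_si hh)
    have q_real: "q x = complex_of_real (2 * M\<^sup>2 * wt x powi (- 2 * int ?K) - (cmod (h x))\<^sup>2)" for x
      unfolding q_def by (simp add: complex_norm_square[symmetric] del: of_real_power)
    have q_low: "M\<^sup>2 * wt x powi (- 2 * int ?K) \<le> 2 * M\<^sup>2 * wt x powi (- 2 * int ?K) - (cmod (h x))\<^sup>2" for x
    proof -
      have "(cmod (h x))\<^sup>2 \<le> (M * wt x powi (- int ?K))\<^sup>2" by (intro power_mono bd) simp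
      also have "\<dots> = M\<^sup>2 * wt x powi (- 2 * int ?K)"
        unfolding power_mult_distrib power2_eq_square[of "wt x powi _"] wt_powi_add[symmetric]
        by (simp add: algebra_simps)
      finally show ?thesis by simp
    qed
    have low_pos: "0 < M\<^sup>2 * wt x powi (- 2 * int ?K)" for x using M by (intro mult_pos_pos wt_powi_pos) simp
    have q_pos: "q x \<in> \<real> \<and> 0 < Re (q x)" for x
      unfolding q_real using less_le_trans[OF low_pos q_low] by (simp only: Reals_of_real Re_complex_of_real simp_thms)
    have q_nz: "q x \<noteq> 0" for x using q_pos[of x] by auto
    have inv_bd: "cmod (inverse (q x)) \<le> inverse (M\<^sup>2) * wt x powi int (2 * ?K)" for x
    proof -
      have "cmod (inverse (q x)) = inverse (2 * M\<^sup>2 * wt x powi (- 2 * int ?K) - (cmod (h x))\<^sup>2)"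
        unfolding norm_inverse q_real norm_of_real using less_le_trans[OF low_pos q_low[of x]] by (simp only: abs_of_pos)
      also have "\<dots> \<le> inverse (M\<^sup>2 * wt x powi (- 2 * int ?K))"
        by (rule le_imp_inverse_le[OF q_low low_pos])
      also have "\<dots> = inverse (M\<^sup>2) * wt x powi int (2 * ?K)"
        unfolding inverse_mult_distrib power_int_minus[symmetric] by (simp add: algebra_simps)
      finally show ?thesis .
    qed
    have "(\<lambda>x. inverse (q x)) \<in> slowly_increasing"
    proof (rule si_inverse[OF q_si q_nz])
      have "wbd 0 (int (2 * ?K)) (inverse (M\<^sup>2)) (\<lambda>x. inverse (q x))" unfolding wbd.simps using inv_bd by blast
      then show "pbd 0 (\<lambda>x. inverse (q x))" by (rule pbdI)
    qed
    then have s_si: "(\<lambda>x. csqrt (q x)) \<in> slowly_increasing" by (rule si_csqrt[OF q_si q_pos])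
    have s_sq: "csqrt (q x) * cnj (csqrt (q x)) = q x" for x
    proof -
      have "csqrt (q x) \<in> \<real>"
        using q_pos[of x] csqrt_of_real_nonneg[of "q x"] by (auto simp: complex_is_Real_iff)
      then have "cnj (csqrt (q x)) = csqrt (q x)" by (simp add: Reals_cnj_iff)
      then show ?thesis by (metis power2_csqrt power2_eq_square)
    qed
    have main: "Re (T (\<lambda>x. gauss d x * ?hh x)) \<le> (2 * (K0 * ?C1)) * M\<^sup>2" if d: "d \<in> {0<..1}" for d
    proof -
      \<comment> \<open>Its squared modulus is \<open>q * gauss d\<close>, since
        \<open>gauss (d / 2)\<close> squares to \<open>gauss d\<close>; positivity of
        \<open>T\<close> there is the desired comparison.\<close>
      let ?v = "\<lambda>x. csqrt (q x) * gauss (d / 2) x"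
      have v: "?v \<in> schwartz" using d by (intro schwartz_mult s_si gauss_schwartz) simp
      have ghh: "(\<lambda>x. gauss d x * ?hh x) \<in> schwartz" using d by (intro schwartz_mult schwartz_si[OF gauss_schwartz] hh) simp
      have veq: "(\<lambda>x. ?v x * cnj (?v x)) = (\<lambda>x. complex_of_real (2 * M\<^sup>2) * (gauss d x * ?w x) + (- 1) * (gauss d x * ?hh x))"
      proof
        fix x
        have "?v x * cnj (?v x) = (csqrt (q x) * cnj (csqrt (q x))) * (gauss (d / 2) x * gauss (d / 2) x)"
          by (simp add: mult_ac)
        also have "\<dots> = q x * gauss d x" unfolding s_sq gauss_half ..
        finally show "?v x * cnj (?v x) = complex_of_real (2 * M\<^sup>2) * (gauss d x * ?w x) + (- 1) * (gauss d x * ?hh x)"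
          unfolding q_def by (simp add: algebra_simps)
      qed
      have "T (\<lambda>x. ?v x * cnj (?v x)) = complex_of_real (2 * M\<^sup>2) * T (\<lambda>x. gauss d x * ?w x) + (- 1) * T (\<lambda>x. gauss d x * ?hh x)"
        unfolding veq by (rule tempered_functional_lin[OF T gw(1)[OF d] ghh])
      then have "Re (T (\<lambda>x. gauss d x * ?hh x)) \<le> 2 * M\<^sup>2 * Re (T (\<lambda>x. gauss d x * ?w x))"
        using pos[OF v] by (simp del: of_real_power of_real_mult)
      also have "\<dots> \<le> 2 * M\<^sup>2 * (K0 * ?C1)"
        by (intro mult_left_mono order_trans[OF complex_Re_le_cmod gw(2)[OF d]]) simp
      finally show ?thesis by (simp add: mult_ac)
    qed
    have "((\<lambda>d. Re (T (\<lambda>x. gauss d x * ?hh x))) \<longlongrightarrow> Re (T ?hh)) (at_right 0)"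
      by (intro tendsto_Re tempered_functional_gauss[OF T hh])
    then show ?thesis
      by (rule tendsto_upperbound) (auto intro!: eventually_at_rightI[of 0 1] main)
  qed
  then show ?thesis by blast
qed

text \<open>The bounds combine because \<open>wt (x, y) \<le> wt x * wt y\<close>. A basis vector of
  the product space lies in one factor, so a partial derivative of a tensor is again a
  tensor.\<close>

lemma wbd_tensor:
  fixes f h :: "'a::euclidean_space \<Rightarrow> complex"
  assumes "f \<in> schwartz" "h \<in> schwartz" "wbd n (- int k) C f" "wbd n (- int k) D h"
  shows "wbd n (- int k) (C * D) (tensor f h)"
  using assms
proof (induction n arbitrary: f h)
  have base: "cmod (tensor f h p) \<le> C * D * wt p powi (- int k)"
    if f: "wbd n (- int k) C f" and h: "wbd n (- int k) D h" for n f h and p :: "'a \<times> 'a"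
  proof -
    obtain x y where p: "p = (x, y)" by (cases p)
    have "wt p \<le> wt x * wt y"
      by (simp add: p wt_def norm_Pair algebra_simps)
    then have w: "inverse (wt x * wt y) ^ k \<le> inverse (wt p) ^ k"
      by (intro power_mono le_imp_inverse_le) auto
    have "cmod (tensor f h p) \<le> (C * wt x powi (- int k)) * (D * wt y powi (- int k))"
      unfolding p tensor_def prod.case norm_mult
      using wbd_nonneg[OF f] by (intro mult_mono wbd_bound[OF f] wbd_bound[OF h]) auto
    also have "\<dots> = (C * D) * inverse (wt x * wt y) ^ k"
      by (simp add: power_int_minus power_inverse power_mult_distrib)
    also have "\<dots> \<le> (C * D) * inverse (wt p) ^ k"
      using w wbd_nonneg[OF f] wbd_nonneg[OF h] by (intro mult_left_mono) auto
    finally show ?thesis by (simp add: power_int_minus power_inverse)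
  qed
  {
    case 0
    then show ?case using base[OF 0(3,4)] by simp
  next
    case (Suc n)
    have D: "(tensor f h has_derivative (\<lambda>v. f (fst p) * dpart (snd v) h (snd p) + dpart (fst v) f (fst p) * h (snd p))) (at p)" for p
    proof -
      have 1: "((\<lambda>p. f (fst p)) has_derivative (\<lambda>v. dpart (fst v) f (fst p))) (at p)"
        using has_derivative_compose[OF has_derivative_fst[OF has_derivative_ident] frechet_works[OF schwartz_differentiable[OF Suc.prems(1)]]] .
      have 2: "((\<lambda>p. h (snd p)) has_derivative (\<lambda>v. dpart (snd v) h (snd p))) (at p)"
        using has_derivative_compose[OF has_derivative_snd[OF has_derivative_ident] frechet_works[OF schwartz_differentiable[OF Suc.prems(2)]]] .
      show ?thesis using has_derivative_mult[OF 1 2] by (simp add: tensor_def case_prod_beta')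
    qed
    have z: "dpart 0 u x = 0" if "u \<in> schwartz" for u :: "'a \<Rightarrow> complex" and x
      using dpart_eq_sum[OF schwartz_differentiable[OF that], of 0] by simp
    have "wbd n (- int k) (C * D) (dpart b (tensor f h))" if b: "b \<in> Basis" for b :: "'a \<times> 'a"
    proof -
      have f: "wbd n (- int k) C f" and h: "wbd n (- int k) D h"
        using wbd_mono[OF Suc.prems(3)] wbd_mono[OF Suc.prems(4)] by auto
      consider c where "c \<in> Basis" "b = (c, 0)" | c where "c \<in> Basis" "b = (0, c)"
        using b unfolding Basis_prod_def by blast
      then show ?thesis
      proof cases
        case 1
        then have "dpart b (tensor f h) = tensor (dpart c f) h"
          by (intro ext, subst dpart_eqI[OF D]) (simp add: tensor_def case_prod_beta' z Suc.prems)
        then show ?thesis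
          using Suc.IH[OF schwartz_dpart[OF Suc.prems(1) 1(1)] Suc.prems(2) wbd_SucD(2)[OF Suc.prems(3) 1(1)] h] by simp
      next
        case 2
        then have "dpart b (tensor f h) = tensor f (dpart c h)"
          by (intro ext, subst dpart_eqI[OF D]) (simp add: tensor_def case_prod_beta' z Suc.prems)
        then show ?thesis
          using Suc.IH[OF Suc.prems(1) schwartz_dpart[OF Suc.prems(2) 2(1)] f wbd_SucD(2)[OF Suc.prems(4) 2(1)]] by simp
      qed
    qed
    moreover have "tensor f h differentiable at p" for p using D[of p] unfolding differentiable_def by blast
    ultimately show ?case using base[OF Suc.prems(3,4)] unfolding wbd.simps by blast
  }
qed

lemma tensor_schwartz:
  assumes "f \<in> schwartz" "h \<in> schwartz"
  shows "tensor f h \<in> schwartz"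
  unfolding schwartz_iff using wbd_tensor[OF assms] schwartz_wbd[OF assms(1)] schwartz_wbd[OF assms(2)] by metis

section \<open>Fourier multipliers\<close>

text \<open>Distributions and fields are acted upon through their test functions: on a test function
  \<open>f\<close>, the operator with symbol \<open>g\<close> becomes
  \<open>U (fourier (g * inv_fourier f))\<close>, which fixes the order of the two
  transforms.\<close>

definition multiplier :: "('a::euclidean_space \<Rightarrow> complex) \<Rightarrow> ('a \<Rightarrow> complex) \<Rightarrow> 'a \<Rightarrow> complex" where
  "multiplier u f = fourier (\<lambda>x. u x * inv_fourier f x)"

lemma schwartz_op_multiplier: "u \<in> slowly_increasing \<Longrightarrow> schwartz_op (multiplier u)"
  unfolding multiplier_def[abs_def]
  by (rule schwartz_op_comp[OF schwartz_op_fourier schwartz_op_comp[OF schwartz_op_mult schwartz_op_inv_fourier]])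

lemma multiplier_multiplier:
  assumes "u \<in> slowly_increasing" "v \<in> slowly_increasing" "f \<in> schwartz"
  shows "multiplier u (multiplier v f) = multiplier (\<lambda>x. u x * v x) f"
  unfolding multiplier_def
  by (simp add: inv_fourier_fourier schwartz_mult assms inv_fourier_schwartz mult.assoc)

lemma multiplier_one: "f \<in> schwartz \<Longrightarrow> multiplier (\<lambda>x. 1) f = f"
  by (simp add: multiplier_def fourier_inv_fourier)

lemma multiplier_fourier: "f \<in> schwartz \<Longrightarrow> multiplier u (fourier f) = fourier (\<lambda>x. u x * f x)"
  by (simp add: multiplier_def inv_fourier_fourier)

lemma cnj_inv_fourier: "cnj (inv_fourier f \<xi>) = fourier (\<lambda>x. cnj (f x)) \<xi>"
proof -
  have "cnj (fourier (\<lambda>x. cnj (f x)) \<xi>) = inv_fourier f \<xi>"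
    using cnj_fourier[of "\<lambda>x. cnj (f x)" \<xi>] by simp
  from arg_cong[OF this, of cnj] show ?thesis by simp
qed

lemma inv_fourier_of_reflect: "f \<in> schwartz \<Longrightarrow> inv_fourier (reflect f) = fourier f"
  unfolding inv_fourier_reflect[of "reflect f"] fourier_of_reflect by (rule ext) (simp add: reflect_def)

text \<open>For real \<open>f\<close> and Hermitian \<open>u\<close>, the function
  \<open>u * inv_fourier f\<close> is again Hermitian, and Hermitian functions have real transforms.
  In this way the symmetry of the symbol makes the solution a real field.\<close>

lemma multiplier_real:
  assumes u: "u \<in> slowly_increasing" "\<And>x. u x = cnj (u (- x))" and f: "f \<in> schwartz" "range f \<subseteq> \<real>"
  shows "range (multiplier u f) \<subseteq> \<real>"
proof -
  let ?k = "\<lambda>x. u x * inv_fourier f x"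
  have k: "?k \<in> schwartz" by (intro schwartz_mult u inv_fourier_schwartz f)
  have cf: "(\<lambda>x. cnj (f x)) = f" using f(2) by (auto simp: Reals_cnj_iff fun_eq_iff subset_eq)
  have "cnj (?k x) = reflect ?k x" for x
  proof -
    have "cnj (inv_fourier f x) = fourier f x" using cnj_inv_fourier[of f x] cf by simp
    moreover have "inv_fourier f (- x) = fourier f x" by (simp add: inv_fourier_reflect reflect_def)
    ultimately show ?thesis using u(2)[of "- x"] by (simp add: reflect_def)
  qed
  then have ck: "(\<lambda>x. cnj (?k x)) = reflect ?k" by auto
  have "cnj (multiplier u f x) = multiplier u f x" for x
    unfolding multiplier_def cnj_fourier ck inv_fourier_of_reflect[OF k] ..
  then show ?thesis by (auto simp: Reals_cnj_iff)
qed

text \<open>Carries the evenness of \<open>\<rho>\<close> over to the covariance of the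
  solution.\<close>

lemma multiplier_reflect:
  assumes u: "u \<in> slowly_increasing" "\<And>x. u (- x) = u x" and f: "f \<in> schwartz"
  shows "multiplier u (reflect f) = reflect (multiplier u f)"
proof -
  let ?k = "\<lambda>x. u x * inv_fourier f x"
  have k: "?k \<in> schwartz" by (intro schwartz_mult u inv_fourier_schwartz f)
  have "(\<lambda>x. u x * inv_fourier (reflect f) x) = reflect ?k"
  proof
    fix x
    have "inv_fourier f (- x) = fourier f x" by (simp add: inv_fourier_reflect reflect_def)
    then show "u x * inv_fourier (reflect f) x = reflect ?k x"
      unfolding inv_fourier_of_reflect[OF f] by (simp add: reflect_def u(2))
  qed
  then show ?thesis by (simp add: multiplier_def fourier_of_reflect[OF k])
qed

text \<open>Translates stationarity to the Fourier side: the argument of \<open>\<rho>\<close>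
  becomes the transform of a pointwise product, on which symbols act by multiplication.\<close>

lemma convolution_cnj:
  fixes f h :: "'a::euclidean_space \<Rightarrow> complex"
  assumes f: "f \<in> schwartz" and h: "h \<in> schwartz"
  shows "fun_convolution (fourier f) (reflect (\<lambda>x. cnj (fourier h x))) =
    (\<lambda>x. inverse (ftc TYPE('a)) * fourier (\<lambda>\<xi>. f \<xi> * cnj (h \<xi>)) x)"
proof
  fix x :: 'a
  have "inv_fourier (reflect (\<lambda>x. cnj (fourier h x))) = (\<lambda>\<xi>. cnj (h \<xi>))"
    using cnj_inv_fourier[of "fourier h"]
    by (simp add: inv_fourier_of_reflect schwartz_cnj fourier_schwartz h inv_fourier_fourier fun_eq_iff)
  then have "ftc TYPE('a) * fun_convolution (fourier f) (reflect (\<lambda>x. cnj (fourier h x))) x = fourier (\<lambda>\<xi>. f \<xi> * cnj (h \<xi>)) x"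
    using fun_convolution_fourier[OF fourier_schwartz[OF f] schwartz_reflect[OF schwartz_cnj[OF fourier_schwartz[OF h]]]]
    by (simp add: inv_fourier_fourier f)
  moreover have "ftc TYPE('a) \<noteq> 0" by simp
  ultimately show "fun_convolution (fourier f) (reflect (\<lambda>x. cnj (fourier h x))) x =
      inverse (ftc TYPE('a)) * fourier (\<lambda>\<xi>. f \<xi> * cnj (h \<xi>)) x"
    by (metis left_inverse mult.assoc mult_1)
qed

section \<open>Random fields\<close>

lemma gerf_L2: "gerf P Z \<Longrightarrow> f \<in> schwartz \<Longrightarrow> square_integrable P (Z f)"
  by (simp add: gerf_def)

lemma gerf_lin: "gerf P Z \<Longrightarrow> f \<in> schwartz \<Longrightarrow> h \<in> schwartz \<Longrightarrow>
    AE \<omega> in P. Z (\<lambda>x. a * f x + b * h x) \<omega> = a * Z f \<omega> + b * Z h \<omega>"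
  by (simp add: gerf_def)

lemma square_integrable_measurable [measurable_dest]: "square_integrable P Y \<Longrightarrow> Y \<in> borel_measurable P"
  by (simp add: square_integrable_def)

text \<open>Integrability of the squared difference is established first, because the value 0 of an
  integral could also be the default for a non-integrable function.\<close>

lemma L2_dist_sq_eq_0:
  assumes Y: "square_integrable P Y" "square_integrable P Y'" and 0: "L2_dist_sq P Y Y' = 0"
  shows "AE \<omega> in P. Y \<omega> = Y' \<omega>"
proof -
  have "integrable P (\<lambda>\<omega>. (cmod (Y \<omega> - Y' \<omega>))\<^sup>2)"
  proof (rule Bochner_Integration.integrable_bound)
    show "integrable P (\<lambda>\<omega>. 2 * (cmod (Y \<omega>))\<^sup>2 + 2 * (cmod (Y' \<omega>))\<^sup>2)"
      using Y by (simp add: square_integrable_def)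
    show "(\<lambda>\<omega>. (cmod (Y \<omega> - Y' \<omega>))\<^sup>2) \<in> borel_measurable P"
      using Y[THEN square_integrable_measurable] by simp
    show "AE \<omega> in P. norm ((cmod (Y \<omega> - Y' \<omega>))\<^sup>2) \<le> norm (2 * (cmod (Y \<omega>))\<^sup>2 + 2 * (cmod (Y' \<omega>))\<^sup>2)"
    proof (intro always_eventually allI)
      fix \<omega>
      have "(cmod (Y \<omega> - Y' \<omega>))\<^sup>2 \<le> (cmod (Y \<omega>) + cmod (Y' \<omega>))\<^sup>2"
        by (intro power_mono norm_triangle_ineq4) simp
      also have "\<dots> \<le> 2 * (cmod (Y \<omega>))\<^sup>2 + 2 * (cmod (Y' \<omega>))\<^sup>2"
        using sum_squares_bound[of "cmod (Y \<omega>)" "cmod (Y' \<omega>)"] by (simp add: power2_sum)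
      finally show "norm ((cmod (Y \<omega> - Y' \<omega>))\<^sup>2) \<le> norm (2 * (cmod (Y \<omega>))\<^sup>2 + 2 * (cmod (Y' \<omega>))\<^sup>2)" by simp
    qed
  qed
  with 0 have "AE \<omega> in P. (cmod (Y \<omega> - Y' \<omega>))\<^sup>2 = 0"
    unfolding L2_dist_sq_def by (subst (asm) integral_nonneg_eq_0_iff_AE) auto
  then show ?thesis by simp
qed

lemma rsg_gerf: "real_stationary_gerf P U \<rho> \<Longrightarrow> gerf P U"
  by (simp add: real_stationary_gerf_def real_gerf_def)

lemma rsg_tempered: "real_stationary_gerf P U \<rho> \<Longrightarrow> tempered_functional \<rho>"
  by (simp add: real_stationary_gerf_def tempered_iff)

text \<open>Corresponds to the isometry between the random spectral measure and L2 of the spectral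
  measure, with \<open>\<rho>\<close> composed with \<open>fourier\<close> in place of the latter;
  the inverse of \<open>ftc\<close> is the factor (2 pi)^(d/2).\<close>

lemma rsg_covariance:
  fixes \<rho> :: "('a::euclidean_space \<Rightarrow> complex) \<Rightarrow> complex"
  assumes U: "real_stationary_gerf P U \<rho>" and f: "f \<in> schwartz" and h: "h \<in> schwartz"
  shows "(LINT \<omega>|P. U (fourier f) \<omega> * cnj (U (fourier h) \<omega>)) =
    inverse (ftc TYPE('a)) * \<rho> (fourier (\<lambda>\<xi>. f \<xi> * cnj (h \<xi>)))"
proof -
  have fh: "(\<lambda>\<xi>. f \<xi> * cnj (h \<xi>)) \<in> schwartz" by (intro schwartz_mult schwartz_si schwartz_cnj f h)
  have "(LINT \<omega>|P. U (fourier f) \<omega> * cnj (U (fourier h) \<omega>)) =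
      \<rho> (fun_convolution (fourier f) (reflect (\<lambda>x. cnj (fourier h x))))"
    using U fourier_schwartz[OF f] fourier_schwartz[OF h]
    unfolding real_stationary_gerf_def covariance_distribution_def by metis
  then show ?thesis
    unfolding convolution_cnj[OF f h]
    by (simp add: tempered_functional_cmult[OF rsg_tempered[OF U] fourier_schwartz[OF fh]])
qed

lemma rsg_norm:
  fixes \<rho> :: "('a::euclidean_space \<Rightarrow> complex) \<Rightarrow> complex"
  assumes U: "real_stationary_gerf P U \<rho>" and f: "f \<in> schwartz"
  shows "complex_of_real (LINT \<omega>|P. (cmod (U (fourier f) \<omega>))\<^sup>2) =
    inverse (ftc TYPE('a)) * \<rho> (fourier (\<lambda>\<xi>. f \<xi> * cnj (f \<xi>)))"
proof -
  have "complex_of_real (LINT \<omega>|P. (cmod (U (fourier f) \<omega>))\<^sup>2) =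
      (LINT \<omega>|P. complex_of_real ((cmod (U (fourier f) \<omega>))\<^sup>2))"
    by (rule integral_complex_of_real[symmetric])
  then show ?thesis unfolding complex_norm_square rsg_covariance[OF U f f] .
qed

text \<open>The functional \<open>T\<close> computes second moments on squares and is therefore
  nonnegative there, which gives access to a bound without derivatives. Linearity of the field,
  valid up to null sets, reduces a difference of two values to one value.\<close>

lemma rsg_dist_bound:
  fixes U :: "('a::euclidean_space \<Rightarrow> complex) \<Rightarrow> 'w \<Rightarrow> complex"
  assumes U: "real_stationary_gerf P U \<rho>"
  shows "\<exists>K C. \<forall>f\<in>schwartz. \<forall>h\<in>schwartz. \<forall>M>0. (\<forall>x. cmod (f x - h x) \<le> M * wt x powi (- int K)) \<longrightarrow>
    L2_dist_sq P (U (fourier f)) (U (fourier h)) \<le> C * M\<^sup>2"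
proof -
  define T where "T = (\<lambda>k. \<rho> (fourier (\<lambda>x. inverse (ftc TYPE('a)) * k x)))"
  note Tr = tempered_functional_comp[OF rsg_tempered[OF U] schwartz_op_fourier]
  have T: "tempered_functional T"
    unfolding T_def
    by (rule tempered_functional_comp[OF Tr schwartz_op_mult[OF si_const]])
  have norm: "complex_of_real (LINT \<omega>|P. (cmod (U (fourier f) \<omega>))\<^sup>2) = T (\<lambda>\<xi>. f \<xi> * cnj (f \<xi>))"
    if f: "f \<in> schwartz" for f
    unfolding rsg_norm[OF U f] T_def
    by (rule tempered_functional_cmult[OF Tr schwartz_mult[OF schwartz_si[OF f] schwartz_cnj[OF f]], symmetric])
  have "0 \<le> Re (T (\<lambda>x. f x * cnj (f x)))" if "f \<in> schwartz" for f
    unfolding norm[OF that, symmetric] by simp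
  from positive_functional_bound[OF T this] obtain K C where
    KC: "\<And>h M. h \<in> schwartz \<Longrightarrow> 0 < M \<Longrightarrow> (\<forall>x. cmod (h x) \<le> M * wt x powi (- int K)) \<Longrightarrow>
      Re (T (\<lambda>x. h x * cnj (h x))) \<le> C * M\<^sup>2" by blast
  have "L2_dist_sq P (U (fourier f)) (U (fourier h)) \<le> C * M\<^sup>2"
    if f: "f \<in> schwartz" and h: "h \<in> schwartz" and M: "0 < M" "\<forall>x. cmod (f x - h x) \<le> M * wt x powi (- int K)" for f h M
  proof -
    note fs = fourier_schwartz[OF f] and hs = fourier_schwartz[OF h] and ds = schwartz_diff[OF f h]
    have "AE \<omega> in P. U (fourier (\<lambda>x. f x - h x)) \<omega> = U (fourier f) \<omega> - U (fourier h) \<omega>"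
      using gerf_lin[OF rsg_gerf[OF U] fs hs, of 1 "-1"] by (simp add: schwartz_op_diff[OF schwartz_op_fourier f h])
    then have "L2_dist_sq P (U (fourier f)) (U (fourier h)) = (LINT \<omega>|P. (cmod (U (fourier (\<lambda>x. f x - h x)) \<omega>))\<^sup>2)"
      unfolding L2_dist_sq_def
      using gerf_L2[OF rsg_gerf[OF U] fs] gerf_L2[OF rsg_gerf[OF U] hs] gerf_L2[OF rsg_gerf[OF U] fourier_schwartz[OF ds]]
      by (intro integral_cong_AE) (auto dest!: square_integrable_measurable)
    also have "\<dots> = Re (T (\<lambda>x. (f x - h x) * cnj (f x - h x)))" unfolding norm[OF ds, symmetric] by simp
    also have "\<dots> \<le> C * M\<^sup>2" by (rule KC[OF ds M])
    finally show ?thesis .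
  qed
  then show ?thesis by blast
qed

text \<open>\<open>gerf_extend\<close> is a choice, so a witness must be exhibited before anything
  is known about it: \<open>U (fourier f)\<close> is one, by \<open>rsg_dist_bound\<close>. The
  chosen representative then agrees with it almost surely, as the constant sequence \<open>f\<close>
  shows.\<close>

lemma gerf_extend_schwartz:
  fixes U :: "('a::euclidean_space \<Rightarrow> complex) \<Rightarrow> 'w \<Rightarrow> complex"
  assumes U: "real_stationary_gerf P U \<rho>" and f: "f \<in> schwartz"
  shows "square_integrable P (gerf_extend P (gerf_fourier U) f)"
    and "AE \<omega> in P. gerf_extend P (gerf_fourier U) f \<omega> = U (fourier f) \<omega>"
proof -
  define Q where "Q Y \<longleftrightarrow> square_integrable P Y \<and>
        (\<forall>F. (\<forall>n::nat. F n \<in> schwartz) \<and>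
             (\<forall>k. (\<lambda>n. weighted_sup k (\<lambda>x. F n x - f x)) \<longlonglongrightarrow> 0) \<longrightarrow>
             (\<lambda>n. L2_dist_sq P (gerf_fourier U (F n)) Y) \<longlonglongrightarrow> 0)" for Y
  have sq: "square_integrable P (U (fourier f))" by (rule gerf_L2[OF rsg_gerf[OF U] fourier_schwartz[OF f]])
  obtain K C where KC: "\<And>f h M. f \<in> schwartz \<Longrightarrow> h \<in> schwartz \<Longrightarrow> 0 < M \<Longrightarrow> (\<And>x. cmod (f x - h x) \<le> M * wt x powi (- int K)) \<Longrightarrow>
    L2_dist_sq P (U (fourier f)) (U (fourier h)) \<le> C * M\<^sup>2"
    using rsg_dist_bound[OF U] by blast
  have "Q (U (fourier f))"
    unfolding Q_def
  proof (intro conjI allI impI sq)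
    fix F :: "nat \<Rightarrow> 'a \<Rightarrow> complex"
    assume "(\<forall>n. F n \<in> schwartz) \<and> (\<forall>k. (\<lambda>n. weighted_sup k (\<lambda>x. F n x - f x)) \<longlonglongrightarrow> 0)"
    then have F: "\<And>n. F n \<in> schwartz" "(\<lambda>n. weighted_sup K (\<lambda>x. F n x - f x)) \<longlonglongrightarrow> 0" by auto
    \<comment> \<open>The summand \<open>1 / real (Suc n)\<close> keeps the bound strictly positive
      where the supremum vanishes, without affecting the limit.\<close>
    define M where "M n = weighted_sup K (\<lambda>x. F n x - f x) + 1 / real (Suc n)" for n
    have M0: "M \<longlonglongrightarrow> 0"
      unfolding M_def using tendsto_add[OF F(2) LIMSEQ_Suc[OF lim_1_over_n]] by simp
    have up: "L2_dist_sq P (U (fourier (F n))) (U (fourier f)) \<le> C * (M n)\<^sup>2" for n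
    proof (rule KC[OF F(1) f])
      obtain D where D: "wbd 0 (- int K) D (\<lambda>x. F n x - f x)" using schwartz_wbd[OF schwartz_diff[OF F(1) f]] by blast
      have ws: "cmod (F n x - f x) \<le> weighted_sup K (\<lambda>x. F n x - f x) * wt x powi (- int K)" for x
        by (rule weighted_sup_bound[of "\<lambda>x. F n x - f x"]) (use wbd_bound[OF D] in auto)
      have "0 \<le> weighted_sup K (\<lambda>x. F n x - f x)" using order_trans[OF norm_ge_zero ws[of 0]] by simp
      then show "0 < M n" by (simp add: M_def add_nonneg_pos)
      show "cmod (F n x - f x) \<le> M n * wt x powi (- int K)" for x
        by (rule order_trans[OF ws mult_right_mono]) (auto simp: M_def less_imp_le)
    qed
    have low: "0 \<le> L2_dist_sq P (U (fourier (F n))) (U (fourier f))" for n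
      by (simp add: L2_dist_sq_def)
    have lim: "(\<lambda>n. C * (M n)\<^sup>2) \<longlonglongrightarrow> 0" using M0 by (auto intro!: tendsto_eq_intros)
    show "(\<lambda>n. L2_dist_sq P (gerf_fourier U (F n)) (U (fourier f))) \<longlonglongrightarrow> 0"
      unfolding gerf_fourier_def
    proof (rule tendsto_sandwich[OF _ _ tendsto_const lim])
      show "\<forall>\<^sub>F n in sequentially. 0 \<le> L2_dist_sq P (U (fourier (F n))) (U (fourier f))"
        by (intro always_eventually allI low)
      show "\<forall>\<^sub>F n in sequentially. L2_dist_sq P (U (fourier (F n))) (U (fourier f)) \<le> C * (M n)\<^sup>2"
        by (intro always_eventually allI up)
    qed
  qed
  then have Q: "Q (gerf_extend P (gerf_fourier U) f)"
    unfolding gerf_extend_def Q_def[symmetric] by (rule someI[of Q])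
  then show sqe: "square_integrable P (gerf_extend P (gerf_fourier U) f)" by (simp add: Q_def)
  have "(\<lambda>n::nat. weighted_sup k (\<lambda>x. f x - f x)) \<longlonglongrightarrow> 0" for k
    by (simp add: weighted_sup_def weighted_def)
  then have "(\<lambda>n::nat. L2_dist_sq P (U (fourier f)) (gerf_extend P (gerf_fourier U) f)) \<longlonglongrightarrow> 0"
    using Q[unfolded Q_def, THEN conjunct2, rule_format, of "\<lambda>_. f"] f by (simp add: gerf_fourier_def)
  then have "L2_dist_sq P (U (fourier f)) (gerf_extend P (gerf_fourier U) f) = 0"
    by (rule LIMSEQ_unique[OF tendsto_const])
  from L2_dist_sq_eq_0[OF sq sqe this]
  show "AE \<omega> in P. gerf_extend P (gerf_fourier U) f \<omega> = U (fourier f) \<omega>" by auto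
qed

lemma symbol_operator_schwartz:
  assumes U: "real_stationary_gerf P U \<rho>" and g: "g \<in> slowly_increasing" and f: "f \<in> schwartz"
  shows "square_integrable P (symbol_operator P g U f)"
    and "AE \<omega> in P. symbol_operator P g U f \<omega> = U (multiplier g f) \<omega>"
  using gerf_extend_schwartz[OF U schwartz_mult[OF g inv_fourier_schwartz[OF f]]]
  by (simp_all add: symbol_operator_def gerf_inv_fourier_def gerf_mult_def multiplier_def)

text \<open>All defining conditions of a field survive modification on null sets, which matters
  because the operator with symbol \<open>g\<close> yields only chosen representatives.
  \<open>A\<close> is the multiplier of \<open>1 / g\<close> for the solution and the identity for
  its image under the operator.\<close>

lemma gerf_transfer:
  assumes X: "gerf P X" and A: "schwartz_op A"
    and Z: "\<And>f. f \<in> schwartz \<Longrightarrow> square_integrable P (Z f)"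
      "\<And>f. f \<in> schwartz \<Longrightarrow> AE \<omega> in P. Z f \<omega> = X (A f) \<omega>"
  shows "gerf P Z"
proof -
  have XA: "square_integrable P (X (A f))" if "f \<in> schwartz" for f
    by (rule gerf_L2[OF X schwartz_op_in[OF A that]])
  show ?thesis
    unfolding gerf_def
  proof (intro conjI ballI allI)
    show "prob_space P" using X by (simp add: gerf_def)
    show "square_integrable P (Z f)" if "f \<in> schwartz" for f by (rule Z(1)[OF that])
    show "AE \<omega> in P. Z (\<lambda>x. a * f x + b * h x) \<omega> = a * Z f \<omega> + b * Z h \<omega>" if "f \<in> schwartz" "h \<in> schwartz" for f h a b
      using gerf_lin[OF X schwartz_op_in[OF A that(1)] schwartz_op_in[OF A that(2)], of a b]
        Z(2)[OF that(1)] Z(2)[OF that(2)] Z(2)[OF schwartz_lin[OF that, of a b]]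
      by eventually_elim (simp add: schwartz_op_lin[OF A that])
    show "((\<lambda>h. L2_dist_sq P (Z h) (Z f)) \<longlongrightarrow> 0) (schwartz_nhds f)" if f: "f \<in> schwartz" for f
    proof -
      have eq: "L2_dist_sq P (Z h) (Z f) = L2_dist_sq P (X (A h)) (X (A f))" if h: "h \<in> schwartz" for h
        unfolding L2_dist_sq_def
      proof (rule integral_cong_AE)
        show "AE \<omega> in P. (cmod (Z h \<omega> - Z f \<omega>))\<^sup>2 = (cmod (X (A h) \<omega> - X (A f) \<omega>))\<^sup>2"
          using Z(2)[OF h] Z(2)[OF f] by eventually_elim simp
      qed (use Z(1)[OF h] Z(1)[OF f] XA[OF h] XA[OF f] in \<open>auto dest!: square_integrable_measurable\<close>)
      have "((\<lambda>k. L2_dist_sq P (X k) (X (A f))) \<longlongrightarrow> 0) (schwartz_nhds (A f))"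
        using X schwartz_op_in[OF A f] by (simp add: gerf_def)
      from filterlim_compose[OF this filterlim_schwartz_op[OF A f]]
      have "((\<lambda>h. L2_dist_sq P (X (A h)) (X (A f))) \<longlongrightarrow> 0) (schwartz_nhds f)" .
      moreover have "\<forall>\<^sub>F h in schwartz_nhds f. L2_dist_sq P (X (A h)) (X (A f)) = L2_dist_sq P (Z h) (Z f)"
        unfolding eventually_schwartz_nhds[OF f] using eq by (intro exI[of _ 0] exI[of _ 0] exI[of _ 1]) auto
      ultimately show ?thesis by (rule Lim_transform_eventually)
    qed
    show "(LINT \<omega>|P. Z f \<omega>) = 0" if f: "f \<in> schwartz" for f
    proof -
      have "(LINT \<omega>|P. Z f \<omega>) = (LINT \<omega>|P. X (A f) \<omega>)"
        by (rule integral_cong_AE) (use Z[OF f] XA[OF f] in \<open>auto dest!: square_integrable_measurable\<close>)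
      then show ?thesis using X schwartz_op_in[OF A f] by (simp add: gerf_def)
    qed
  qed
qed

lemma integral_product_cong:
  assumes "square_integrable P Y" "square_integrable P Z" "square_integrable P Y'" "square_integrable P Z'"
    and "AE \<omega> in P. Y \<omega> = Y' \<omega>" "AE \<omega> in P. Z \<omega> = Z' \<omega>"
  shows "(LINT \<omega>|P. Y \<omega> * cnj (Z \<omega>)) = (LINT \<omega>|P. Y' \<omega> * cnj (Z' \<omega>))"
proof (rule integral_cong_AE)
  show "AE \<omega> in P. Y \<omega> * cnj (Z \<omega>) = Y' \<omega> * cnj (Z' \<omega>)"
    using assms(5,6) by eventually_elim simp
qed (use assms in \<open>auto dest!: square_integrable_measurable intro!: borel_measurable_times borel_measurable_continuous_on[OF continuous_on_cnj[OF continuous_on_id]]\<close>)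

section \<open>Stationary solutions\<close>

text \<open>The function \<open>1 / \<bar>g\<bar>\<^sup>2\<close>, written as a product so that
  closure of O_M under products and conjugates applies directly.\<close>

definition inv_sq :: "('a::euclidean_space \<Rightarrow> complex) \<Rightarrow> 'a \<Rightarrow> complex" where
  "inv_sq g x = 1 / g x * cnj (1 / g x)"

text \<open>In terms of spectral measures, passage to the density
  \<open>1 / \<bar>g\<bar>\<^sup>2\<close>. The restriction to \<open>schwartz\<close> makes the
  functional extensional, so that uniqueness can be stated as an equality.\<close>

definition solution_covariance ::
    "('a::euclidean_space \<Rightarrow> complex) \<Rightarrow> (('a \<Rightarrow> complex) \<Rightarrow> complex) \<Rightarrow> ('a \<Rightarrow> complex) \<Rightarrow> complex" where
  "solution_covariance g \<rho> = (\<lambda>h\<in>schwartz. \<rho> (multiplier (inv_sq g) h))"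

lemma inv_sq_si: "(\<lambda>x. 1 / g x) \<in> slowly_increasing \<Longrightarrow> inv_sq g \<in> slowly_increasing"
  unfolding inv_sq_def[abs_def] by (intro si_mult si_cnj)

lemma inv_sq_cnj: "cnj (inv_sq g x) = inv_sq g x"
  by (simp add: inv_sq_def)

lemma symbol_function_cnj: "symbol_function g \<Longrightarrow> cnj (g (- x)) = g x"
  unfolding symbol_function_def by metis

lemma inv_sq_even:
  assumes "symbol_function g"
  shows "inv_sq g (- x) = inv_sq g x"
proof -
  have "g (- x) = cnj (g x)" using symbol_function_cnj[OF assms, of "- x"] by simp
  then show ?thesis by (simp add: inv_sq_def)
qed

lemma symbol_si:
  assumes "symbol_function g" "\<forall>x. g x \<noteq> 0" "(\<lambda>x. 1 / g x) \<in> slowly_increasing"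
  shows "g \<in> slowly_increasing"
proof -
  have "pbd 0 g"
    using assms(1) unfolding symbol_function_def polynomially_bounded_def pbd_def wbd.simps wt_def power_int_of_nat by blast
  then have "(\<lambda>x. inverse (1 / g x)) \<in> slowly_increasing"
    using assms(2,3) by (intro si_inverse) auto
  then show ?thesis by simp
qed

lemma multiplier_inverse:
  assumes "symbol_function g" "\<forall>x. g x \<noteq> 0" "(\<lambda>x. 1 / g x) \<in> slowly_increasing" "f \<in> schwartz"
  shows "multiplier (\<lambda>x. 1 / g x) (multiplier g f) = f"
proof -
  have "multiplier (\<lambda>x. 1 / g x) (multiplier g f) = multiplier (\<lambda>x. 1 / g x * g x) f"
    by (rule multiplier_multiplier[OF assms(3) symbol_si[OF assms(1-3)] assms(4)])
  also have "(\<lambda>x. 1 / g x * g x) = (\<lambda>x. 1)" using assms(2) by auto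
  finally show ?thesis by (simp add: multiplier_one assms(4))
qed

text \<open>The solution lives on the probability space of \<open>X\<close>, and the operator
  returns \<open>X\<close> almost surely, not only in covariance, because the multipliers of
  \<open>1 / g\<close> and \<open>g\<close> cancel.\<close>

lemma stationary_solution_exists:
  fixes g :: "'a::euclidean_space \<Rightarrow> complex"
  assumes X: "real_stationary_gerf P X \<rho>"
    and g: "symbol_function g" "\<forall>x. g x \<noteq> 0" "(\<lambda>x. 1 / g x) \<in> slowly_increasing"
  shows "stationary_solution g P X P (\<lambda>f. X (multiplier (\<lambda>x. 1 / g x) f)) (solution_covariance g \<rho>)"
proof -
  let ?A = "multiplier (\<lambda>x. 1 / g x)" and ?U = "\<lambda>f. X (multiplier (\<lambda>x. 1 / g x) f)"
  let ?w = "inv_sq g" and ?\<rho>U = "solution_covariance g \<rho>"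
  note g_si = symbol_si[OF g] and w_si = inv_sq_si[OF g(3)]
  note A = schwartz_op_multiplier[OF g(3)] and w = schwartz_op_multiplier[OF w_si]
  note GX = rsg_gerf[OF X] and \<rho> = rsg_tempered[OF X]
  have herm: "1 / g x = cnj (1 / g (- x))" for x
    using symbol_function_cnj[OF g(1), of x] by simp
  have UL2: "square_integrable P (?U f)" if "f \<in> schwartz" for f
    by (rule gerf_L2[OF GX schwartz_op_in[OF A that]])
  have GU: "gerf P ?U" by (rule gerf_transfer[OF GX A]) (auto simp: UL2)
  have RU: "real_gerf P ?U"
    unfolding real_gerf_def
  proof (intro conjI GU ballI impI)
    fix f :: "'a \<Rightarrow> complex" assume f: "f \<in> schwartz" "range f \<subseteq> \<real>"
    show "AE \<omega> in P. ?U f \<omega> \<in> \<real>"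
      using X schwartz_op_in[OF A f(1)] multiplier_real[OF g(3) herm f]
      unfolding real_stationary_gerf_def real_gerf_def by blast
  qed
  have tU: "?\<rho>U \<in> tempered_distributions"
    unfolding solution_covariance_def by (rule tempered_restrict[OF tempered_functional_comp[OF \<rho> w]])
  have rU: "real_distribution ?\<rho>U"
    unfolding real_distribution_def
  proof (intro ballI impI)
    fix f :: "'a \<Rightarrow> complex" assume f: "f \<in> schwartz" "range f \<subseteq> \<real>"
    have "range (multiplier ?w f) \<subseteq> \<real>"
      by (rule multiplier_real[OF w_si _ f]) (simp add: inv_sq_cnj inv_sq_even[OF g(1)])
    then have "\<rho> (multiplier ?w f) \<in> \<real>"
      using X schwartz_op_in[OF w f(1)] by (simp add: real_stationary_gerf_def real_distribution_def)
    then show "?\<rho>U f \<in> \<real>" using f by (simp add: solution_covariance_def)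
  qed
  have eU: "even_distribution ?\<rho>U"
    unfolding even_distribution_def
  proof
    fix f :: "'a \<Rightarrow> complex"
    show "dist_reflect ?\<rho>U f = ?\<rho>U f"
    proof (cases "f \<in> schwartz")
      case True
      have "\<rho> (reflect (multiplier ?w f)) = \<rho> (multiplier ?w f)"
        using X schwartz_op_in[OF w True]
        unfolding real_stationary_gerf_def even_distribution_def dist_reflect_def by (metis restrict_apply')
      then show ?thesis using True
        by (simp add: dist_reflect_def solution_covariance_def schwartz_reflect
            multiplier_reflect[OF w_si inv_sq_even[OF g(1)]])
    next
      case False
      then show ?thesis by (simp add: dist_reflect_def solution_covariance_def)
    qed
  qed
  \<comment> \<open>A covariance distribution acts on functions of two variables,
    \<open>\<rho>\<close> on functions of one; \<open>diagonal_integral\<close> bridges the two and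
    keeps the functional tempered.\<close>
  define C where "C = (\<lambda>\<Phi>\<in>schwartz. \<rho> (multiplier ?w (diagonal_integral \<Phi>)))"
  have tC: "C \<in> tempered_distributions"
    unfolding C_def
    by (rule tempered_restrict[OF tempered_functional_comp[OF \<rho> schwartz_op_comp[OF w schwartz_op_diagonal_integral]]])
  have conv_in: "fun_convolution f (reflect (\<lambda>x. cnj (h x))) \<in> schwartz" if "f \<in> schwartz" "h \<in> schwartz" for f h :: "'a \<Rightarrow> complex"
    using schwartz_op_in[OF schwartz_op_diagonal_integral tensor_schwartz[OF that(1) schwartz_cnj[OF that(2)]]]
    by (simp add: diagonal_integral_tensor[OF that(1) schwartz_cnj[OF that(2)]])
  have C1: "C (tensor f (\<lambda>x. cnj (h x))) = ?\<rho>U (fun_convolution f (reflect (\<lambda>x. cnj (h x))))"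
    if "f \<in> schwartz" "h \<in> schwartz" for f h
    using conv_in[OF that] tensor_schwartz[OF that(1) schwartz_cnj[OF that(2)]]
    by (simp add: C_def solution_covariance_def diagonal_integral_tensor[OF that(1) schwartz_cnj[OF that(2)]])
  have C2: "(LINT \<omega>|P. ?U f \<omega> * cnj (?U h \<omega>)) = C (tensor f (\<lambda>x. cnj (h x)))"
    if f: "f \<in> schwartz" and h: "h \<in> schwartz" for f h
  proof -
    let ?f = "inv_fourier f" and ?h = "inv_fourier h"
    have fS: "?f \<in> schwartz" and hS: "?h \<in> schwartz" using f h by (simp_all add: inv_fourier_schwartz)
    have fh: "(\<lambda>\<xi>. ?f \<xi> * cnj (?h \<xi>)) \<in> schwartz" by (intro schwartz_mult schwartz_si schwartz_cnj fS hS)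
    have "(LINT \<omega>|P. ?U f \<omega> * cnj (?U h \<omega>)) =
        inverse (ftc TYPE('a)) * \<rho> (fourier (\<lambda>\<xi>. (1 / g \<xi> * ?f \<xi>) * cnj (1 / g \<xi> * ?h \<xi>)))"
      unfolding multiplier_def by (rule rsg_covariance[OF X schwartz_mult[OF g(3) fS] schwartz_mult[OF g(3) hS]])
    also have "(\<lambda>\<xi>. (1 / g \<xi> * ?f \<xi>) * cnj (1 / g \<xi> * ?h \<xi>)) = (\<lambda>\<xi>. ?w \<xi> * (?f \<xi> * cnj (?h \<xi>)))"
      by (simp add: inv_sq_def)
    also have "fourier \<dots> = multiplier ?w (fourier (\<lambda>\<xi>. ?f \<xi> * cnj (?h \<xi>)))"
      by (rule multiplier_fourier[OF fh, symmetric])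
    also have "inverse (ftc TYPE('a)) * \<rho> \<dots> = \<rho> (multiplier ?w (\<lambda>x. inverse (ftc TYPE('a)) * fourier (\<lambda>\<xi>. ?f \<xi> * cnj (?h \<xi>)) x))"
      by (rule tempered_functional_cmult[OF tempered_functional_comp[OF \<rho> w] fourier_schwartz[OF fh], symmetric])
    also have "(\<lambda>x. inverse (ftc TYPE('a)) * fourier (\<lambda>\<xi>. ?f \<xi> * cnj (?h \<xi>)) x) = fun_convolution f (reflect (\<lambda>x. cnj (h x)))"
      using convolution_cnj[OF fS hS] by (simp add: fourier_inv_fourier f h)
    also have "\<rho> (multiplier ?w \<dots>) = ?\<rho>U (fun_convolution f (reflect (\<lambda>x. cnj (h x))))"
      using conv_in[OF f h] by (simp add: solution_covariance_def)
    finally show ?thesis by (simp only: C1[OF f h])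
  qed
  have covU: "covariance_distribution P ?U C"
    unfolding covariance_distribution_def using GU tC C2 by blast
  have rsgU: "real_stationary_gerf P ?U ?\<rho>U"
    unfolding real_stationary_gerf_def using RU tU rU eU covU C1 by blast
  have L: "square_integrable P (symbol_operator P g ?U f)" "AE \<omega> in P. symbol_operator P g ?U f \<omega> = X f \<omega>"
    if f: "f \<in> schwartz" for f
    using symbol_operator_schwartz[OF rsgU g_si f] by (simp_all add: multiplier_inverse[OF g f])
  have GL: "gerf P (symbol_operator P g ?U)"
    by (rule gerf_transfer[OF GX schwartz_op_id]) (use L in auto)
  obtain CX where CX: "covariance_distribution P X CX"
    using X by (auto simp: real_stationary_gerf_def)
  have "covariance_distribution P (symbol_operator P g ?U) CX"
    unfolding covariance_distribution_def
  proof (intro conjI ballI GL)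
    show "CX \<in> tempered_distributions" using CX by (simp add: covariance_distribution_def)
    fix f h :: "'a \<Rightarrow> complex" assume fh: "f \<in> schwartz" "h \<in> schwartz"
    have "(LINT \<omega>|P. symbol_operator P g ?U f \<omega> * cnj (symbol_operator P g ?U h \<omega>)) = (LINT \<omega>|P. X f \<omega> * cnj (X h \<omega>))"
      by (intro integral_product_cong L fh gerf_L2[OF GX])
    then show "(LINT \<omega>|P. symbol_operator P g ?U f \<omega> * cnj (symbol_operator P g ?U h \<omega>)) = CX (tensor f (\<lambda>x. cnj (h x)))"
      using CX fh by (simp add: covariance_distribution_def)
  qed
  with CX have "second_order_eq P (symbol_operator P g ?U) P X" unfolding second_order_eq_def by blast
  with rsgU show ?thesis by (simp add: stationary_solution_def)
qed

text \<open>With \<open>b\<close> a Gaussian, which is real, the regularization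
  \<open>gauss d * f\<close> is itself one of the products.\<close>

lemma tempered_functional_eq_products:
  fixes T S :: "('a::euclidean_space \<Rightarrow> complex) \<Rightarrow> complex"
  assumes "tempered_functional T" "tempered_functional S"
    and eq: "\<And>a b. a \<in> schwartz \<Longrightarrow> b \<in> schwartz \<Longrightarrow> T (\<lambda>x. a x * cnj (b x)) = S (\<lambda>x. a x * cnj (b x))"
    and f: "f \<in> schwartz"
  shows "T f = S f"
proof (rule tempered_functional_eqI[OF assms(1,2) _ f])
  fix d :: real assume "0 < d"
  then show "T (\<lambda>x. gauss d x * f x) = S (\<lambda>x. gauss d x * f x)"
    using eq[OF f gauss_schwartz[of d]] by (simp add: mult.commute)
qed

text \<open>Comparing covariances at \<open>fourier a\<close> and \<open>fourier b\<close>
  determines \<open>\<rho>\<close> on transforms of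
  \<open>\<bar>g\<bar>\<^sup>2 * a * cnj b\<close>. After extension from products to all Schwartz
  functions the symbol is divided out.\<close>

lemma stationary_solution_unique:
  fixes g :: "'a::euclidean_space \<Rightarrow> complex"
  assumes X: "real_stationary_gerf P X \<rho>X"
    and g: "symbol_function g" "\<forall>x. g x \<noteq> 0" "(\<lambda>x. 1 / g x) \<in> slowly_increasing"
    and sol: "stationary_solution g P X Q U \<rho>"
  shows "\<rho> = solution_covariance g \<rho>X"
proof
  note g_si = symbol_si[OF g] and w_si = inv_sq_si[OF g(3)]
  have U: "real_stationary_gerf Q U \<rho>" using sol by (simp add: stationary_solution_def)
  obtain C where C: "covariance_distribution Q (symbol_operator Q g U) C" "covariance_distribution P X C"
    using sol by (auto simp: stationary_solution_def second_order_eq_def)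
  let ?u = "\<lambda>\<xi>. g \<xi> * cnj (g \<xi>)"
  have u_si: "?u \<in> slowly_increasing" by (intro si_mult si_cnj g_si)
  have uw: "?u \<xi> * inv_sq g \<xi> = 1" for \<xi>
    using g(2) by (simp add: inv_sq_def)
  have key: "\<rho> (fourier (\<lambda>\<xi>. ?u \<xi> * (a \<xi> * cnj (b \<xi>)))) = \<rho>X (fourier (\<lambda>\<xi>. a \<xi> * cnj (b \<xi>)))"
    if a: "a \<in> schwartz" and b: "b \<in> schwartz" for a b
  proof -
    let ?L = "symbol_operator Q g U"
    note fa = fourier_schwartz[OF a] and fb = fourier_schwartz[OF b]
    have ga: "(\<lambda>\<xi>. g \<xi> * a \<xi>) \<in> schwartz" and gb: "(\<lambda>\<xi>. g \<xi> * b \<xi>) \<in> schwartz"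
      by (intro schwartz_mult g_si a b)+
    have "(LINT \<omega>|Q. ?L (fourier a) \<omega> * cnj (?L (fourier b) \<omega>)) =
        (LINT \<omega>|Q. U (fourier (\<lambda>\<xi>. g \<xi> * a \<xi>)) \<omega> * cnj (U (fourier (\<lambda>\<xi>. g \<xi> * b \<xi>)) \<omega>))"
      using symbol_operator_schwartz[OF U g_si fa] symbol_operator_schwartz[OF U g_si fb]
        gerf_L2[OF rsg_gerf[OF U] fourier_schwartz[OF ga]] gerf_L2[OF rsg_gerf[OF U] fourier_schwartz[OF gb]]
      unfolding multiplier_fourier[OF a] multiplier_fourier[OF b]
      by (intro integral_product_cong)
    also have "\<dots> = inverse (ftc TYPE('a)) * \<rho> (fourier (\<lambda>\<xi>. (g \<xi> * a \<xi>) * cnj (g \<xi> * b \<xi>)))"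
      by (rule rsg_covariance[OF U ga gb])
    also have "(\<lambda>\<xi>. (g \<xi> * a \<xi>) * cnj (g \<xi> * b \<xi>)) = (\<lambda>\<xi>. ?u \<xi> * (a \<xi> * cnj (b \<xi>)))"
      by (simp add: mult_ac)
    finally have 1: "C (tensor (fourier a) (\<lambda>x. cnj (fourier b x))) =
        inverse (ftc TYPE('a)) * \<rho> (fourier (\<lambda>\<xi>. ?u \<xi> * (a \<xi> * cnj (b \<xi>))))"
      using C(1) fa fb by (simp add: covariance_distribution_def)
    have 2: "C (tensor (fourier a) (\<lambda>x. cnj (fourier b x))) =
        inverse (ftc TYPE('a)) * \<rho>X (fourier (\<lambda>\<xi>. a \<xi> * cnj (b \<xi>)))"
      using C(2) fa fb rsg_covariance[OF X a b] by (simp add: covariance_distribution_def)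
    from 1 2 show ?thesis by simp
  qed
  have T1: "tempered_functional (\<lambda>k. \<rho> (fourier (\<lambda>\<xi>. ?u \<xi> * k \<xi>)))"
    by (intro tempered_functional_comp[OF rsg_tempered[OF U] schwartz_op_comp[OF schwartz_op_fourier schwartz_op_mult[OF u_si]]])
  have T2: "tempered_functional (\<lambda>k. \<rho>X (fourier k))"
    by (intro tempered_functional_comp[OF rsg_tempered[OF X] schwartz_op_fourier])
  fix h :: "'a \<Rightarrow> complex"
  show "\<rho> h = solution_covariance g \<rho>X h"
  proof (cases "h \<in> schwartz")
    case True
    \<comment> \<open>Chosen so that multiplication by \<open>?u\<close> restores
      \<open>inv_fourier h\<close>.\<close>
    let ?k = "\<lambda>\<xi>. inv_sq g \<xi> * inv_fourier h \<xi>"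
    have k: "?k \<in> schwartz" by (intro schwartz_mult w_si inv_fourier_schwartz True)
    have "\<rho> (fourier (\<lambda>\<xi>. ?u \<xi> * ?k \<xi>)) = \<rho>X (fourier ?k)"
      by (rule tempered_functional_eq_products[OF T1 T2 key k])
    moreover have "(\<lambda>\<xi>. ?u \<xi> * ?k \<xi>) = inv_fourier h"
    proof
      fix \<xi>
      have "?u \<xi> * ?k \<xi> = (?u \<xi> * inv_sq g \<xi>) * inv_fourier h \<xi>" by (rule mult.assoc[symmetric])
      then show "?u \<xi> * ?k \<xi> = inv_fourier h \<xi>" unfolding uw by (simp only: mult_1)
    qed
    ultimately have "\<rho> (fourier (inv_fourier h)) = \<rho>X (fourier ?k)" by (simp only:)
    then show ?thesis
      unfolding fourier_inv_fourier[OF True] solution_covariance_def multiplier_def by (simp only: restrict_apply' True)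
  next
    case False
    \<comment> \<open>Outside the Schwartz space both functionals take the value
      \<open>undefined\<close>.\<close>
    have "\<rho> \<in> extensional schwartz"
      using U unfolding real_stationary_gerf_def tempered_iff by blast
    from extensional_arb[OF this False] show ?thesis
      using False by (simp add: solution_covariance_def)
  qed
qed

text \<open>The L2 pairing of \<open>fourier a\<close> with \<open>fourier b\<close> is a
  convolution evaluated at 0. This identifies \<open>\<rho>\<close> on transforms of products, and
  these determine it.\<close>

lemma white_noise_covariance:
  fixes W :: "('a::euclidean_space \<Rightarrow> complex) \<Rightarrow> 'w \<Rightarrow> complex"
  assumes W: "white_noise N W" and rsg: "real_stationary_gerf N W \<rho>" and h: "h \<in> schwartz"
  shows "\<rho> h = h 0"
proof -
  have T1: "tempered_functional (\<lambda>k. \<rho> (fourier k))"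
    by (rule tempered_functional_comp[OF rsg_tempered[OF rsg] schwartz_op_fourier])
  have delta: "tempered_functional (\<lambda>k::'a \<Rightarrow> complex. k 0)"
    unfolding tempered_functional_def
  proof (intro conjI ballI allI)
    show "\<exists>n k K. \<forall>f\<in>schwartz. \<forall>C. wbd n (- int k) C (f :: 'a \<Rightarrow> complex) \<longrightarrow> cmod (f 0) \<le> K * C"
      using wbd_bound[where x = 0] by (intro exI[of _ 0] exI[of _ "1::real"]) fastforce
  qed simp
  have T2: "tempered_functional (\<lambda>k. fourier k (0::'a))"
    by (rule tempered_functional_comp[OF delta schwartz_op_fourier])
  have "\<rho> (fourier (\<lambda>\<xi>. a \<xi> * cnj (b \<xi>))) = fourier (\<lambda>\<xi>. a \<xi> * cnj (b \<xi>)) 0"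
    if a: "a \<in> schwartz" and b: "b \<in> schwartz" for a b
  proof -
    have "inverse (ftc TYPE('a)) * \<rho> (fourier (\<lambda>\<xi>. a \<xi> * cnj (b \<xi>))) =
        (LINT \<omega>|N. W (fourier a) \<omega> * cnj (W (fourier b) \<omega>))"
      by (rule rsg_covariance[OF rsg a b, symmetric])
    also have "\<dots> = (LINT x|lborel. fourier a x * cnj (fourier b x))"
      using W fourier_schwartz[OF a] fourier_schwartz[OF b]
      by (auto simp: white_noise_def covariance_distribution_def)
    also have "\<dots> = fun_convolution (fourier a) (reflect (\<lambda>x. cnj (fourier b x))) 0"
      by (simp add: fun_convolution_def reflect_def)
    also have "\<dots> = inverse (ftc TYPE('a)) * fourier (\<lambda>\<xi>. a \<xi> * cnj (b \<xi>)) 0"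
      by (simp only: convolution_cnj[OF a b])
    finally show ?thesis by simp
  qed
  then have "\<rho> (fourier (inv_fourier h)) = fourier (inv_fourier h) 0"
    by (rule tempered_functional_eq_products[OF T1 T2 _ inv_fourier_schwartz[OF h]])
  then show ?thesis unfolding fourier_inv_fourier[OF h] .
qed

text \<open>Evaluation of the multiplier at 0 is integration of \<open>fourier h\<close> against
  \<open>ftc * inv_sq g\<close>, a function in O_M. For the convolution, multipliers commute with
  translations, so the value at 0 for the translate of \<open>f\<close> by \<open>x\<close> is the
  value at \<open>x\<close> for \<open>f\<close>.\<close>

lemma solution_covariance_delta:
  fixes g :: "'a::euclidean_space \<Rightarrow> complex"
  assumes g: "symbol_function g" "(\<lambda>x. 1 / g x) \<in> slowly_increasing"
    and \<rho>: "\<And>h. h \<in> schwartz \<Longrightarrow> \<rho> h = h 0"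
  shows "solution_covariance g \<rho> \<in> convolvable"
    and "f \<in> schwartz \<Longrightarrow> dist_conv_fun (dist_reflect (solution_covariance g \<rho>)) f = multiplier (inv_sq g) f"
proof -
  let ?w = "inv_sq g"
  note w_si = inv_sq_si[OF g(2)]
  note w = schwartz_op_multiplier[OF w_si]
  have val: "solution_covariance g \<rho> h = multiplier ?w h 0" if "h \<in> schwartz" for h
    using that \<rho>[OF schwartz_op_in[OF w that]] by (simp add: solution_covariance_def)
  have val': "multiplier ?w h 0 = (LINT x|lborel. (ftc TYPE('a) * ?w x) * fourier h x)" if h: "h \<in> schwartz" for h
  proof -
    have m: "(\<lambda>x. ?w x * fourier h x) \<in> borel_measurable borel"
      by (intro schwartz_measurable schwartz_mult w_si fourier_schwartz h)
    \<comment> \<open>Reflecting the variable turns \<open>inv_fourier\<close> into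
      \<open>fourier\<close>; the evenness of \<open>inv_sq g\<close> absorbs the sign.\<close>
    have "charf (- 0) x * (?w x * inv_fourier h x) = ?w (- x) * fourier h (- x)" for x
      unfolding inv_fourier_reflect reflect_def inv_sq_even[OF g(1)] by (simp add: charf_def)
    then have "multiplier ?w h 0 = ftc TYPE('a) * (LINT x|lborel. ?w (- x) * fourier h (- x))"
      unfolding multiplier_def fourier_charf[of _ 0] by (simp only:)
    also have "\<dots> = ftc TYPE('a) * (LINT x|lborel. ?w x * fourier h x)"
      by (simp only: integral_reflect[OF m])
    finally show ?thesis by (simp add: mult.assoc)
  qed
  have "solution_covariance g \<rho> = dist_fourier (dist_of_fun (\<lambda>x. ftc TYPE('a) * ?w x))"
  proof
    fix h :: "'a \<Rightarrow> complex"
    show "solution_covariance g \<rho> h = dist_fourier (dist_of_fun (\<lambda>x. ftc TYPE('a) * ?w x)) h"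
    proof (cases "h \<in> schwartz")
      case True
      then show ?thesis using val val' by (simp add: dist_fourier_def dist_of_fun_def fourier_schwartz)
    next
      case False
      then show ?thesis by (simp add: dist_fourier_def solution_covariance_def)
    qed
  qed
  then show "solution_covariance g \<rho> \<in> convolvable"
    unfolding convolvable_def using si_cmult[OF w_si] by blast
  show "dist_conv_fun (dist_reflect (solution_covariance g \<rho>)) f = multiplier ?w f" if f: "f \<in> schwartz"
  proof
    fix x :: 'a
    have tr: "(\<lambda>y. f (x + y)) \<in> schwartz" by (rule schwartz_translate[OF f])
    have eq: "(\<lambda>y. f (x - y)) = reflect (\<lambda>y. f (x + y))" by (simp add: reflect_def fun_eq_iff)
    have rr: "reflect (reflect (\<lambda>y. f (x + y))) = (\<lambda>y. f (x + y))" by (simp add: reflect_def fun_eq_iff)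
    have "dist_conv_fun (dist_reflect (solution_covariance g \<rho>)) f x = multiplier ?w (\<lambda>y. f (x + y)) 0"
      unfolding dist_conv_fun_def eq using val[OF tr] by (simp add: dist_reflect_def schwartz_reflect tr rr)
    also have "\<dots> = ftc TYPE('a) * (LINT \<xi>|lborel. ?w \<xi> * inv_fourier (\<lambda>y. f (x + y)) \<xi>)"
      unfolding multiplier_def fourier_charf[of _ 0] by (simp add: charf_def)
    \<comment> \<open>On the Fourier side a translation is multiplication by a character, which
      commutes with the factor \<open>?w\<close>.\<close>
    also have "(\<lambda>\<xi>. ?w \<xi> * inv_fourier (\<lambda>y. f (x + y)) \<xi>) = (\<lambda>\<xi>. charf (- x) \<xi> * (?w \<xi> * inv_fourier f \<xi>))"
      unfolding inv_fourier_reflect reflect_def fourier_translate[OF f]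
      by (intro ext) (simp add: charf_def inner_commute)
    also have "ftc TYPE('a) * (LINT \<xi>|lborel. charf (- x) \<xi> * (?w \<xi> * inv_fourier f \<xi>)) = multiplier ?w f x"
      unfolding multiplier_def fourier_charf[of _ x] ..
    finally show "dist_conv_fun (dist_reflect (solution_covariance g \<rho>)) f x = multiplier ?w f x" .
  qed
qed

text \<open>A formula cannot quantify over types, so the sample spaces of competing solutions have a
  type variable of their own, while existence is witnessed on sample spaces of the types of
  \<open>X\<close> and \<open>W\<close>.\<close>

theorem theorem2:
  fixes P :: "'w measure"
    and X :: "(real ^ 'd \<Rightarrow> complex) \<Rightarrow> 'w \<Rightarrow> complex"
    and \<rho>X :: "(real ^ 'd \<Rightarrow> complex) \<Rightarrow> complex"
    and g :: "real ^ 'd \<Rightarrow> complex"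
  assumes "real_stationary_gerf P X \<rho>X"
    and "symbol_function g"
    and "\<forall>x. g x \<noteq> 0"
    and "(\<lambda>x. 1 / g x) \<in> slowly_increasing"
  shows "\<exists>\<rho>U.
    (\<exists>(Q :: 'w measure) U. stationary_solution g P X Q U \<rho>U) \<and>
    (\<forall>(Q :: 'v measure) U \<rho>. stationary_solution g P X Q U \<rho> \<longrightarrow> \<rho> = \<rho>U) \<and>
    (\<forall>(N :: 'n measure) W. white_noise N W \<longrightarrow>
      (\<exists>\<rho>UW.
        (\<exists>(Q :: 'n measure) V. stationary_solution g N W Q V \<rho>UW) \<and>
        (\<forall>(Q :: 'v measure) V \<rho>. stationary_solution g N W Q V \<rho> \<longrightarrow> \<rho> = \<rho>UW) \<and>
        \<rho>UW \<in> convolvable \<and>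
        \<rho>U = dist_convolution \<rho>UW \<rho>X))"
proof (rule exI[of _ "solution_covariance g \<rho>X"], intro conjI allI impI)
  show "\<exists>(Q :: 'w measure) U. stationary_solution g P X Q U (solution_covariance g \<rho>X)"
    using stationary_solution_exists[OF assms] by blast
  show "\<rho> = solution_covariance g \<rho>X" if "stationary_solution g P X Q U \<rho>" for Q :: "'v measure" and U \<rho>
    by (rule stationary_solution_unique[OF assms that])
next
  fix N :: "'n measure" and W :: "(real ^ 'd \<Rightarrow> complex) \<Rightarrow> 'n \<Rightarrow> complex"
  assume W: "white_noise N W"
  then obtain \<rho>W where rsg: "real_stationary_gerf N W \<rho>W" by (auto simp: white_noise_def)
  note \<rho>W = white_noise_covariance[OF W rsg]
  have "solution_covariance g \<rho>X = dist_convolution (solution_covariance g \<rho>W) \<rho>X"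
    unfolding dist_convolution_def
    by (rule ext) (simp add: solution_covariance_def[of g \<rho>X] solution_covariance_delta(2)[where \<rho> = \<rho>W, OF assms(2,4) \<rho>W] restrict_def)
  then show "\<exists>\<rho>UW.
        (\<exists>(Q :: 'n measure) V. stationary_solution g N W Q V \<rho>UW) \<and>
        (\<forall>(Q :: 'v measure) V \<rho>. stationary_solution g N W Q V \<rho> \<longrightarrow> \<rho> = \<rho>UW) \<and>
        \<rho>UW \<in> convolvable \<and>
        solution_covariance g \<rho>X = dist_convolution \<rho>UW \<rho>X"
    using stationary_solution_exists[OF rsg assms(2-4)] stationary_solution_unique[OF rsg assms(2-4)]
      solution_covariance_delta(1)[where \<rho> = \<rho>W, OF assms(2,4) \<rho>W] by blast
qed

end
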